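(* Let $(X,\{\star_1,\dots,\star_k\})$ be a finite multispindle, $t\in X$, let $a_1,\dots,a_k$ be integer scalars defining the multi-term chain complex $C(X)$, and let $\Sigma=\sum_{i=1}^k a_i$. (1) Assume that $\Sigma=0$ or that the free part of $H_n(X,t)$ is trivial for every $n\ge 0$. Then $$H_{n+1}(\mathcal F^0(X,t))\cong H_n(X,t)\otimes\mathbb Z_\Sigma\quad\text{for every } n\ge 0.$$ (2) If $\Sigma\ne 0$ and $H_n\big((C/\mathcal F^0)(X,t)\big)$ is a free group for every $n\ge 0$, then $$H_{n+1}(\mathcal F^0(X,t))\cong H_{n-1}(\mathcal F^0(X,t))\ \oplus\ H_n\big((C/\mathcal F^0)(X,t)\big)\otimes\mathbb Z_\Sigma\quad\text{for every } n\ge 0.$$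
   Context: A multispindle $(X,\{\star_1,\dots,\star_k\})$ is a set $X$ with binary operations such that $(x\star_\alpha y)\star_\beta z=(x\star_\beta z)\star_\alpha(y\star_\beta z)$ for all $x,y,z\in X$ and all $\alpha,\beta$ (including $\alpha=\beta$), and $x\star_\alpha x=x$ for all $x,\alpha$. The multi-term chain complex $C(X)$ for integer scalars $a_1,\dots,a_k$ has $C_n(X)=\mathbb Z X^{n+1}$ for $n\ge0$ (zero for $n<0$) and $\partial=\sum_r a_r\partial^{\star_r}$, where $\partial^\star_n=\sum_{i=0}^n(-1)^i d_i^\star$ for $n\ge1$, $\partial_0=0$, $d_0^\star(x_0,\dots,x_n)=(x_1,\dots,x_n)$, and $d_i^\star(x_0,\dots,x_n)=(x_0\star x_i,\dots,x_{i-1}\star x_i,x_{i+1},\dots,x_n)$ for $i\geq1$. $C(\{t\})\subset C(X)$ is the subcomplex spanned by tuples $(t,\dots,t)$; $C(X,t):=C(X)/C(\{t\})$ with homology $H_n(X,t)$ (reduced homology). With $s_0(x_0,x_1,\dots,x_n)=(x_0,x_0,x_1,\dots,x_n)$ (also on $C(X,t)$), $\mathcal F^0(X,t)\subset C(X,t)$ is the subcomplex $\mathcal F^0_n(X,t)=s_0(C_{n-1}(X,t))$ (zero for $n\le 0$), and $(C/\mathcal F^0)(X,t):=C(X,t)/\mathcal F^0(X,t)$. Here $\mathbb Z_\Sigma=\mathbb Z/\Sigma\mathbb Z$ (so $\mathbb Z_0=\mathbb Z$), and homology in negative degrees is zero. *)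

theory Defs
  imports "HOL-Algebra.Elementary_Groups" "HOL-Algebra.Free_Abelian_Groups"
begin

section \<open>Multispindles\<close>

text \<open>The operations are \<open>star 1, \<dots>, star k\<close>; only their restrictions to \<open>X\<close> matter.\<close>

definition multispindle :: "'a set \<Rightarrow> nat \<Rightarrow> (nat \<Rightarrow> 'a \<Rightarrow> 'a \<Rightarrow> 'a) \<Rightarrow> bool" where
  "multispindle X k star \<longleftrightarrow>
     (\<forall>\<alpha>\<in>{1..k}. \<forall>x\<in>X. \<forall>y\<in>X. star \<alpha> x y \<in> X) \<and>
     (\<forall>\<alpha>\<in>{1..k}. \<forall>\<beta>\<in>{1..k}. \<forall>x\<in>X. \<forall>y\<in>X. \<forall>z\<in>X.
        star \<beta> (star \<alpha> x y) z = star \<alpha> (star \<beta> x z) (star \<beta> y z)) \<and>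
     (\<forall>\<alpha>\<in>{1..k}. \<forall>x\<in>X. star \<alpha> x x = x)"

section \<open>Chain complexes of abelian groups\<close>

text \<open>Complexes are indexed by all integers; \<open>bd C n\<close> goes from \<open>grp C n\<close> to \<open>grp C (n - 1)\<close>.\<close>

record 'a chain_cpx =
  grp :: "int \<Rightarrow> 'a monoid"
  bd :: "int \<Rightarrow> 'a \<Rightarrow> 'a"

definition homology :: "'a chain_cpx \<Rightarrow> int \<Rightarrow> 'a set monoid" where
  "homology C n =
     (grp C n)\<lparr>carrier := kernel (grp C n) (grp C (n - 1)) (bd C n)\<rparr>
       Mod (bd C (n + 1) ` carrier (grp C (n + 1)))"

definition sub_cpx :: "'a chain_cpx \<Rightarrow> (int \<Rightarrow> 'a set) \<Rightarrow> 'a chain_cpx" where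
  "sub_cpx C S = \<lparr>grp = (\<lambda>n. (grp C n)\<lparr>carrier := S n\<rparr>), bd = bd C\<rparr>"

text \<open>
  For a homomorphism \<open>f : G \<rightarrow> H\<close> and a subgroup \<open>N\<close> of \<open>H\<close>, this sends a coset \<open>g + M\<close> in \<open>G\<close>
  to the coset \<open>f g + N\<close>, provided that \<open>f\<close> maps \<open>M\<close> into \<open>N\<close>.
\<close>

definition coset_map :: "'b monoid \<Rightarrow> 'b set \<Rightarrow> ('a \<Rightarrow> 'b) \<Rightarrow> 'a set \<Rightarrow> 'b set" where
  "coset_map H N f A = N <#>\<^bsub>H\<^esub> (f ` A)"

definition quot_cpx :: "'a chain_cpx \<Rightarrow> (int \<Rightarrow> 'a set) \<Rightarrow> 'a set chain_cpx" where
  "quot_cpx C S =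
     \<lparr>grp = (\<lambda>n. grp C n Mod S n),
      bd = (\<lambda>n. coset_map (grp C (n - 1)) (S (n - 1)) (bd C n))\<rparr>"

section \<open>The multi-term complex and its subquotients\<close>

definition tuples :: "'a set \<Rightarrow> int \<Rightarrow> 'a list set" where
  "tuples X n = {xs. 0 \<le> n \<and> int (length xs) = n + 1 \<and> set xs \<subseteq> X}"

text \<open>For \<open>i = 0\<close> this deletes the head of the list, for every operation.\<close>

definition face :: "('a \<Rightarrow> 'a \<Rightarrow> 'a) \<Rightarrow> nat \<Rightarrow> 'a list \<Rightarrow> 'a list" where
  "face op i xs = map (\<lambda>y. op y (xs ! i)) (take i xs) @ drop (Suc i) xs"

definition one_term_bd :: "('a \<Rightarrow> 'a \<Rightarrow> 'a) \<Rightarrow> int \<Rightarrow> ('a list \<Rightarrow>\<^sub>0 int) \<Rightarrow> ('a list \<Rightarrow>\<^sub>0 int)" where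
  "one_term_bd op n c =
     (if n \<ge> 1
      then frag_extend (\<lambda>xs. \<Sum>i=0..nat n. frag_cmul ((-1) ^ i) (frag_of (face op i xs))) c
      else 0)"

definition multi_cpx ::
  "'a set \<Rightarrow> nat \<Rightarrow> (nat \<Rightarrow> 'a \<Rightarrow> 'a \<Rightarrow> 'a) \<Rightarrow> (nat \<Rightarrow> int) \<Rightarrow> ('a list \<Rightarrow>\<^sub>0 int) chain_cpx" where
  "multi_cpx X k star a =
     \<lparr>grp = (\<lambda>n. free_Abelian_group (tuples X n)),
      bd = (\<lambda>n c. \<Sum>r=1..k. frag_cmul (a r) (one_term_bd (star r) n c))\<rparr>"

text \<open>The chains of \<open>C({t})\<close>, as subgroups of those of \<open>C(X)\<close>.\<close>

definition point_chains :: "'a \<Rightarrow> int \<Rightarrow> ('a list \<Rightarrow>\<^sub>0 int) set" where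
  "point_chains t n = carrier (free_Abelian_group (tuples {t} n))"

definition reduced_cpx ::
  "'a set \<Rightarrow> nat \<Rightarrow> (nat \<Rightarrow> 'a \<Rightarrow> 'a \<Rightarrow> 'a) \<Rightarrow> (nat \<Rightarrow> int) \<Rightarrow> 'a
     \<Rightarrow> ('a list \<Rightarrow>\<^sub>0 int) set chain_cpx" where
  "reduced_cpx X k star a t = quot_cpx (multi_cpx X k star a) (point_chains t)"

definition s0 :: "('a list \<Rightarrow>\<^sub>0 int) \<Rightarrow> ('a list \<Rightarrow>\<^sub>0 int)" where
  "s0 = frag_extend (\<lambda>xs. frag_of (hd xs # xs))"

text \<open>
  The map induced by \<open>s0\<close> from degree \<open>n - 1\<close> to degree \<open>n\<close> of the reduced complex, applied to
  all chains. In degrees \<open>n \<le> 0\<close> the reduced complex vanishes in degree \<open>n - 1\<close>, so that this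
  is the trivial subgroup.
\<close>

definition F0_chains ::
  "'a set \<Rightarrow> nat \<Rightarrow> (nat \<Rightarrow> 'a \<Rightarrow> 'a \<Rightarrow> 'a) \<Rightarrow> (nat \<Rightarrow> int) \<Rightarrow> 'a
     \<Rightarrow> int \<Rightarrow> ('a list \<Rightarrow>\<^sub>0 int) set set" where
  "F0_chains X k star a t n =
     coset_map (grp (multi_cpx X k star a) n) (point_chains t n) s0
       ` carrier (grp (reduced_cpx X k star a t) (n - 1))"

definition F0_cpx ::
  "'a set \<Rightarrow> nat \<Rightarrow> (nat \<Rightarrow> 'a \<Rightarrow> 'a \<Rightarrow> 'a) \<Rightarrow> (nat \<Rightarrow> int) \<Rightarrow> 'a
     \<Rightarrow> ('a list \<Rightarrow>\<^sub>0 int) set chain_cpx" where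
  "F0_cpx X k star a t = sub_cpx (reduced_cpx X k star a t) (F0_chains X k star a t)"

definition mod_F0_cpx ::
  "'a set \<Rightarrow> nat \<Rightarrow> (nat \<Rightarrow> 'a \<Rightarrow> 'a \<Rightarrow> 'a) \<Rightarrow> (nat \<Rightarrow> int) \<Rightarrow> 'a
     \<Rightarrow> ('a list \<Rightarrow>\<^sub>0 int) set set chain_cpx" where
  "mod_F0_cpx X k star a t = quot_cpx (reduced_cpx X k star a t) (F0_chains X k star a t)"

section \<open>Abelian groups\<close>

definition is_free_abelian :: "'g monoid \<Rightarrow> bool" where
  "is_free_abelian G \<longleftrightarrow> (\<exists>B :: 'g set. G \<cong> free_Abelian_group B)"

definition torsion_elements :: "'g monoid \<Rightarrow> 'g set" where
  "torsion_elements G = {x \<in> carrier G. \<exists>m::nat. m > 0 \<and> x [^]\<^bsub>G\<^esub> m = \<one>\<^bsub>G\<^esub>}"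

text \<open>For a finitely generated abelian group this is its free part, up to isomorphism.\<close>

definition free_part :: "'g monoid \<Rightarrow> 'g set monoid" where
  "free_part G = G Mod torsion_elements G"

text \<open>
  The tensor product over the integers of abelian groups (written multiplicatively):
  the free abelian group on pairs modulo the bilinearity relations.
\<close>

definition tensor_relations :: "'g monoid \<Rightarrow> 'h monoid \<Rightarrow> ('g \<times> 'h \<Rightarrow>\<^sub>0 int) set" where
  "tensor_relations G H =
     {frag_of (x \<otimes>\<^bsub>G\<^esub> x', y) - frag_of (x, y) - frag_of (x', y) | x x' y.
        x \<in> carrier G \<and> x' \<in> carrier G \<and> y \<in> carrier H} \<union>
     {frag_of (x, y \<otimes>\<^bsub>H\<^esub> y') - frag_of (x, y) - frag_of (x, y') | x y y'.
        x \<in> carrier G \<and> y \<in> carrier H \<and> y' \<in> carrier H}"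

definition tensor :: "'g monoid \<Rightarrow> 'h monoid \<Rightarrow> ('g \<times> 'h \<Rightarrow>\<^sub>0 int) set monoid" where
  "tensor G H =
     free_Abelian_group (carrier G \<times> carrier H)
       Mod generate (free_Abelian_group (carrier G \<times> carrier H)) (tensor_relations G H)"

definition Z_mod :: "int \<Rightarrow> int monoid" where
  "Z_mod m = integer_mod_group (nat \<bar>m\<bar>)"

end

theory Submission
  imports Defs "HOL-Algebra.Multiplicative_Group" "HOL-Computational_Algebra.Primes"
begin

text \<open>
  Let \<open>C\<close> be the reduced complex with differential \<open>D\<close>, let \<open>N\<close> be the sum of the scalars, let \<open>s\<close>
  be the degeneracy that repeats the first entry of a tuple, and let \<open>d\<close> delete the first entry.
  The relations between faces and degeneracy give \<open>d s = 1\<close>, \<open>D s = N s d - s D\<close> and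
  \<open>d D = N d d - D d\<close>. In the composite \<open>s d\<close> the two correction terms agree, so \<open>s d\<close> is an idempotent
  chain map. Its image is the degenerate subcomplex \<open>F\<close>, so that \<open>C = F \<oplus> K\<close> for the kernel \<open>K\<close> of \<open>d\<close>,
  and \<open>K\<close> is a model of the quotient complex \<open>C / F\<close>.

  The map \<open>s\<close> identifies \<open>C\<^sub>n\<close> with \<open>F\<^sub>n\<^sub>+\<^sub>1\<close>, where it becomes a complex with differential \<open>N d - D\<close>. For
  \<open>N = 0\<close> this is \<open>C\<close> up to sign. In general, write an element of \<open>C\<^sub>n\<close> as \<open>s (g + y) + x\<close> with
  \<open>g \<in> F\<^sub>n\<^sub>-\<^sub>1\<close>, \<open>y \<in> K\<^sub>n\<^sub>-\<^sub>1\<close> and \<open>x \<in> K\<^sub>n\<close>. In these coordinates the complex is the sum of a shifted copy of \<open>F\<close>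
  and of the mapping cone of multiplication by \<open>N\<close> on \<open>K\<close>. As \<open>X\<close> is finite, the chain groups are
  free of finite rank; hence the homology of the cone splits as in the universal coefficient theorem, and
  \<open>H\<^sub>n\<^sub>+\<^sub>1 F \<cong> H\<^sub>n\<^sub>-\<^sub>1 F \<oplus> H\<^sub>n K / N \<oplus> (H\<^sub>n\<^sub>-\<^sub>1 K)[N]\<close>; this is \<open>HF_recursion_iso\<close>.

  If \<open>N \<noteq> 0\<close> and the homology of \<open>K\<close> is free, then the last summand vanishes. If the homology of \<open>C\<close> consists of
  torsion groups, then it is finite in each degree, and so is that of \<open>K\<close>. A finite abelian group \<open>A\<close>
  satisfies \<open>A[N] \<cong> A / N\<close>, although not naturally (\<open>finite_mult_torsion_iso_mult_quotient\<close>), and by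
  induction on \<open>n\<close> the recursion becomes \<open>H\<^sub>n\<^sub>+\<^sub>1 F \<cong> H\<^sub>n F / N \<oplus> H\<^sub>n K / N \<cong> H\<^sub>n C / N\<close>. Finally, \<open>A / N\<close> is
  \<open>A \<otimes> \<int>\<^sub>N\<close> (\<open>mult_quotient_iso_tensor_Z_mod\<close>).

  All computations take place among formal integer combinations of tuples: a class of chains modulo
  the tuples \<open>(t, \<dots>, t)\<close> is represented by the chain in which these tuples do not occur.
\<close>

section \<open>Multiples and torsion in abelian groups\<close>

text \<open>
  Multiplicative versions of \<open>A / m A\<close> and of the \<open>m\<close>-torsion \<open>A[m]\<close>; for \<open>m \<noteq> 0\<close> they
  are the values at \<open>A\<close> of tensor and Tor with \<open>\<int>\<^sub>m\<close>.
\<close>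

definition mult_quotient :: "('a, 'b) monoid_scheme \<Rightarrow> int \<Rightarrow> 'a set monoid" where
  "mult_quotient G m = G Mod ((\<lambda>x. x [^]\<^bsub>G\<^esub> m) ` carrier G)"

definition mult_torsion :: "('a, 'b) monoid_scheme \<Rightarrow> int \<Rightarrow> ('a, 'b) monoid_scheme" where
  "mult_torsion G m = G\<lparr>carrier := {x \<in> carrier G. x [^]\<^bsub>G\<^esub> m = \<one>\<^bsub>G\<^esub>}\<rparr>"

lemma comm_group_subgroup:
  assumes "comm_group G" "subgroup H G"
  shows "comm_group (G\<lparr>carrier := H\<rparr>)"
proof -
  interpret comm_group G by fact
  interpret GH: group "G\<lparr>carrier := H\<rparr>"
    by (rule subgroup.subgroup_is_group[OF assms(2) is_group])
  show ?thesis
    by (rule GH.group_comm_groupI) (simp add: m_comm subgroup.mem_carrier[OF assms(2)])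
qed

lemma comm_group_DirProd:
  assumes "comm_group G" "comm_group H"
  shows "comm_group (G \<times>\<times> H)"
proof -
  interpret G: comm_group G by fact
  interpret H: comm_group H by fact
  interpret GH: group "G \<times>\<times> H" by (rule DirProd_group) (unfold_locales)
  show ?thesis
    by (rule GH.group_comm_groupI) (auto simp: mult_DirProd' G.m_comm H.m_comm)
qed

lemma comm_group_iso_sym: "comm_group G \<Longrightarrow> G \<cong> H \<Longrightarrow> H \<cong> G"
  using comm_group.axioms(2) group.iso_sym by blast

lemma DirProd_iso_cong:
  assumes "G \<cong> G'" "H \<cong> H'"
  shows "G \<times>\<times> H \<cong> G' \<times>\<times> H'"
proof -
  obtain f g where f: "f \<in> iso G G'" and g: "g \<in> iso H H'"
    using assms by (auto simp: is_iso_def)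
  have "(\<lambda>(x,y). (f x, g y)) \<in> iso (G \<times>\<times> H) (G' \<times>\<times> H')"
    using f g by (auto simp: iso_def hom_def Pi_def bij_betw_def inj_on_def image_iff) blast+
  then show ?thesis by (auto simp: is_iso_def)
qed

lemma trivial_groups_iso:
  assumes "group G" "group H" "carrier G = {\<one>\<^bsub>G\<^esub>}" "carrier H = {\<one>\<^bsub>H\<^esub>}"
  shows "G \<cong> H"
proof -
  have "(\<lambda>x. \<one>\<^bsub>H\<^esub>) \<in> iso G H"
    using assms by (auto simp: iso_def hom_def bij_betw_def monoid.l_one group.is_monoid)
  then show ?thesis by (auto simp: is_iso_def)
qed

lemma DirProd_trivial_iso:
  assumes "carrier H = {\<one>\<^bsub>H\<^esub>}"
  shows "G \<times>\<times> H \<cong> G"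
proof -
  have "fst \<in> iso (G \<times>\<times> H) G"
    using assms by (auto simp: iso_def hom_def bij_betw_def inj_on_def mult_DirProd')
  then show ?thesis by (auto simp: is_iso_def)
qed

lemma DirProd_swap_iso: "A \<times>\<times> (B \<times>\<times> C) \<cong> (A \<times>\<times> C) \<times>\<times> B"
proof -
  have "(\<lambda>(a, b, c). ((a, c), b)) \<in> iso (A \<times>\<times> (B \<times>\<times> C)) ((A \<times>\<times> C) \<times>\<times> B)"
    by (auto simp: iso_def hom_def bij_betw_def inj_on_def mult_DirProd' image_iff)
  then show ?thesis by (auto simp: is_iso_def)
qed

text \<open>
  The first isomorphism theorem for a kernel given by a membership condition. The last two claims
  evaluate the induced isomorphism on cosets, so that it can be compared with other maps.
\<close>

lemma Mod_iso_of_surjective_hom: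
  assumes "group G" "group H" "f \<in> hom G H" "f ` carrier G = carrier H"
    and "\<And>x. x \<in> carrier G \<Longrightarrow> f x = \<one>\<^bsub>H\<^esub> \<longleftrightarrow> x \<in> N" "N \<subseteq> carrier G"
  shows "(\<lambda>X. the_elem (f ` X)) \<in> iso (G Mod N) H" "G Mod N \<cong> H"
    "subgroup N G"
    "\<And>x. x \<in> carrier G \<Longrightarrow> the_elem (f ` (N #>\<^bsub>G\<^esub> x)) = f x"
    "\<And>x y. x \<in> carrier G \<Longrightarrow> y \<in> N #>\<^bsub>G\<^esub> x \<Longrightarrow> f y = f x"
proof -
  interpret group_hom G H f using assms by (simp add: group_hom_def group_hom_axioms_def)
  have k: "kernel G H f = N" using assms(5,6) by (auto simp: kernel_def)
  show "(\<lambda>X. the_elem (f ` X)) \<in> iso (G Mod N) H" using FactGroup_iso_set[OF assms(4)] k by simp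
  then show "G Mod N \<cong> H" by (auto simp: is_iso_def)
  show sN: "subgroup N G" using subgroup_kernel k by simp
  show eq: "f y = f x" if "x \<in> carrier G" "y \<in> N #>\<^bsub>G\<^esub> x" for x y
  proof -
    from that(2) obtain h where h: "h \<in> N" "y = h \<otimes>\<^bsub>G\<^esub> x" by (auto simp: r_coset_def)
    with assms(6) have hc: "h \<in> carrier G" by auto
    have "f h = \<one>\<^bsub>H\<^esub>" using assms(5)[OF hc] h by simp
    then show ?thesis using that h hc by (simp add: hom_mult)
  qed
  show "the_elem (f ` (N #>\<^bsub>G\<^esub> x)) = f x" if "x \<in> carrier G" for x
  proof -
    have "x \<in> N #>\<^bsub>G\<^esub> x" using G.rcos_self[OF that sN] .
    then have "f ` (N #>\<^bsub>G\<^esub> x) = {f x}" using eq[OF that] by blast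
    then show ?thesis by simp
  qed
qed

lemma coset_in_Mod_eq_one:
  assumes "group G" "subgroup N G" "x \<in> carrier G"
  shows "N #>\<^bsub>G\<^esub> x = N \<longleftrightarrow> x \<in> N"
  using group.coset_join1[OF assms(1), of N x] group.coset_join2[OF assms(1,3,2)]
    subgroup.subset[OF assms(2)] assms(2,3) by blast

lemma coset_hom_Mod:
  assumes "comm_group G" "subgroup N G"
  shows "(\<lambda>x. N #>\<^bsub>G\<^esub> x) \<in> hom G (G Mod N)"
proof -
  interpret comm_group G by fact
  show ?thesis using normal.r_coset_hom_Mod[of N G] assms(2) normal_iff_subgroup by blast
qed

text \<open>
  This is the first isomorphism theorem for \<open>f\<close> followed by the projection onto \<open>H Mod M\<close>.
\<close>

lemma Mod_iso_Mod:
  assumes "comm_group G" "comm_group H" "f \<in> hom G H"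
    and "N \<subseteq> carrier G" "subgroup M H"
    and surj: "\<And>y. y \<in> carrier H \<Longrightarrow> \<exists>x\<in>carrier G. M #>\<^bsub>H\<^esub> f x = M #>\<^bsub>H\<^esub> y"
    and ker: "\<And>x. x \<in> carrier G \<Longrightarrow> f x \<in> M \<longleftrightarrow> x \<in> N"
  shows "G Mod N \<cong> H Mod M"
proof (rule Mod_iso_of_surjective_hom(2)[where f = "(\<lambda>x. M #>\<^bsub>H\<^esub> x) \<circ> f"])
  have c: "f x \<in> carrier H" if "x \<in> carrier G" for x using assms(3) that by (auto simp: hom_def)
  show "group G" using assms(1) comm_group_def by blast
  show "group (H Mod M)" using comm_group.abelian_FactGroup[OF assms(2,5)] comm_group_def by blast
  show "(\<lambda>x. M #>\<^bsub>H\<^esub> x) \<circ> f \<in> hom G (H Mod M)"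
    by (rule hom_compose[OF assms(3) coset_hom_Mod[OF assms(2,5)]])
  show "((\<lambda>x. M #>\<^bsub>H\<^esub> x) \<circ> f) ` carrier G = carrier (H Mod M)"
    using surj c by (fastforce simp: carrier_FactGroup image_iff)
  show "N \<subseteq> carrier G" by fact
  show "((\<lambda>x. M #>\<^bsub>H\<^esub> x) \<circ> f) x = \<one>\<^bsub>H Mod M\<^esub> \<longleftrightarrow> x \<in> N" if "x \<in> carrier G" for x
    using ker[OF that] coset_in_Mod_eq_one[OF _ assms(5) c[OF that]] assms(2) comm_group_def by auto
qed

lemma (in comm_group) powers_subgroup: "subgroup ((\<lambda>x. x [^] (m::int)) ` carrier G) G"
proof (rule subgroupI)
  fix a assume "a \<in> (\<lambda>x. x [^] m) ` carrier G"
  then show "inv a \<in> (\<lambda>x. x [^] m) ` carrier G"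
    by (auto simp: image_iff) (metis inv_closed int_pow_inv)
next
  fix a b assume "a \<in> (\<lambda>x. x [^] m) ` carrier G" "b \<in> (\<lambda>x. x [^] m) ` carrier G"
  then show "a \<otimes> b \<in> (\<lambda>x. x [^] m) ` carrier G"
    by (auto simp: image_iff) (metis m_closed m_comm int_pow_mult_distrib)
qed auto

lemma (in comm_group) torsion_subgroup: "subgroup {x \<in> carrier G. x [^] (m::int) = \<one>} G"
  by (rule subgroupI) (auto simp: int_pow_inv int_pow_mult_distrib m_comm intro: exI[of _ \<one>])

lemma comm_group_mult_quotient: "comm_group G \<Longrightarrow> comm_group (mult_quotient G m)"
  by (simp add: mult_quotient_def comm_group.abelian_FactGroup comm_group.powers_subgroup)

lemma comm_group_mult_torsion: "comm_group G \<Longrightarrow> comm_group (mult_torsion G m)"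
  by (simp add: mult_torsion_def comm_group_subgroup comm_group.torsion_subgroup)

lemma comm_group_hom_int_pow: 
  assumes "comm_group G" "comm_group H" "f \<in> hom G H" "x \<in> carrier G"
  shows "f (x [^]\<^bsub>G\<^esub> (m::int)) = f x [^]\<^bsub>H\<^esub> m"
  by (rule hom_int_pow[OF assms(3,4)]) (use assms comm_group_def in blast)+

lemma mult_quotient_iso:
  assumes "comm_group G" "comm_group H" "G \<cong> H"
  shows "mult_quotient G m \<cong> mult_quotient H m"
proof -
  interpret G: comm_group G by fact
  interpret H: comm_group H by fact
  obtain f where f: "f \<in> iso G H" using assms(3) by (auto simp: is_iso_def)
  then have fh: "f \<in> hom G H" and im: "f ` carrier G = carrier H" and inj: "inj_on f (carrier G)"
    by (auto simp: iso_iff)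
  show ?thesis unfolding mult_quotient_def
  proof (rule Mod_iso_Mod[OF assms(1,2) fh _ comm_group.powers_subgroup[OF assms(2)]])
    show "\<exists>x\<in>carrier G. (\<lambda>x. x [^]\<^bsub>H\<^esub> m) ` carrier H #>\<^bsub>H\<^esub> f x = (\<lambda>x. x [^]\<^bsub>H\<^esub> m) ` carrier H #>\<^bsub>H\<^esub> y"
      if "y \<in> carrier H" for y
      using that im by (metis imageE)
    show "f x \<in> (\<lambda>x. x [^]\<^bsub>H\<^esub> m) ` carrier H \<longleftrightarrow> x \<in> (\<lambda>x. x [^]\<^bsub>G\<^esub> m) ` carrier G"
      if x: "x \<in> carrier G" for x
    proof -
      have "f x \<in> (\<lambda>x. x [^]\<^bsub>H\<^esub> m) ` carrier H \<longleftrightarrow> (\<exists>y\<in>carrier G. f x = f (y [^]\<^bsub>G\<^esub> m))"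
        unfolding im[symmetric] image_image by (simp add: image_iff comm_group_hom_int_pow[OF assms(1,2) fh])
      also have "\<dots> \<longleftrightarrow> (\<exists>y\<in>carrier G. x = y [^]\<^bsub>G\<^esub> m)"
        using inj_on_eq_iff[OF inj x] by (intro bex_cong) auto
      finally show ?thesis by (auto simp: image_iff)
    qed
  qed auto
qed

lemma mult_torsion_iso:
  assumes "comm_group G" "comm_group H" "G \<cong> H"
  shows "mult_torsion G m \<cong> mult_torsion H m"
proof -
  interpret G: comm_group G by fact
  interpret H: comm_group H by fact
  obtain f where f: "f \<in> iso G H" using assms(3) by (auto simp: is_iso_def)
  then have fh: "f \<in> hom G H" and im: "f ` carrier G = carrier H" and inj: "inj_on f (carrier G)"
    by (auto simp: iso_iff)
  have eq: "f x [^]\<^bsub>H\<^esub> m = \<one>\<^bsub>H\<^esub> \<longleftrightarrow> x [^]\<^bsub>G\<^esub> m = \<one>\<^bsub>G\<^esub>" if "x \<in> carrier G" for x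
    unfolding comm_group_hom_int_pow[OF assms(1,2) fh that, symmetric]
      hom_one[OF fh G.is_group H.is_group, symmetric]
    using inj_on_eq_iff[OF inj] that by simp
  have "f \<in> iso (mult_torsion G m) (mult_torsion H m)"
    unfolding iso_iff
  proof (intro conjI)
    show "f \<in> hom (mult_torsion G m) (mult_torsion H m)"
      using fh eq by (auto simp: hom_def mult_torsion_def)
    show "f ` carrier (mult_torsion G m) = carrier (mult_torsion H m)"
      unfolding mult_torsion_def im[symmetric] using eq by auto
    show "inj_on f (carrier (mult_torsion G m))"
      using inj by (auto simp: mult_torsion_def inj_on_def)
  qed
  then show ?thesis by (auto simp: is_iso_def)
qed

lemma DirProd_int_pow:
  assumes "group G" "group H" "x \<in> carrier G" "y \<in> carrier H"
  shows "(x, y) [^]\<^bsub>G \<times>\<times> H\<^esub> (m::int) = (x [^]\<^bsub>G\<^esub> m, y [^]\<^bsub>H\<^esub> m)"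
proof -
  have GH: "group (G \<times>\<times> H)" using DirProd_group assms(1,2) .
  have "fst \<in> hom (G \<times>\<times> H) G" "snd \<in> hom (G \<times>\<times> H) H" by (auto simp: hom_def mult_DirProd')
  from hom_int_pow[OF this(1) _ GH assms(1)] hom_int_pow[OF this(2) _ GH assms(2)]
  have "fst ((x, y) [^]\<^bsub>G \<times>\<times> H\<^esub> m) = x [^]\<^bsub>G\<^esub> m" "snd ((x, y) [^]\<^bsub>G \<times>\<times> H\<^esub> m) = y [^]\<^bsub>H\<^esub> m"
    using assms by auto
  then show ?thesis by (metis prod.collapse)
qed

lemma mult_quotient_DirProd:
  assumes "comm_group G" "comm_group H"
  shows "mult_quotient (G \<times>\<times> H) m \<cong> mult_quotient G m \<times>\<times> mult_quotient H m"
proof -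
  interpret G: comm_group G by fact
  interpret H: comm_group H by fact
  let ?M = "(\<lambda>x. x [^]\<^bsub>G\<^esub> m) ` carrier G" and ?N = "(\<lambda>x. x [^]\<^bsub>H\<^esub> m) ` carrier H"
  have M: "?M \<lhd> G" and N: "?N \<lhd> H"
    using comm_group.powers_subgroup assms by (auto simp: G.normal_iff_subgroup H.normal_iff_subgroup)
  have "(\<lambda>x. x [^]\<^bsub>G \<times>\<times> H\<^esub> m) ` carrier (G \<times>\<times> H) = ?M \<times> ?N"
    using DirProd_int_pow[OF G.is_group H.is_group] by (force simp: image_iff)
  then show ?thesis
    using G.FactGroup_DirProd_multiplication_iso_2[OF H.is_group M N]
    by (simp add: mult_quotient_def)
qed

lemma mult_torsion_DirProd:
  assumes "comm_group G" "comm_group H"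
  shows "mult_torsion (G \<times>\<times> H) m \<cong> mult_torsion G m \<times>\<times> mult_torsion H m"
proof -
  interpret G: comm_group G by fact
  interpret H: comm_group H by fact
  have "id \<in> iso (mult_torsion (G \<times>\<times> H) m) (mult_torsion G m \<times>\<times> mult_torsion H m)"
    using DirProd_int_pow[OF G.is_group H.is_group, of _ _ m]
    by (auto simp: iso_def hom_def mult_torsion_def bij_betw_def mult_DirProd')
  then show ?thesis by (auto simp: is_iso_def)
qed

lemma mult_quotient_of_exponent_dividing:
  assumes "comm_group G" "\<And>x. x \<in> carrier G \<Longrightarrow> x [^]\<^bsub>G\<^esub> m = \<one>\<^bsub>G\<^esub>"
  shows "mult_quotient G m \<cong> G"
proof -
  interpret G: comm_group G by fact
  have 1: "(\<lambda>x. x [^]\<^bsub>G\<^esub> m) ` carrier G = {\<one>\<^bsub>G\<^esub>}"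
    using assms(2) by (auto simp: image_iff intro: bexI[of _ "\<one>\<^bsub>G\<^esub>"])
  show ?thesis unfolding mult_quotient_def 1
    by (rule Mod_iso_of_surjective_hom(2)[where f = "\<lambda>x. x"]) (auto simp: hom_def)
qed

lemma mult_quotient_exponent:
  assumes "comm_group G" "A \<in> carrier (mult_quotient G m)"
  shows "A [^]\<^bsub>mult_quotient G m\<^esub> m = \<one>\<^bsub>mult_quotient G m\<^esub>"
proof -
  interpret G: comm_group G by fact
  let ?M = "(\<lambda>x. x [^]\<^bsub>G\<^esub> m) ` carrier G"
  have s: "subgroup ?M G" by (rule comm_group.powers_subgroup[OF assms(1)])
  then interpret normal ?M G by (simp add: G.normal_iff_subgroup)
  obtain x where x: "x \<in> carrier G" "A = ?M #>\<^bsub>G\<^esub> x" using assms(2) 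
    by (auto simp: mult_quotient_def carrier_FactGroup)
  have "A [^]\<^bsub>mult_quotient G m\<^esub> m = ?M #>\<^bsub>G\<^esub> (x [^]\<^bsub>G\<^esub> m)"
    using FactGroup_int_pow[OF x(1)] x by (simp add: mult_quotient_def)
  also have "\<dots> = ?M" using coset_in_Mod_eq_one[OF G.is_group s] x by auto
  finally show ?thesis by (simp add: mult_quotient_def)
qed

lemma exponent_iso:
  assumes "comm_group G" "comm_group H" "G \<cong> H"
    "\<And>x. x \<in> carrier G \<Longrightarrow> x [^]\<^bsub>G\<^esub> (m::int) = \<one>\<^bsub>G\<^esub>" "y \<in> carrier H"
  shows "y [^]\<^bsub>H\<^esub> m = \<one>\<^bsub>H\<^esub>"
proof -
  interpret G: comm_group G by fact
  interpret H: comm_group H by fact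
  obtain f where f: "f \<in> iso G H" using assms(3) by (auto simp: is_iso_def)
  then have fh: "f \<in> hom G H" and im: "f ` carrier G = carrier H" by (auto simp: iso_iff)
  obtain x where "x \<in> carrier G" "y = f x" using im assms(5) by auto
  then show ?thesis using comm_group_hom_int_pow[OF assms(1,2) fh] assms(4) hom_one[OF fh] by (metis G.is_group H.is_group)
qed

section \<open>Finite abelian groups\<close>

lemma (in comm_group) ord_mult_of_coprime:
  assumes x: "x \<in> carrier G" and y: "y \<in> carrier G" and cop: "coprime (ord x) (ord y)"
  shows "ord (x \<otimes> y) = ord x * ord y"
proof (rule dvd_antisym)
  show "ord (x \<otimes> y) dvd ord x * ord y" using abelian_ord_mul_divides x y by blast
  have *: "ord u dvd ord (u \<otimes> v)" if u: "u \<in> carrier G" and v: "v \<in> carrier G"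
    and c: "coprime (ord u) (ord v)" for u v
  proof -
    let ?n = "ord (u \<otimes> v)"
    have "\<one> = ((u \<otimes> v) [^] ?n) [^] ord v" using u v by simp
    also have "\<dots> = (u [^] ?n \<otimes> v [^] ?n) [^] ord v"
      using pow_mult_distrib[OF m_comm[OF u v] u v, of ?n] by simp
    also have "\<dots> = u [^] (?n * ord v) \<otimes> v [^] (?n * ord v)"
      using u v by (simp add: pow_mult_distrib m_comm nat_pow_pow)
    also have "v [^] (?n * ord v) = \<one>" using pow_eq_id[OF v] by simp
    finally have "u [^] (?n * ord v) = \<one>" using u by simp
    then have "ord u dvd ?n * ord v" using pow_eq_id[OF u] by simp
    then show ?thesis using c by (simp add: coprime_dvd_mult_left_iff)
  qed
  show "ord x * ord y dvd ord (x \<otimes> y)"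
    using *[OF x y cop] *[OF y x] cop by (simp add: divides_mult m_comm x y coprime_commute)
qed

text \<open>
  An element \<open>g\<close> of maximal order works. If some prime \<open>p\<close> divided the order of \<open>x\<close> more often than
  that of \<open>g\<close>, then the \<open>p\<close>-part of \<open>x\<close> and the part of \<open>g\<close> prime to \<open>p\<close> would have coprime orders
  whose product exceeds the order of \<open>g\<close>.
\<close>

lemma (in comm_group) exists_exponent_element:
  assumes fin: "finite (carrier G)"
  obtains g where "g \<in> carrier G" "ord g > 0" "\<And>x. x \<in> carrier G \<Longrightarrow> ord x dvd ord g"
proof -
  have "Max (ord ` carrier G) \<in> ord ` carrier G"
    by (rule Max_in) (use fin in auto)
  then obtain g where g: "g \<in> carrier G" "ord g = Max (ord ` carrier G)" by auto
  have pos: "ord x > 0" if "x \<in> carrier G" for x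
    using ord_ge_1[OF fin that] by simp
  have "ord x dvd ord g" if x: "x \<in> carrier G" for x
  proof (rule ccontr)
    assume "\<not> ord x dvd ord g"
    then obtain p where p: "prime p" "multiplicity p (ord g) < multiplicity p (ord x)"
      using multiplicity_le_imp_dvd[of "ord x" "ord g"] pos[OF x] pos[OF g(1)]
      by (metis linorder_not_le not_gr_zero)
    define a b where "a = multiplicity p (ord g)" and "b = multiplicity p (ord x)"
    have np: "\<not> is_unit p" using p(1) not_prime_unit by blast
    have g0: "ord g \<noteq> 0" and x0: "ord x \<noteq> 0" using pos x g(1) by auto
    obtain u where u: "ord g = p ^ a * u" "\<not> p dvd u"
      using multiplicity_decompose'[OF g0 np] unfolding a_def by metis
    obtain w where w: "ord x = p ^ b * w" "\<not> p dvd w"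
      using multiplicity_decompose'[OF x0 np] unfolding b_def by metis
    have p0: "p > 0" using p(1) prime_gt_0_nat by blast
    have u0: "u > 0" and w0: "w > 0" using u w pos[OF x] pos[OF g(1)] by (auto intro!: Nat.gr0I)
    have 1: "ord (g [^] (p ^ a)) = u" using ord_pow[OF g(1), of "p ^ a"] u p0 by simp
    have 2: "ord (x [^] w) = p ^ b" using ord_pow[OF x, of w] w w0 by simp
    have "coprime (p ^ b) u"
      using p(1) u(2) by (simp add: prime_imp_coprime)
    then have "ord (g [^] (p ^ a) \<otimes> x [^] w) = u * p ^ b"
      using ord_mult_of_coprime[of "g [^] (p ^ a)" "x [^] w"] g x 1 2 by (simp add: coprime_commute)
    moreover have "u * p ^ b > ord g"
    proof -
      have "p ^ a < p ^ b" using p(2) prime_gt_1_nat[OF p(1)] by (simp add: a_def b_def)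
      then show ?thesis using u0 by (simp add: u(1))
    qed
    moreover have "ord (g [^] (p ^ a) \<otimes> x [^] w) \<le> Max (ord ` carrier G)"
      by (rule Max_ge) (use fin g x in auto)
    ultimately show False using g by simp
  qed
  then show ?thesis using that g pos by blast
qed

text \<open>
  Take \<open>B\<close> maximal among the subgroups that meet \<open>\<langle>g\<rangle>\<close> trivially, and suppose that \<open>x\<close> lies outside
  \<open>H = B\<langle>g\<rangle>\<close>. Let \<open>m\<close> be the order of \<open>x\<close> modulo \<open>H\<close> and \<open>x\<^sup>m = b g\<^sup>j\<close>. As the order of \<open>x\<close> divides that
  of \<open>g\<close>, raising this equation to a suitable power shows that \<open>m\<close> divides \<open>j\<close>. Hence \<open>x\<close> can be
  multiplied by a power of \<open>g\<close> to give \<open>y\<close> with \<open>y\<^sup>m = b \<in> B\<close>. Then \<open>B\<langle>y\<rangle>\<close> still meets \<open>\<langle>g\<rangle>\<close> trivially,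
  which contradicts the choice of \<open>B\<close>.
\<close>

lemma (in comm_group) exists_cyclic_complement:
  assumes fin: "finite (carrier G)" and g: "g \<in> carrier G" "ord g > 0"
    and exp: "\<And>x. x \<in> carrier G \<Longrightarrow> ord x dvd ord g"
  obtains B where "subgroup B G" "B \<inter> range (\<lambda>i::int. g [^] i) \<subseteq> {\<one>}"
    "\<And>x. x \<in> carrier G \<Longrightarrow> \<exists>b\<in>B. \<exists>i::int. x = b \<otimes> g [^] i"
proof -
  define P where "P = range (\<lambda>i::int. g [^] i)"
  define \<B> where "\<B> = {B. subgroup B G \<and> B \<inter> P \<subseteq> {\<one>}}"
  have "\<B> \<subseteq> Pow (carrier G)" by (auto simp: \<B>_def dest: subgroup.subset)
  then have "finite \<B>" using fin finite_subset by blast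
  moreover have "{\<one>} \<in> \<B>" by (auto simp: \<B>_def triv_subgroup)
  ultimately obtain B where B: "B \<in> \<B>" and max: "\<And>B'. B' \<in> \<B> \<Longrightarrow> B \<subseteq> B' \<Longrightarrow> B = B'"
    using finite_has_maximal[of \<B>] by (metis empty_iff)
  then have sB: "subgroup B G" and BP: "B \<inter> P \<subseteq> {\<one>}" by (auto simp: \<B>_def)
  interpret B: subgroup B G by fact
  have Bc: "b \<in> carrier G" if "b \<in> B" for b using that B.subset by blast
  have gc: "g [^] (i::int) \<in> carrier G" for i using g by simp
  have Bpow: "b [^] (i::int) \<in> B" if "b \<in> B" for b i using subgroup_int_pow_closed[OF sB that] .
  define H where "H = {b \<otimes> g [^] i | b i. b \<in> B \<and> i \<in> (UNIV :: int set)}"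
  have HI: "b \<otimes> g [^] (i::int) \<in> H" if "b \<in> B" for b i using that by (auto simp: H_def)
  have sH: "subgroup H G"
  proof (rule subgroupI)
    show "H \<subseteq> carrier G" by (auto simp: H_def Bc g)
    show "H \<noteq> {}" using HI B.one_closed by blast
    fix x assume "x \<in> H"
    then obtain b i where x: "x = b \<otimes> g [^] (i::int)" "b \<in> B" by (auto simp: H_def)
    then have "inv x = inv b \<otimes> g [^] (- i)" using Bc gc by (simp add: inv_mult int_pow_neg g)
    then show "inv x \<in> H" using HI B.m_inv_closed x by auto
    fix y assume "y \<in> H"
    then obtain c j where y: "y = c \<otimes> g [^] (j::int)" "c \<in> B" by (auto simp: H_def)
    have "x \<otimes> y = (b \<otimes> c) \<otimes> g [^] (i + j)"
      using x y Bc g by (simp add: int_pow_mult m_ac)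
    then show "x \<otimes> y \<in> H" using HI B.m_closed x y by auto
  qed
  have "carrier G \<subseteq> H"
  proof (rule ccontr)
    assume "\<not> carrier G \<subseteq> H"
    then obtain x where x: "x \<in> carrier G" "x \<notin> H" by auto
    have "x [^] ord x \<in> H" using x subgroup.one_closed[OF sH] by simp
    moreover have "ord x > 0" using exp[OF x(1)] g by (auto intro: Nat.gr0I)
    ultimately have ex: "\<exists>m::nat. m > 0 \<and> x [^] m \<in> H" by blast
    define m where "m = (LEAST m::nat. m > 0 \<and> x [^] m \<in> H)"
    have m: "m > 0" "x [^] m \<in> H" using LeastI_ex[OF ex] by (auto simp: m_def)
    have m_min: "\<not> (k > 0 \<and> x [^] k \<in> H)" if "k < m" for k
      using not_less_Least that unfolding m_def by blast
    (* m is the order of x modulo H, so it divides every exponent of a power of x in H. *)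
    have dvd: "int m dvd i" if i: "x [^] (i::int) \<in> H" for i
    proof -
      define r where "r = nat (i mod int m)"
      have ri: "int r = i + int m * (- (i div int m))" 
        using m by (simp add: r_def minus_mult_div_eq_mod)
      have "x [^] r = x [^] int r" by (simp add: int_pow_int)
      also have "\<dots> = x [^] i \<otimes> (x [^] int m) [^] (- (i div int m))"
        unfolding ri using x by (simp only: int_pow_mult int_pow_pow)
      also have "\<dots> \<in> H" using subgroup.m_closed[OF sH i subgroup_int_pow_closed[OF sH]] m(2)
        by (simp add: int_pow_int)
      finally have "x [^] r \<in> H" .
      moreover have "r < m" using m by (simp add: r_def nat_less_iff)
      ultimately have "r = 0" using m_min[of r] by simp
      then have "i mod int m \<le> 0" by (simp add: r_def)
      moreover have "i mod int m \<ge> 0" using m by simp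
      ultimately show ?thesis by (simp add: dvd_eq_mod_eq_0)
    qed
    have e: "x [^] int (ord g) = \<one>" using exp[OF x(1)] pow_eq_id[OF x(1)] by (simp add: int_pow_int)
    then obtain q where q: "int (ord g) = int m * q"
      using dvd subgroup.one_closed[OF sH] by (metis dvdE)
    have q0: "q \<noteq> 0" using q g by auto
    from m(2) obtain b j where bj: "x [^] int m = b \<otimes> g [^] (j::int)" "b \<in> B"
      by (auto simp: H_def int_pow_int)
    have "\<one> = (x [^] int m) [^] q" using e q x by (simp add: int_pow_pow)
    also have "\<dots> = b [^] q \<otimes> g [^] (j * q)"
      using bj Bc g by (simp add: int_pow_mult_distrib m_comm int_pow_pow)
    finally have one: "\<one> = b [^] q \<otimes> g [^] (j * q)" .
    then have "g [^] (j * q) = inv (b [^] q)"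
      using Bc[OF bj(2)] g by (metis int_pow_closed inv_equality inv_inv inv_closed m_comm)
    then have "g [^] (j * q) \<in> B" using Bpow[OF bj(2)] B.m_inv_closed by simp
    moreover have "g [^] (j * q) \<in> P" by (simp add: P_def)
    ultimately have "g [^] (j * q) = \<one>" using BP by blast
    then have "int (ord g) dvd j * q" using int_pow_eq_id[OF g(1)] by simp
    then have "int m dvd j" using q q0 by (simp add: q)
    then obtain l where l: "j = int m * l" by auto
    define y where "y = x \<otimes> g [^] (- l)"
    have y: "y \<in> carrier G" using x g by (simp add: y_def)
    have xy: "x = y \<otimes> g [^] l" using x g by (simp add: y_def m_assoc int_pow_mult[symmetric])
    have ypow: "y [^] (i::int) = x [^] i \<otimes> g [^] (- l * i)" for i
      using x g by (simp add: y_def int_pow_mult_distrib m_comm int_pow_pow)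
    have ym: "y [^] int m = b"
      using bj Bc g by (simp add: ypow l m_assoc int_pow_mult[symmetric] mult.commute)
    have ydvd: "int m dvd i" if "y [^] (i::int) \<in> H" for i
    proof -
      have "x [^] i = y [^] i \<otimes> (\<one> \<otimes> g [^] (l * i))"
        using x g by (simp add: ypow m_assoc int_pow_mult[symmetric])
      also have "\<dots> \<in> H" using that HI[OF B.one_closed] subgroup.m_closed[OF sH] by blast
      finally show ?thesis by (rule dvd)
    qed
    define B' where "B' = {c \<otimes> y [^] i | c i. c \<in> B \<and> i \<in> (UNIV :: int set)}"
    have B'I: "c \<otimes> y [^] (i::int) \<in> B'" if "c \<in> B" for c i using that by (auto simp: B'_def)
    have sB': "subgroup B' G"
    proof (rule subgroupI)
      show "B' \<subseteq> carrier G" by (auto simp: B'_def Bc y)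
      show "B' \<noteq> {}" using B'I B.one_closed by blast
      fix z assume "z \<in> B'"
      then obtain c i where z: "z = c \<otimes> y [^] (i::int)" "c \<in> B" by (auto simp: B'_def)
      then have "inv z = inv c \<otimes> y [^] (- i)" using Bc y by (simp add: inv_mult int_pow_neg)
      then show "inv z \<in> B'" using B'I B.m_inv_closed z by auto
      fix w assume "w \<in> B'"
      then obtain d k where w: "w = d \<otimes> y [^] (k::int)" "d \<in> B" by (auto simp: B'_def)
      have "z \<otimes> w = (c \<otimes> d) \<otimes> y [^] (i + k)"
        using z w Bc y by (simp add: int_pow_mult m_ac)
      then show "z \<otimes> w \<in> B'" using B'I B.m_closed z w by auto
    qed
    have "B' \<inter> P \<subseteq> {\<one>}"
    proof
      fix z assume "z \<in> B' \<inter> P"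
      then obtain c i k where z: "z = c \<otimes> y [^] (i::int)" "c \<in> B" "z = g [^] (k::int)"
        by (auto simp: B'_def P_def)
      have "y [^] i = inv c \<otimes> z" using z y Bc by (simp add: m_assoc[symmetric])
      then have "y [^] i \<in> H" using z HI[of "inv c" k] B.m_inv_closed by auto
      then obtain k' where "i = int m * k'" using ydvd by (meson dvdE)
      then have "y [^] i = b [^] k'" using ym y by (simp add: int_pow_pow[symmetric])
      then have "z \<in> B" using z Bpow[OF bj(2)] B.m_closed by auto
      then show "z \<in> {\<one>}" using BP \<open>z \<in> B' \<inter> P\<close> by blast
    qed
    then have "B' \<in> \<B>" using sB' by (simp add: \<B>_def)
    moreover have "B \<subseteq> B'"
    proof
      fix c assume "c \<in> B" then show "c \<in> B'" using B'I[of c 0] Bc by simp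
    qed
    ultimately have "B = B'" by (rule max)
    moreover have "y \<in> B'" using B'I[OF B.one_closed, of 1] y by (simp add: int_pow_1)
    ultimately have "x \<in> H" using HI[of y l] xy by simp
    then show False using x by simp
  qed
  then have "\<exists>b\<in>B. \<exists>i::int. x = b \<otimes> g [^] i" if "x \<in> carrier G" for x
    using that unfolding H_def by blast
  then show ?thesis using that[OF sB] BP unfolding P_def by blast
qed

text \<open>
  In the cyclic group of order \<open>e\<close>, with \<open>h = gcd e m\<close>, multiplication by \<open>e / h\<close> has the \<open>m\<close>-torsion
  as its image and the multiples of \<open>m\<close> (equivalently, of \<open>h\<close>) as its kernel.
\<close>

lemma (in comm_group) cyclic_torsion_iso_quotient:
  assumes g: "g \<in> carrier G" "ord g > 0" and gen: "carrier G = range (\<lambda>i::int. g [^] i)"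
  shows "mult_torsion G m \<cong> mult_quotient G m"
proof -
  have cg: "comm_group G" by (rule comm_group_axioms)
  define e h where "e = int (ord g)" and "h = gcd e m"
  have e0: "e > 0" using g by (simp add: e_def)
  have h0: "h > 0" using e0 by (simp add: h_def)
  obtain e' m' where e': "e = h * e'" and m': "m = h * m'"
    by (metis dvdE gcd_dvd1 gcd_dvd2 h_def)
  have cop: "coprime e' m'"
  proof -
    have "gcd e m = h * gcd e' m'" using h0 by (simp add: e' m' gcd_mult_left)
    then show ?thesis using h0 unfolding h_def[symmetric] by (simp add: coprime_iff_gcd_eq_1)
  qed
  have pow1: "g [^] i = \<one> \<longleftrightarrow> e dvd i" for i :: int using int_pow_eq_id[OF g(1)] by (simp add: e_def)
  have fdiv: "e dvd i * m \<longleftrightarrow> e' dvd i" for i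
    using h0 cop by (simp add: e' m' mult.left_commute coprime_dvd_mult_left_iff)
  have "mult_quotient G m \<cong> mult_torsion G m"
    unfolding mult_quotient_def
  proof (rule Mod_iso_of_surjective_hom(2)[where f = "\<lambda>x. x [^] e'"])
    show "group (mult_torsion G m)" using comm_group_mult_torsion[OF cg] comm_group_def by blast
    show "(\<lambda>x. x [^] e') \<in> hom G (mult_torsion G m)"
      using fdiv g by (auto simp: hom_def mult_torsion_def int_pow_mult_distrib m_comm)
        (auto simp: gen int_pow_pow pow1 mult.assoc)
    show "(\<lambda>x. x [^] e') ` carrier G = carrier (mult_torsion G m)"
    proof
      show "(\<lambda>x. x [^] e') ` carrier G \<subseteq> carrier (mult_torsion G m)"
        using fdiv g by (auto simp: mult_torsion_def) (auto simp: gen int_pow_pow pow1 mult.assoc)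
      show "carrier (mult_torsion G m) \<subseteq> (\<lambda>x. x [^] e') ` carrier G"
      proof
        fix x assume "x \<in> carrier (mult_torsion G m)"
        then obtain i where i: "x = g [^] (i::int)" "x [^] m = \<one>" by (auto simp: mult_torsion_def gen)
        then have "e' dvd i" using fdiv g by (simp add: int_pow_pow pow1)
        then obtain j where "i = j * e'" by (metis dvdE mult.commute)
        then have "x = (g [^] j) [^] e'" using i g by (simp add: int_pow_pow)
        then show "x \<in> (\<lambda>x. x [^] e') ` carrier G" using g by auto
      qed
    qed
    show "(\<lambda>x. x [^] m) ` carrier G \<subseteq> carrier G" by auto
    show "x [^] e' = \<one>\<^bsub>mult_torsion G m\<^esub> \<longleftrightarrow> x \<in> (\<lambda>x. x [^] m) ` carrier G" if x: "x \<in> carrier G" for x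
    proof -
      from x obtain i where i: "x = g [^] (i::int)" by (auto simp: gen)
      have e'0: "e' \<noteq> 0" using e' e0 by auto
      have "x [^] e' = \<one> \<longleftrightarrow> h dvd i"
        using i g e'0 by (simp add: int_pow_pow pow1 e')
      also have "\<dots> \<longleftrightarrow> x \<in> (\<lambda>x. x [^] m) ` carrier G"
      proof
        assume "h dvd i"
        then obtain k where k: "i = h * k" by auto
        obtain u v where "u * e + v * m = h" using bezout_int[of e m] by (auto simp: h_def)
        then have "i = (u * e + v * m) * k" by (simp add: k)
        then have "i = e * (u * k) + (v * k) * m" by (simp add: algebra_simps)
        then have "x = g [^] (e * (u * k)) \<otimes> g [^] ((v * k) * m)" using i g by (simp add: int_pow_mult)
        also have "g [^] (e * (u * k)) = \<one>" by (simp add: pow1)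
        also have "\<one> \<otimes> g [^] ((v * k) * m) = (g [^] (v * k)) [^] m" using g by (simp add: int_pow_pow)
        finally show "x \<in> (\<lambda>x. x [^] m) ` carrier G" using g by auto
      next
        assume "x \<in> (\<lambda>x. x [^] m) ` carrier G"
        then obtain j where "x = (g [^] (j::int)) [^] m" by (auto simp: gen)
        then have "g [^] i = g [^] (j * m)" using i g by (simp add: int_pow_pow)
        then have "g [^] (i - j * m) = \<one>" using g by (simp add: int_pow_diff)
        then have "e dvd i - j * m" by (simp add: pow1)
        then have "h dvd i - j * m" by (simp add: e' dvd_mult_left)
        moreover have "h dvd j * m" by (simp add: m')
        ultimately show "h dvd i" by (metis diff_add_cancel dvd_add)
      qed
      finally show ?thesis by (simp add: mult_torsion_def)
    qed
  qed (use is_group in auto)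
  then show ?thesis by (rule comm_group_iso_sym[OF comm_group_mult_quotient[OF cg]])
qed

lemma (in comm_group) internal_product_iso:
  assumes "subgroup A G" "subgroup B G" "A \<inter> B \<subseteq> {\<one>}"
    and "\<And>x. x \<in> carrier G \<Longrightarrow> \<exists>a\<in>A. \<exists>b\<in>B. x = a \<otimes> b"
  shows "G\<lparr>carrier := A\<rparr> \<times>\<times> G\<lparr>carrier := B\<rparr> \<cong> G"
proof -
  have A: "a \<in> A \<Longrightarrow> a \<in> carrier G" and B: "b \<in> B \<Longrightarrow> b \<in> carrier G" for a b
    using assms by (auto dest: subgroup.mem_carrier)
  have "(\<lambda>(a,b). a \<otimes> b) \<in> iso (G\<lparr>carrier := A\<rparr> \<times>\<times> G\<lparr>carrier := B\<rparr>) G"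
    unfolding iso_iff
  proof (intro conjI)
    show "(\<lambda>(a,b). a \<otimes> b) \<in> hom (G\<lparr>carrier := A\<rparr> \<times>\<times> G\<lparr>carrier := B\<rparr>) G"
      using A B by (auto simp: hom_def m_ac)
    show "(\<lambda>(a,b). a \<otimes> b) ` carrier (G\<lparr>carrier := A\<rparr> \<times>\<times> G\<lparr>carrier := B\<rparr>) = carrier G"
      using A B assms(4) by (force simp: image_iff)
    show "inj_on (\<lambda>(a,b). a \<otimes> b) (carrier (G\<lparr>carrier := A\<rparr> \<times>\<times> G\<lparr>carrier := B\<rparr>))"
    proof (rule inj_onI, clarsimp)
      fix a b a' b' assume *: "a \<in> A" "b \<in> B" "a' \<in> A" "b' \<in> B" "a \<otimes> b = a' \<otimes> b'"
      then have "inv a' \<otimes> a = b' \<otimes> inv b"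
        using A B by (metis inv_closed inv_solve_left inv_solve_right m_assoc m_closed)
      moreover have "inv a' \<otimes> a \<in> A" "b' \<otimes> inv b \<in> B"
        using * assms by (auto intro: subgroup.m_closed subgroup.m_inv_closed)
      ultimately have "inv a' \<otimes> a = \<one>" "b' \<otimes> inv b = \<one>" using assms(3) by auto
      then show "a = a' \<and> b = b'" using * A B
        by (metis inv_closed inv_equality inv_inv inv_comm)
    qed
  qed
  then show ?thesis by (auto simp: is_iso_def)
qed

text \<open>
  Both sides are compatible with direct products, and a cyclic factor generated by an element of
  maximal order can be split off.
\<close>

theorem finite_mult_torsion_iso_mult_quotient:
  assumes "comm_group G" "finite (carrier G)"
  shows "mult_torsion G m \<cong> mult_quotient G m"
  using assms
proof (induction "card (carrier G)" arbitrary: G rule: less_induct)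
  case less
  interpret comm_group G by fact
  obtain g where g: "g \<in> carrier G" "ord g > 0" "\<And>x. x \<in> carrier G \<Longrightarrow> ord x dvd ord g"
    using exists_exponent_element[OF less.prems(2)] by blast
  obtain B where B: "subgroup B G" "B \<inter> range (\<lambda>i::int. g [^]\<^bsub>G\<^esub> i) \<subseteq> {\<one>\<^bsub>G\<^esub>}"
    "\<And>x. x \<in> carrier G \<Longrightarrow> \<exists>b\<in>B. \<exists>i::int. x = b \<otimes>\<^bsub>G\<^esub> g [^]\<^bsub>G\<^esub> i"
    using exists_cyclic_complement[OF less.prems(2) g] by blast
  define P where "P = range (\<lambda>i::int. g [^]\<^bsub>G\<^esub> i)"
  have sP: "subgroup P G" unfolding P_def using subgroup_of_powers g(1) by blast
  let ?B = "G\<lparr>carrier := B\<rparr>" and ?P = "G\<lparr>carrier := P\<rparr>"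
  have cB: "comm_group ?B" and cP: "comm_group ?P"
    using comm_group_subgroup[OF less.prems(1)] B(1) sP by auto
  interpret P: comm_group ?P by fact
  have BP: "?B \<times>\<times> ?P \<cong> G"
    by (rule internal_product_iso[OF B(1) sP]) (use B in \<open>auto simp: P_def\<close>)
  have gP: "g \<in> P" unfolding P_def using g(1) by (metis int_pow_1 rangeI)
  have powP: "x [^]\<^bsub>?P\<^esub> (i::int) = x [^]\<^bsub>G\<^esub> i" if "x \<in> P" for x i
    using int_pow_consistent[OF sP that] by simp
  have tP: "mult_torsion ?P m \<cong> mult_quotient ?P m"
  proof (rule P.cyclic_torsion_iso_quotient)
    show "g \<in> carrier ?P" using gP by simp
    show "carrier ?P = range (\<lambda>i::int. g [^]\<^bsub>?P\<^esub> i)" using powP[OF gP] by (simp add: P_def)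
    have "P.ord g = ord g"
      using P.ord_unique[of g "ord g"] gP pow_eq_id[OF g(1)] by (simp flip: nat_pow_consistent)
    then show "P.ord g > 0" using g by simp
  qed
  have tB: "mult_torsion ?B m \<cong> mult_quotient ?B m"
  proof (cases "B = carrier G")
    case True
    then have "g = \<one>\<^bsub>G\<^esub>" using B(2) gP g(1) by (auto simp: P_def)
    then have "carrier G = {\<one>\<^bsub>G\<^esub>}" using g(3) ord_eq_1 by auto
    then have "P = carrier G" using subgroup.subset[OF sP] subgroup.one_closed[OF sP] by auto
    then show ?thesis using tP True by simp
  next
    case False
    then have "card B < card (carrier G)"
      using subgroup.subset[OF B(1)] less.prems(2) by (simp add: psubset_card_mono psubset_eq)
    then show ?thesis
      using less.hyps[of ?B] cB subgroup.subset[OF B(1)] less.prems(2) finite_subset by auto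
  qed
  have cBP: "comm_group (?B \<times>\<times> ?P)" by (rule comm_group_DirProd[OF cB cP])
  have "mult_torsion G m \<cong> mult_torsion (?B \<times>\<times> ?P) m"
    by (rule mult_torsion_iso[OF less.prems(1) cBP comm_group_iso_sym[OF cBP BP]])
  also have "\<dots> \<cong> mult_torsion ?B m \<times>\<times> mult_torsion ?P m"
    by (rule mult_torsion_DirProd[OF cB cP])
  also have "\<dots> \<cong> mult_quotient ?B m \<times>\<times> mult_quotient ?P m"
    by (rule DirProd_iso_cong[OF tB tP])
  also have "\<dots> \<cong> mult_quotient (?B \<times>\<times> ?P) m"
    by (rule comm_group_iso_sym[OF comm_group_mult_quotient[OF cBP] mult_quotient_DirProd[OF cB cP]])
  also have "\<dots> \<cong> mult_quotient G m"
    by (rule mult_quotient_iso[OF cBP less.prems(1) BP])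
  finally show ?case .
qed

section \<open>Tensor products with cyclic groups\<close>

text \<open>
  The pairing \<open>(g, y) \<mapsto> g\<^sup>y\<close> is well defined modulo \<open>m\<close>-th powers and induces a surjection from the
  tensor product. For injectivity, let \<open>u\<close> be the class of \<open>1\<close>. Bilinearity brings every tensor into
  the form \<open>g \<otimes> u\<close>, and such a tensor vanishes if \<open>g = h\<^sup>m\<close>, because \<open>h\<^sup>m \<otimes> u = h \<otimes> m u\<close>.
\<close>

theorem mult_quotient_iso_tensor_Z_mod:
  assumes G: "comm_group G"
  shows "mult_quotient G m \<cong> tensor G (Z_mod m)"
proof -
  interpret G: comm_group G by fact
  define n where "n = nat \<bar>m\<bar>"
  define Zm where "Zm = integer_mod_group n"
  have Zm: "comm_group Zm" by (simp add: Zm_def)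
  interpret Zm: comm_group Zm by fact
  have Zm_eq: "Z_mod m = Zm" by (simp add: Z_mod_def Zm_def n_def)
  define A where "A = free_Abelian_group (carrier G \<times> carrier Zm)"
  have A: "comm_group A" unfolding A_def by (rule abelian_free_Abelian_group)
  interpret A: comm_group A by fact
  have Amult[simp]: "x \<otimes>\<^bsub>A\<^esub> y = x + y" and Aone[simp]: "\<one>\<^bsub>A\<^esub> = 0"
    and Ac[simp]: "x \<in> carrier A \<longleftrightarrow> Poly_Mapping.keys x \<subseteq> carrier G \<times> carrier Zm" for x y
    by (simp_all add: A_def)
  define R where "R = tensor_relations G Zm"
  define N where "N = generate A R"
  have RA: "R \<subseteq> carrier A"
    unfolding R_def tensor_relations_def
    by (auto dest!: subsetD[OF keys_diff] split: if_splits)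
  have N: "subgroup N A" unfolding N_def by (rule A.generate_is_subgroup[OF RA])
  define T where "T = A Mod N"
  have T: "comm_group T" unfolding T_def by (rule comm_group.abelian_FactGroup[OF A N])
  interpret T: comm_group T by fact
  have T_eq: "tensor G (Z_mod m) = T"
    unfolding tensor_def Zm_eq T_def N_def R_def A_def ..
  define pr where "pr c = N #>\<^bsub>A\<^esub> c" for c
  have pr: "pr \<in> hom A T" unfolding pr_def T_def by (rule coset_hom_Mod[OF A N])
  have pr1: "pr c = \<one>\<^bsub>T\<^esub> \<longleftrightarrow> c \<in> N" if "c \<in> carrier A" for c
    unfolding pr_def T_def using coset_in_Mod_eq_one[OF A.is_group N that] by simp
  have pr_add: "pr (x + y) = pr x \<otimes>\<^bsub>T\<^esub> pr y" if "x \<in> carrier A" "y \<in> carrier A" for x y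
    using hom_mult[OF pr that] by simp
  have frA: "frag_of (g, y) \<in> carrier A" if "g \<in> carrier G" "y \<in> carrier Zm" for g y using that by simp
  have prc: "pr c \<in> carrier T" if "c \<in> carrier A" for c using hom_in_carrier[OF pr that] .
  have rel: "pr u = pr v \<otimes>\<^bsub>T\<^esub> pr w" 
    if "u - v - w \<in> R" "u \<in> carrier A" "v \<in> carrier A" "w \<in> carrier A" for u v w
  proof -
    have c: "u - v - w \<in> carrier A" using that RA by blast
    then have "pr (u - v - w) = \<one>\<^bsub>T\<^esub>" 
      using pr1 that(1) unfolding N_def by (blast intro: generate.incl)
    moreover have "v + w \<in> carrier A" using A.m_closed[OF that(3,4)] by simp
    ultimately have "pr ((u - v - w) + (v + w)) = pr v \<otimes>\<^bsub>T\<^esub> pr w"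
      using pr_add[OF c, of "v + w"] pr_add[OF that(3,4)] T.l_one[OF T.m_closed[OF prc prc], OF that(3,4)]
      by metis
    then show ?thesis by simp
  qed
  have left: "(\<lambda>g. pr (frag_of (g, y))) \<in> hom G T" if "y \<in> carrier Zm" for y
  proof (rule homI)
    fix g g' assume "g \<in> carrier G" "g' \<in> carrier G"
    with that show "pr (frag_of (g \<otimes>\<^bsub>G\<^esub> g', y)) = pr (frag_of (g, y)) \<otimes>\<^bsub>T\<^esub> pr (frag_of (g', y))"
      by (intro rel frA) (auto simp: R_def tensor_relations_def)
  qed (use that prc frA in auto)
  have right: "(\<lambda>y. pr (frag_of (g, y))) \<in> hom Zm T" if "g \<in> carrier G" for g
  proof (rule homI)
    fix y y' assume "y \<in> carrier Zm" "y' \<in> carrier Zm"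
    with that show "pr (frag_of (g, y \<otimes>\<^bsub>Zm\<^esub> y')) = pr (frag_of (g, y)) \<otimes>\<^bsub>T\<^esub> pr (frag_of (g, y'))"
      by (intro rel frA) (auto simp: R_def tensor_relations_def)
  qed (use that prc frA in auto)
  (* The remainder is 0 if n = 1, where the group is trivial, and 1 if n = 0, where it is the integers. *)
  define u where "u = 1 mod int n"
  have uZ: "u \<in> carrier Zm"
    by (auto simp: u_def Zm_def carrier_integer_mod_group)
  have upow: "u [^]\<^bsub>Zm\<^esub> j = j mod int n" for j :: int
    by (simp add: u_def Zm_def int_pow_integer_mod_group mod_mult_right_eq)
  have yu: "u [^]\<^bsub>Zm\<^esub> y = y" if "y \<in> carrier Zm" for y
    using that unfolding upow by (auto simp: Zm_def carrier_integer_mod_group split: if_splits)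
  have move: "pr (frag_of (g, u [^]\<^bsub>Zm\<^esub> j)) = pr (frag_of (g [^]\<^bsub>G\<^esub> j, u))" if "g \<in> carrier G" for g and j :: int
    using comm_group_hom_int_pow[OF Zm T right[OF that] uZ] comm_group_hom_int_pow[OF G T left[OF uZ] that] by simp
  have normal_form: "\<exists>g\<in>carrier G. pr c = pr (frag_of (g, u))" if "c \<in> carrier A" for c
  proof -
    have "Poly_Mapping.keys c \<subseteq> carrier G \<times> carrier Zm" using that by simp
    then show ?thesis
    proof (induction c rule: free_Abelian_group_induct[consumes 1])
      case 1
      have "pr (frag_of (\<one>\<^bsub>G\<^esub>, u)) = \<one>\<^bsub>T\<^esub>" using hom_one[OF left[OF uZ] G.is_group T.is_group] .
      moreover have "pr 0 = \<one>\<^bsub>T\<^esub>" using hom_one[OF pr A.is_group T.is_group] by simp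
      ultimately show ?case by (metis G.one_closed)
    next
      case (2 x y)
      then obtain g h where g: "g \<in> carrier G" "pr x = pr (frag_of (g, u))"
        and h: "h \<in> carrier G" "pr y = pr (frag_of (h, u))" by blast
      have d: "x - y \<in> carrier A" using 2 keys_diff[of x y] by auto
      have "pr x = pr (x - y) \<otimes>\<^bsub>T\<^esub> pr y" using pr_add[OF d, of y] 2 by simp
      moreover have "pr x = pr (frag_of (g \<otimes>\<^bsub>G\<^esub> inv\<^bsub>G\<^esub> h, u)) \<otimes>\<^bsub>T\<^esub> pr y"
        using hom_mult[OF left[OF uZ], of "g \<otimes>\<^bsub>G\<^esub> inv\<^bsub>G\<^esub> h" h] g h
        by (simp add: G.m_assoc)
      ultimately have "pr (x - y) = pr (frag_of (g \<otimes>\<^bsub>G\<^esub> inv\<^bsub>G\<^esub> h, u))"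
        using T.right_cancel[of "pr y"] prc[OF d] prc[of y] prc[OF frA[of "g \<otimes>\<^bsub>G\<^esub> inv\<^bsub>G\<^esub> h" u]]
          2 g h uZ by simp
      then show ?case using g h by blast
    next
      case (3 z)
      then obtain g y where z: "z = (g, y)" "g \<in> carrier G" "y \<in> carrier Zm" by auto
      then show ?case using move[OF z(2), of y] yu[OF z(3)] G.int_pow_closed by metis
    qed
  qed
  define M where "M = (\<lambda>x. x [^]\<^bsub>G\<^esub> m) ` carrier G"
  have M: "subgroup M G" unfolding M_def by (rule comm_group.powers_subgroup[OF G])
  define Q where "Q = G Mod M"
  have Q: "comm_group Q" unfolding Q_def by (rule comm_group.abelian_FactGroup[OF G M])
  interpret Q: comm_group Q by fact
  define q where "q g = M #>\<^bsub>G\<^esub> g" for g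
  have q: "q \<in> hom G Q" unfolding q_def Q_def by (rule coset_hom_Mod[OF G M])
  have qc: "q g \<in> carrier Q" if "g \<in> carrier G" for g using hom_in_carrier[OF q that] .
  have q1: "q g = \<one>\<^bsub>Q\<^esub> \<longleftrightarrow> g \<in> M" if "g \<in> carrier G" for g
    unfolding q_def Q_def using coset_in_Mod_eq_one[OF G.is_group M that] by simp
  have qpow: "q (g [^]\<^bsub>G\<^esub> i) = q (g [^]\<^bsub>G\<^esub> j)" if g: "g \<in> carrier G" and ij: "m dvd i - j" for g and i j :: int
  proof -
    obtain l where l: "i = l * m + j" using ij by (metis dvdE diff_add_cancel mult.commute)
    have "g [^]\<^bsub>G\<^esub> i = (g [^]\<^bsub>G\<^esub> l) [^]\<^bsub>G\<^esub> m \<otimes>\<^bsub>G\<^esub> g [^]\<^bsub>G\<^esub> j"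
      using g by (simp add: l G.int_pow_mult G.int_pow_pow)
    moreover have "q ((g [^]\<^bsub>G\<^esub> l) [^]\<^bsub>G\<^esub> m) = \<one>\<^bsub>Q\<^esub>"
      using q1 g by (auto simp: M_def)
    ultimately show ?thesis using hom_mult[OF q] qc g by (metis G.int_pow_closed Q.l_one)
  qed
  have mod_dvd: "m dvd i mod int n - i" for i :: int
  proof -
    have "int n dvd i mod int n - i" by (metis dvd_minus_mod dvd_diff_commute)
    then show ?thesis by (simp add: n_def)
  qed
  define f0 where "f0 = (\<lambda>(g, y::int). q (g [^]\<^bsub>G\<^esub> y))"
  have "f0 ` (carrier G \<times> carrier Zm) \<subseteq> carrier Q" using qc by (auto simp: f0_def)
  then obtain f where fA: "f \<in> hom A Q" and f0: "\<And>z. z \<in> carrier G \<times> carrier Zm \<Longrightarrow> f (frag_of z) = f0 z"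
    using Q.free_Abelian_group_universal unfolding A_def by blast
  have f: "f (frag_of (g, y)) = q (g [^]\<^bsub>G\<^esub> y)" if "g \<in> carrier G" "y \<in> carrier Zm" for g y
    using f0 that by (simp add: f0_def)
  interpret f: group_hom A Q f
    using fA by (simp add: group_hom_def group_hom_axioms_def)
  have fdiff: "f (a - b - c) = \<one>\<^bsub>Q\<^esub>"
    if "f a = f b \<otimes>\<^bsub>Q\<^esub> f c" "a \<in> carrier A" "b \<in> carrier A" "c \<in> carrier A" for a b c
  proof -
    have bc: "b + c \<in> carrier A" using A.m_closed[OF that(3,4)] by simp
    have abc: "a - b - c \<in> carrier A" using that(2-4) keys_diff[of a b] keys_diff[of "a - b" c]
      unfolding Ac by blast
    have "f a = f (a - b - c) \<otimes>\<^bsub>Q\<^esub> f (b + c)"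
      using f.hom_mult[OF abc bc] by simp
    moreover have "f (b + c) = f a" using f.hom_mult[OF that(3,4)] that(1) by simp
    ultimately show ?thesis
      using f.hom_closed[OF that(2)] f.hom_closed[OF abc] Q.right_cancel[of "f a" "f (a - b - c)" "\<one>\<^bsub>Q\<^esub>"] by (metis Q.l_one Q.one_closed)
  qed
  have "R \<subseteq> kernel A Q f"
  proof
    fix r assume r: "r \<in> R"
    have "f r = \<one>\<^bsub>Q\<^esub>"
      using r unfolding R_def tensor_relations_def
    proof (elim UnE CollectE exE conjE)
      fix x x' y assume *: "x \<in> carrier G" "x' \<in> carrier G" "y \<in> carrier Zm"
        and r: "r = frag_of (x \<otimes>\<^bsub>G\<^esub> x', y) - frag_of (x, y) - frag_of (x', y)"
      show "f r = \<one>\<^bsub>Q\<^esub>" unfolding r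
      proof (rule fdiff)
        show "f (frag_of (x \<otimes>\<^bsub>G\<^esub> x', y)) = f (frag_of (x, y)) \<otimes>\<^bsub>Q\<^esub> f (frag_of (x', y))"
          using * by (simp add: f hom_mult[OF q, symmetric] G.int_pow_mult_distrib[OF G.m_comm])
      qed (use * frA in auto)
    next
      fix x y y' assume *: "x \<in> carrier G" "y \<in> carrier Zm" "y' \<in> carrier Zm"
        and r: "r = frag_of (x, y \<otimes>\<^bsub>Zm\<^esub> y') - frag_of (x, y) - frag_of (x, y')"
      show "f r = \<one>\<^bsub>Q\<^esub>" unfolding r
      proof (rule fdiff)
        have "f (frag_of (x, y \<otimes>\<^bsub>Zm\<^esub> y')) = q (x [^]\<^bsub>G\<^esub> ((y + y') mod int n))"
          using * Zm.m_closed by (simp add: f) (simp add: Zm_def)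
        also have "\<dots> = q (x [^]\<^bsub>G\<^esub> (y + y'))" by (rule qpow[OF *(1) mod_dvd])
        also have "\<dots> = f (frag_of (x, y)) \<otimes>\<^bsub>Q\<^esub> f (frag_of (x, y'))"
          using * by (simp add: f hom_mult[OF q, symmetric] G.int_pow_mult)
        finally show "f (frag_of (x, y \<otimes>\<^bsub>Zm\<^esub> y')) = f (frag_of (x, y)) \<otimes>\<^bsub>Q\<^esub> f (frag_of (x, y'))" .
      qed (use * frA Zm.m_closed in auto)
    qed
    then show "r \<in> kernel A Q f" using subsetD[OF RA r] by (simp add: kernel_def)
  qed
  then have "N \<subseteq> kernel A Q f"
    unfolding N_def by (rule A.generate_subgroup_incl) (rule f.subgroup_kernel)
  then have NK: "f c = \<one>\<^bsub>Q\<^esub>" if "c \<in> N" for c using that by (auto simp: kernel_def)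
  have f_pr: "f a = f b" if "a \<in> carrier A" "b \<in> carrier A" "pr a = pr b" for a b
  proof -
    have "a \<in> N #>\<^bsub>A\<^esub> b" using that A.rcos_self[OF that(1) N] by (simp add: pr_def)
    then obtain h where h: "h \<in> N" "a = h + b" by (auto simp: r_coset_def)
    then have "f a = f h \<otimes>\<^bsub>Q\<^esub> f b" using f.hom_mult[of h b] that(2) subgroup.mem_carrier[OF N] by simp
    then show ?thesis using NK[OF h(1)] f.hom_closed[OF that(2)] by simp
  qed
  have fu: "f (frag_of (g, u)) = q g" if "g \<in> carrier G" for g
  proof -
    have "f (frag_of (g, u)) = q (g [^]\<^bsub>G\<^esub> u)" by (rule f[OF that uZ])
    also have "\<dots> = q (g [^]\<^bsub>G\<^esub> (1::int))" unfolding u_def by (rule qpow[OF that mod_dvd])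
    finally show ?thesis using that by simp
  qed
  have "A Mod N \<cong> Q"
  proof (rule Mod_iso_of_surjective_hom(2)[OF A.is_group Q.is_group fA])
    show "f ` carrier A = carrier Q"
    proof
      show "carrier Q \<subseteq> f ` carrier A"
      proof
        fix X assume "X \<in> carrier Q"
        then obtain g where "g \<in> carrier G" "X = q g" by (auto simp: Q_def carrier_FactGroup q_def)
        then show "X \<in> f ` carrier A" using fu frA[OF _ uZ] by (metis imageI)
      qed
    qed (use f.hom_closed in blast)
    show "N \<subseteq> carrier A" using subgroup.subset[OF N] .
    show "f c = \<one>\<^bsub>Q\<^esub> \<longleftrightarrow> c \<in> N" if c: "c \<in> carrier A" for c
    proof
      assume fc: "f c = \<one>\<^bsub>Q\<^esub>"
      obtain g where g: "g \<in> carrier G" "pr c = pr (frag_of (g, u))" using normal_form[OF c] by blast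
      then have "q g = \<one>\<^bsub>Q\<^esub>" using f_pr[OF c frA[OF g(1) uZ] g(2)] fc fu by simp
      then obtain h where h: "h \<in> carrier G" "g = h [^]\<^bsub>G\<^esub> m" using q1[OF g(1)] by (auto simp: M_def)
      have "pr c = pr (frag_of (h, u [^]\<^bsub>Zm\<^esub> m))" using move[OF h(1)] g h by simp
      also have "u [^]\<^bsub>Zm\<^esub> m = \<one>\<^bsub>Zm\<^esub>" unfolding upow by (simp add: Zm_def n_def)
      also have "pr (frag_of (h, \<one>\<^bsub>Zm\<^esub>)) = \<one>\<^bsub>T\<^esub>"
        by (rule hom_one[OF right[OF h(1)] Zm.is_group T.is_group])
      finally show "c \<in> N" using pr1[OF c] by simp
    qed (rule NK)
  qed
  then have "T \<cong> mult_quotient G m" unfolding T_def Q_def M_def mult_quotient_def .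
  then show ?thesis unfolding T_eq by (rule comm_group_iso_sym[OF T])
qed

section \<open>Subgroups of free abelian groups\<close>

text \<open>
  Subgroups of the free abelian group on a whole type share its addition, so that their elements
  can be computed with by the arithmetic of the type.
\<close>

definition frag_group :: "('b \<Rightarrow>\<^sub>0 int) set \<Rightarrow> ('b \<Rightarrow>\<^sub>0 int) monoid" where
  "frag_group Z = (free_Abelian_group UNIV)\<lparr>carrier := Z\<rparr>"

definition frag_subgroup :: "('b \<Rightarrow>\<^sub>0 int) set \<Rightarrow> bool" where
  "frag_subgroup Z \<longleftrightarrow> 0 \<in> Z \<and> (\<forall>x\<in>Z. \<forall>y\<in>Z. x - y \<in> Z)"

lemma frag_group_simps [simp]:
  "carrier (frag_group Z) = Z" "\<one>\<^bsub>frag_group Z\<^esub> = 0" "x \<otimes>\<^bsub>frag_group Z\<^esub> y = x + y"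
  by (simp_all add: frag_group_def)

lemma frag_group_update [simp]: "(frag_group Z)\<lparr>carrier := Y\<rparr> = frag_group Y"
  by (simp add: frag_group_def)

lemma free_Abelian_group_eq_frag_group: "free_Abelian_group S = frag_group {c. Poly_Mapping.keys c \<subseteq> S}"
  by (simp add: frag_group_def free_Abelian_group_def)

lemma frag_subgroupD:
  assumes "frag_subgroup Z"
  shows "0 \<in> Z" "\<And>x y. x \<in> Z \<Longrightarrow> y \<in> Z \<Longrightarrow> x - y \<in> Z" "\<And>x. x \<in> Z \<Longrightarrow> - x \<in> Z"
    "\<And>x y. x \<in> Z \<Longrightarrow> y \<in> Z \<Longrightarrow> x + y \<in> Z"
proof -
  show 0: "0 \<in> Z" using assms unfolding frag_subgroup_def by blast
  show d: "x - y \<in> Z" if "x \<in> Z" "y \<in> Z" for x y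
    using assms that unfolding frag_subgroup_def by blast
  show m: "- x \<in> Z" if "x \<in> Z" for x using d[OF 0 that] by simp
  show "x + y \<in> Z" if "x \<in> Z" "y \<in> Z" for x y using d[OF that(1) m[OF that(2)]] by simp
qed

lemma subgroup_free_Abelian_group_UNIV: "frag_subgroup Z \<longleftrightarrow> subgroup Z (free_Abelian_group UNIV)"
proof
  assume "frag_subgroup Z"
  then show "subgroup Z (free_Abelian_group UNIV)"
    by (intro group.subgroupI) (use frag_subgroupD[of Z] in auto)
next
  assume Z: "subgroup Z (free_Abelian_group UNIV)"
  have "x - y \<in> Z" if "x \<in> Z" "y \<in> Z" for x y
    using subgroup.m_closed[OF Z that(1) subgroup.m_inv_closed[OF Z that(2)]] by simp
  then show "frag_subgroup Z" using subgroup.one_closed[OF Z] by (simp add: frag_subgroup_def)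
qed

lemma comm_group_frag_group:
  assumes "frag_subgroup Z"
  shows "comm_group (frag_group Z)"
  using assms comm_group_subgroup[OF abelian_free_Abelian_group]
  by (auto simp: subgroup_free_Abelian_group_UNIV frag_group_def)

lemma subgroup_frag_group:
  assumes "frag_subgroup Z" "frag_subgroup B" "B \<subseteq> Z"
  shows "subgroup B (frag_group Z)"
proof (rule group.group_incl_imp_subgroup)
  show "group (frag_group Z)" using comm_group_frag_group[OF assms(1)] comm_group_def by blast
  show "group ((frag_group Z)\<lparr>carrier := B\<rparr>)"
    using comm_group_frag_group[OF assms(2)] comm_group_def by auto
qed (use assms in auto)

lemma frag_group_int_pow:
  assumes "frag_subgroup Z" "x \<in> Z"
  shows "x [^]\<^bsub>frag_group Z\<^esub> (m::int) = frag_cmul m x"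
proof -
  have "x [^]\<^bsub>frag_group Z\<^esub> m = x [^]\<^bsub>free_Abelian_group UNIV\<^esub> m"
    unfolding frag_group_def
    using group.int_pow_consistent[OF group_free_Abelian_group, of Z UNIV x m] assms
    by (simp add: subgroup_free_Abelian_group_UNIV)
  then show ?thesis by simp
qed

lemma frag_subgroup_cmul:
  assumes "frag_subgroup Z" "x \<in> Z"
  shows "frag_cmul m x \<in> Z"
  using group.int_pow_closed[of "frag_group Z" x m] frag_group_int_pow[OF assms, of m]
    comm_group_frag_group[OF assms(1)] assms(2) comm_group_def by auto

lemma hom_frag_group:
  "additive f \<Longrightarrow> f ` A \<subseteq> B \<Longrightarrow> f \<in> hom (frag_group A) (frag_group B)"
  by (auto simp: hom_def additive.add)

lemma hom_frag_group_cmul: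
  assumes "frag_subgroup A" "frag_subgroup B" "f \<in> hom (frag_group A) (frag_group B)" "x \<in> A"
  shows "f (frag_cmul m x) = frag_cmul m (f x)"
proof -
  have "f x \<in> B" using assms(3,4) by (auto simp: hom_def)
  then show ?thesis
    using comm_group_hom_int_pow[OF comm_group_frag_group comm_group_frag_group assms(3), of x m] assms
    by (simp add: frag_group_int_pow)
qed

lemma additive_cmul:
  assumes "additive (f :: ('b \<Rightarrow>\<^sub>0 int) \<Rightarrow> ('c \<Rightarrow>\<^sub>0 int))"
  shows "f (frag_cmul m x) = frag_cmul m (f x)"
  by (rule hom_frag_group_cmul[of UNIV UNIV])
    (use assms in \<open>auto simp: frag_subgroup_def hom_frag_group\<close>)

lemma frag_cmul_diff: "frag_cmul m (x - y) = frag_cmul m x - frag_cmul m y"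
  by (metis add_diff_cancel diff_add_cancel frag_cmul_distrib2)

lemma coset_frag_group_eq:
  assumes "frag_subgroup Z" "frag_subgroup B" "B \<subseteq> Z" "x \<in> Z" "y \<in> Z"
  shows "B #>\<^bsub>frag_group Z\<^esub> x = B #>\<^bsub>frag_group Z\<^esub> y \<longleftrightarrow> x - y \<in> B"
proof -
  interpret comm_group "frag_group Z" by (rule comm_group_frag_group) fact
  have s: "subgroup B (frag_group Z)" by (rule subgroup_frag_group) fact+
  have "B #>\<^bsub>frag_group Z\<^esub> x = B #>\<^bsub>frag_group Z\<^esub> y \<longleftrightarrow> x \<in> B #>\<^bsub>frag_group Z\<^esub> y"
    using rcos_self[of x B] repr_independence[of x B y] s assms by auto
  also have "\<dots> \<longleftrightarrow> x - y \<in> B"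
    by (auto simp: r_coset_def) (metis diff_add_cancel)
  finally show ?thesis .
qed

text \<open>
  A subgroup of a free abelian group of finite rank arises from \<open>0\<close> by adjoining free generators
  one at a time. Let \<open>B'\<close> consist of the elements of \<open>B\<close> that do not involve the basis element \<open>a\<close>.
  The coefficients of \<open>a\<close> in elements of \<open>B\<close> form an ideal of the integers, and any element \<open>b\<close> whose
  coefficient generates this ideal is a free generator of \<open>B\<close> over \<open>B'\<close>.
\<close>

lemma frag_subgroup_induct [consumes 3, case_names zero step]:
  fixes B :: "('b \<Rightarrow>\<^sub>0 int) set"
  assumes "finite S" "frag_subgroup B" "B \<subseteq> {c. Poly_Mapping.keys c \<subseteq> S}"
    and zero: "P {0}"
    and step: "\<And>(B' :: ('b \<Rightarrow>\<^sub>0 int) set) B b. frag_subgroup B' \<Longrightarrow> frag_subgroup B \<Longrightarrow> P B' \<Longrightarrow> B' \<subseteq> B \<Longrightarrow> b \<in> B \<Longrightarrow>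
      (\<And>c. c \<in> B \<Longrightarrow> \<exists>m. c - frag_cmul m b \<in> B') \<Longrightarrow>
      (\<And>m. frag_cmul m b \<in> B' \<Longrightarrow> m = 0) \<Longrightarrow> P B"
  shows "P B"
  using assms(1-3)
proof (induction S arbitrary: B rule: finite_induct)
  case empty
  then have "B = {0}" using frag_subgroupD(1)[of B] by force
  then show ?case using zero by simp
next
  case (insert a S)
  note B = frag_subgroupD[OF insert.prems(1)]
  let ?l = "\<lambda>c. Poly_Mapping.lookup c a"
  define B' where "B' = {c \<in> B. ?l c = 0}"
  have sB': "frag_subgroup B'" using B by (auto simp: B'_def frag_subgroup_def lookup_minus)
  have PB': "P B'"
  proof (rule insert.IH[OF sB'])
    show "B' \<subseteq> {c. Poly_Mapping.keys c \<subseteq> S}"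
      using insert.prems(2) by (auto simp: B'_def in_keys_iff subset_iff)
  qed
  show ?case
  proof (cases "B' = B")
    case True
    then show ?thesis using PB' by simp
  next
    case False
    then obtain c0 where c0: "c0 \<in> B" "?l c0 \<noteq> 0" by (auto simp: B'_def)
    define Q where "Q k \<longleftrightarrow> k > 0 \<and> (\<exists>c\<in>B. ?l c = int k)" for k
    have "Q (nat \<bar>?l c0\<bar>)"
    proof (cases "?l c0 > 0")
      case True then show ?thesis using c0 by (auto simp: Q_def)
    next
      case False
      then have "?l (- c0) = int (nat \<bar>?l c0\<bar>)" by simp
      then have "\<exists>c\<in>B. ?l c = int (nat \<bar>?l c0\<bar>)" using B(3)[OF c0(1)] by (rule bexI)
      moreover have "nat \<bar>?l c0\<bar> > 0" using c0(2) by simp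
      ultimately show ?thesis unfolding Q_def by blast
    qed
    define d where "d = (LEAST k. Q k)"
    have Qd: "Q d" unfolding d_def by (rule LeastI) fact
    then obtain b where b: "b \<in> B" "?l b = int d" and d0: "d > 0" by (auto simp: Q_def)
    show ?thesis
    proof (rule step[OF sB' insert.prems(1) PB' _ b(1)])
      show "B' \<subseteq> B" by (auto simp: B'_def)
      show "m = 0" if "frag_cmul m b \<in> B'" for m
        using that b d0 by (simp add: B'_def)
      fix c assume c: "c \<in> B"
      define r where "r = c - frag_cmul (?l c div int d) b"
      have rB: "r \<in> B" unfolding r_def using B(2)[OF c frag_subgroup_cmul[OF insert.prems(1) b(1)]] .
      have lr: "?l r = ?l c mod int d"
        unfolding r_def lookup_minus lookup_frag_cmul b(2) by (rule minus_div_mult_eq_mod)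
      have "\<not> Q (nat (?l r))"
      proof
        assume "Q (nat (?l r))"
        then have "d \<le> nat (?l r)" unfolding d_def by (rule Least_le)
        moreover have "?l r < int d" unfolding lr using d0 by simp
        ultimately show False using d0 by linarith
      qed
      moreover have "?l r \<ge> 0" unfolding lr using d0 by simp
      moreover have "Q (nat (?l r))" if "?l r > 0"
        unfolding Q_def using that rB by (intro conjI bexI[of _ r]) auto
      ultimately have "?l r = 0" by linarith
      then show "\<exists>m. c - frag_cmul m b \<in> B'" using rB unfolding B'_def r_def by blast
    qed
  qed
qed

text \<open>
  Such a subgroup is free, hence projective: a section is extended along each new generator \<open>b\<close> by
  choosing a preimage \<open>g\<close> of \<open>b\<close>.
\<close>

lemma frag_section:
  assumes fin: "finite S" and B: "frag_subgroup B" "B \<subseteq> {c. Poly_Mapping.keys c \<subseteq> S}"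
    and A: "frag_subgroup A" and f: "additive f" "B \<subseteq> f ` A"
  obtains \<sigma> where "\<sigma> \<in> hom (frag_group B) (frag_group A)" "\<And>x. x \<in> B \<Longrightarrow> f (\<sigma> x) = x"
proof -
  have "B \<subseteq> f ` A \<longrightarrow> (\<exists>\<sigma> \<in> hom (frag_group B) (frag_group A). \<forall>x\<in>B. f (\<sigma> x) = x)"
    using fin B
  proof (induct B rule: frag_subgroup_induct)
    case zero
    show ?case using frag_subgroupD(1)[OF A] f(1)
      by (intro impI bexI[of _ "\<lambda>x. 0"]) (auto simp: hom_def additive.zero)
  next
    case (step B' B b)
    show ?case
    proof
      assume BA: "B \<subseteq> f ` A"
      then obtain \<tau> where \<tau>: "\<tau> \<in> hom (frag_group B') (frag_group A)" "\<And>x. x \<in> B' \<Longrightarrow> f (\<tau> x) = x"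
        using step by blast
      obtain g where g: "g \<in> A" "f g = b" using BA step(5) by auto
      (* The coordinate of c along the new generator b; it is unique, hence additive in c. *)
      obtain \<mu> where \<mu>: "\<And>c. c \<in> B \<Longrightarrow> c - frag_cmul (\<mu> c) b \<in> B'" using step(6) by metis
      have uniq: "m = m'" if "c - frag_cmul m b \<in> B'" "c - frag_cmul m' b \<in> B'" for c m m'
      proof -
        have "(c - frag_cmul m' b) - (c - frag_cmul m b) \<in> B'"
          using frag_subgroupD(2)[OF step(1) that(2,1)] .
        then have "frag_cmul (m - m') b \<in> B'"
            unfolding frag_cmul_diff_distrib by (simp add: algebra_simps del: minus_frag_cmul)
        then show ?thesis using step(7) by force
      qed
      have \<mu>_add: "\<mu> (c + c') = \<mu> c + \<mu> c'" if "c \<in> B" "c' \<in> B" for c c'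
      proof (rule uniq[OF \<mu>])
        show "c + c' \<in> B" using frag_subgroupD(4)[OF step(2) that] .
        show "c + c' - frag_cmul (\<mu> c + \<mu> c') b \<in> B'"
          using frag_subgroupD(4)[OF step(1) \<mu>[OF that(1)] \<mu>[OF that(2)]]
          by (simp add: frag_cmul_distrib algebra_simps)
      qed
      define \<sigma> where "\<sigma> c = \<tau> (c - frag_cmul (\<mu> c) b) + frag_cmul (\<mu> c) g" for c
      have "\<sigma> \<in> hom (frag_group B) (frag_group A)"
      proof (rule homI)
        fix c assume "c \<in> carrier (frag_group B)"
        then have "\<tau> (c - frag_cmul (\<mu> c) b) \<in> A" using \<mu> \<tau>(1) by (auto simp: hom_def)
        then show "\<sigma> c \<in> carrier (frag_group A)"
          unfolding \<sigma>_def using frag_subgroupD(4)[OF A] frag_subgroup_cmul[OF A g(1)] by simp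
      next
        fix c c' assume "c \<in> carrier (frag_group B)" "c' \<in> carrier (frag_group B)"
        then have cc: "c \<in> B" "c' \<in> B" by auto
        have "\<tau> ((c - frag_cmul (\<mu> c) b) + (c' - frag_cmul (\<mu> c') b))
            = \<tau> (c - frag_cmul (\<mu> c) b) + \<tau> (c' - frag_cmul (\<mu> c') b)"
          using hom_mult[OF \<tau>(1), of "c - frag_cmul (\<mu> c) b" "c' - frag_cmul (\<mu> c') b"] \<mu> cc by simp
        moreover have "(c - frag_cmul (\<mu> c) b) + (c' - frag_cmul (\<mu> c') b)
            = c + c' - frag_cmul (\<mu> (c + c')) b"
          using \<mu>_add[OF cc] by (simp add: frag_cmul_distrib)
        ultimately show "\<sigma> (c \<otimes>\<^bsub>frag_group B\<^esub> c') = \<sigma> c \<otimes>\<^bsub>frag_group A\<^esub> \<sigma> c'"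
          by (simp add: \<sigma>_def \<mu>_add[OF cc] frag_cmul_distrib)
      qed
      moreover have "f (\<sigma> x) = x" if "x \<in> B" for x
        using \<tau>(2)[OF \<mu>[OF that]] f(1) g(2)
        by (simp add: \<sigma>_def additive.add additive_cmul)
      ultimately show "\<exists>\<sigma> \<in> hom (frag_group B) (frag_group A). \<forall>x\<in>B. f (\<sigma> x) = x" by blast
    qed
  qed
  then show ?thesis using that f(2) by blast
qed

text \<open>
  A finitely generated abelian group all of whose elements have finite order is finite: each new
  generator contributes only finitely many cosets.
\<close>

lemma finite_torsion_image:
  assumes fin: "finite S" and B: "frag_subgroup B" "B \<subseteq> {c. Poly_Mapping.keys c \<subseteq> S}"
    and H: "comm_group H" and f: "f \<in> hom (frag_group B) H"
    and tors: "\<And>x. x \<in> B \<Longrightarrow> \<exists>m::nat. m > 0 \<and> f x [^]\<^bsub>H\<^esub> m = \<one>\<^bsub>H\<^esub>"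
  shows "finite (f ` B)"
proof -
  interpret H: comm_group H by fact
  have "f \<in> hom (frag_group B) H \<and> (\<forall>x\<in>B. \<exists>m::nat. m > 0 \<and> f x [^]\<^bsub>H\<^esub> m = \<one>\<^bsub>H\<^esub>) \<longrightarrow> finite (f ` B)"
    using fin B
  proof (induct B rule: frag_subgroup_induct)
    case zero
    show ?case by simp
  next
    case (step B' B b)
    show ?case
    proof (intro impI, elim conjE)
      assume f: "f \<in> hom (frag_group B) H"
        and t: "\<forall>x\<in>B. \<exists>m::nat. m > 0 \<and> f x [^]\<^bsub>H\<^esub> m = \<one>\<^bsub>H\<^esub>"
      have f': "f \<in> hom (frag_group B') H" using f step(4) by (auto simp: hom_def subset_iff)
      then have fin': "finite (f ` B')" using step(3,4) t by blast
      obtain k :: nat where k: "k > 0" "f b [^]\<^bsub>H\<^esub> k = \<one>\<^bsub>H\<^esub>" using t step(5) by blast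
      have fb: "f b \<in> carrier H" using f step(5) by (auto simp: hom_def)
      have "f ` B \<subseteq> (\<lambda>(u, i). u \<otimes>\<^bsub>H\<^esub> f b [^]\<^bsub>H\<^esub> i) ` (f ` B' \<times> {0..<int k})"
      proof
        fix y assume "y \<in> f ` B"
        then obtain c where c: "c \<in> B" "y = f c" by auto
        then obtain m where m: "c - frag_cmul m b \<in> B'" using step(6) by blast
        have mb: "frag_cmul m b \<in> B" using frag_subgroup_cmul[OF step(2,5)] .
        have "y = f ((c - frag_cmul m b) + frag_cmul m b)" using c by simp
        also have "\<dots> = f (c - frag_cmul m b) \<otimes>\<^bsub>H\<^esub> f (frag_cmul m b)"
          using hom_mult[OF f, of "c - frag_cmul m b" "frag_cmul m b"] m mb step(4) by auto
        also have "f (frag_cmul m b) = f b [^]\<^bsub>H\<^esub> m"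
          using comm_group_hom_int_pow[OF comm_group_frag_group[OF step(2)] H f, of b m] step(2,5)
          by (simp add: frag_group_int_pow)
        also have "f b [^]\<^bsub>H\<^esub> m = f b [^]\<^bsub>H\<^esub> (m mod int k)"
        proof -
          have "f b [^]\<^bsub>H\<^esub> m = f b [^]\<^bsub>H\<^esub> (int k * (m div int k) + m mod int k)" by simp
          also have "\<dots> = (f b [^]\<^bsub>H\<^esub> int k) [^]\<^bsub>H\<^esub> (m div int k) \<otimes>\<^bsub>H\<^esub> f b [^]\<^bsub>H\<^esub> (m mod int k)"
            using fb by (simp only: H.int_pow_mult H.int_pow_pow)
          also have "f b [^]\<^bsub>H\<^esub> int k = \<one>\<^bsub>H\<^esub>" using k by (simp add: int_pow_int)
          finally show ?thesis using fb by simp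
        qed
        finally show "y \<in> (\<lambda>(u, i). u \<otimes>\<^bsub>H\<^esub> f b [^]\<^bsub>H\<^esub> i) ` (f ` B' \<times> {0..<int k})"
          using m k by (intro image_eqI[of _ _ "(f (c - frag_cmul m b), m mod int k)"]) auto
      qed
      then show "finite (f ` B)" by (rule finite_subset) (use fin' in auto)
    qed
  qed
  then show ?thesis using f tors by blast
qed

section \<open>Complexes of subgroups of free abelian groups\<close>

definition frag_homology :: "(int \<Rightarrow> ('b \<Rightarrow>\<^sub>0 int) set) \<Rightarrow> (int \<Rightarrow> ('b \<Rightarrow>\<^sub>0 int) \<Rightarrow> ('b \<Rightarrow>\<^sub>0 int)) \<Rightarrow> int
    \<Rightarrow> ('b \<Rightarrow>\<^sub>0 int) set monoid" where
  "frag_homology C D n = frag_group {c \<in> C n. D n c = 0} Mod (D (n + 1) ` C (n + 1))"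

locale frag_complex =
  fixes C :: "int \<Rightarrow> ('b \<Rightarrow>\<^sub>0 int) set" and D :: "int \<Rightarrow> ('b \<Rightarrow>\<^sub>0 int) \<Rightarrow> ('b \<Rightarrow>\<^sub>0 int)"
  assumes C_subgroup: "frag_subgroup (C n)"
    and D_additive: "additive (D n)"
    and D_closed: "c \<in> C n \<Longrightarrow> D n c \<in> C (n - 1)"
    and D_D: "c \<in> C (n + 1) \<Longrightarrow> D n (D (n + 1) c) = 0"
begin

abbreviation "Z n \<equiv> {c \<in> C n. D n c = 0}"
abbreviation "B n \<equiv> D (n + 1) ` C (n + 1)"

lemmas C_closed = frag_subgroupD[OF C_subgroup]
lemmas D_simps = additive.zero[OF D_additive] additive.minus[OF D_additive]
  additive.diff[OF D_additive] additive.add[OF D_additive] additive_cmul[OF D_additive]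

lemma cycles: "frag_subgroup (Z n)"
  by (auto simp: frag_subgroup_def D_simps C_closed)

lemma boundaries: "frag_subgroup (B n)"
  unfolding frag_subgroup_def
proof (intro conjI ballI)
  show "0 \<in> B n" by (rule image_eqI[of _ _ 0]) (simp_all add: D_simps C_closed)
  fix x y assume "x \<in> B n" "y \<in> B n"
  then obtain u v where "u \<in> C (n + 1)" "v \<in> C (n + 1)" "x = D (n + 1) u" "y = D (n + 1) v" by auto
  then show "x - y \<in> B n" by (intro image_eqI[of _ _ "u - v"]) (auto simp: D_simps C_closed)
qed

lemma boundaries_cycles: "B n \<subseteq> Z n"
  using D_closed[of _ "n + 1"] D_D by auto

lemma boundaries_subgroup: "subgroup (B n) (frag_group (Z n))"
  by (rule subgroup_frag_group[OF cycles boundaries boundaries_cycles])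

lemma comm_group_homology: "comm_group (frag_homology C D n)"
  unfolding frag_homology_def
  by (rule comm_group.abelian_FactGroup[OF comm_group_frag_group[OF cycles] boundaries_subgroup])

definition cls :: "int \<Rightarrow> ('b \<Rightarrow>\<^sub>0 int) \<Rightarrow> ('b \<Rightarrow>\<^sub>0 int) set" where
  "cls n c = B n #>\<^bsub>frag_group (Z n)\<^esub> c"

lemma cls_hom: "cls n \<in> hom (frag_group (Z n)) (frag_homology C D n)"
  unfolding frag_homology_def cls_def[abs_def]
  by (rule coset_hom_Mod[OF comm_group_frag_group[OF cycles] boundaries_subgroup])

lemma carrier_homology: "carrier (frag_homology C D n) = cls n ` Z n"
  by (simp add: frag_homology_def carrier_FactGroup cls_def)

lemma cls_eq: "x \<in> Z n \<Longrightarrow> y \<in> Z n \<Longrightarrow> cls n x = cls n y \<longleftrightarrow> x - y \<in> B n"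
  unfolding cls_def by (rule coset_frag_group_eq[OF cycles boundaries boundaries_cycles])

lemma cls_0: "\<one>\<^bsub>frag_homology C D n\<^esub> = cls n 0"
  using hom_one[OF cls_hom] comm_group_frag_group[OF cycles] comm_group_homology
  by (simp add: comm_group_def)

lemma cls_eq_one: "x \<in> Z n \<Longrightarrow> cls n x = \<one>\<^bsub>frag_homology C D n\<^esub> \<longleftrightarrow> x \<in> B n"
  using cls_eq[of x n 0] by (simp add: cls_0 D_simps C_closed)

lemma cls_pow: "x \<in> Z n \<Longrightarrow> cls n x [^]\<^bsub>frag_homology C D n\<^esub> (m::int) = cls n (frag_cmul m x)"
  using comm_group_hom_int_pow[OF comm_group_frag_group[OF cycles] comm_group_homology cls_hom, of x n m]
    frag_group_int_pow[OF cycles, of x n m] by simp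

lemma finite_torsion_homology:
  assumes "finite S" "C n \<subseteq> {c. Poly_Mapping.keys c \<subseteq> S}"
    and "carrier (frag_homology C D n) \<subseteq> torsion_elements (frag_homology C D n)"
  shows "finite (carrier (frag_homology C D n))"
  unfolding carrier_homology
proof (rule finite_torsion_image[OF assms(1) cycles _ comm_group_homology cls_hom])
  fix x assume "x \<in> Z n"
  then show "\<exists>m::nat. m > 0 \<and> cls n x [^]\<^bsub>frag_homology C D n\<^esub> m = \<one>\<^bsub>frag_homology C D n\<^esub>"
    using assms(3) carrier_homology by (auto simp: torsion_elements_def)
qed (use assms in auto)

end

lemma (in frag_complex) homology_iso_of_surjective_hom:
  assumes "group H" "f \<in> hom (frag_group (Z n)) H" "f ` Z n = carrier H"
    and "\<And>c. c \<in> Z n \<Longrightarrow> f c = \<one>\<^bsub>H\<^esub> \<longleftrightarrow> c \<in> B n"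
  shows "frag_homology C D n \<cong> H"
  unfolding frag_homology_def
proof (rule Mod_iso_of_surjective_hom(2)[OF _ assms(1,2)])
  show "group (frag_group (Z n))" using comm_group_frag_group[OF cycles] comm_group_def by blast
qed (use assms boundaries_cycles in auto)

lemma (in frag_complex) homology_of_zero:
  assumes "C n = {0}"
  shows "carrier (frag_homology C D n) = {\<one>\<^bsub>frag_homology C D n\<^esub>}"
proof -
  have "Z n = {0}" unfolding assms using D_simps(1) by auto
  then show ?thesis unfolding carrier_homology cls_0 by simp
qed

section \<open>Complexes with a degeneracy\<close>

text \<open>
  The last three identities are the properties of the reduced multi-term complex from which the
  theorem follows. Here \<open>N\<close> stands for the sum of the scalars, \<open>s\<close> for the repetition and \<open>d\<close> for the
  deletion of the first entry.
\<close>

locale degenerate_complex = frag_complex C D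
  for C :: "int \<Rightarrow> ('b \<Rightarrow>\<^sub>0 int) set" and D :: "int \<Rightarrow> ('b \<Rightarrow>\<^sub>0 int) \<Rightarrow> ('b \<Rightarrow>\<^sub>0 int)" +
  fixes d s :: "('b \<Rightarrow>\<^sub>0 int) \<Rightarrow> ('b \<Rightarrow>\<^sub>0 int)" and N :: int
  assumes C_neg: "n < 0 \<Longrightarrow> C n = {0}"
    and C_finite: "\<exists>S. finite S \<and> C n \<subseteq> {c. Poly_Mapping.keys c \<subseteq> S}"
    and d_additive: "additive d" and s_additive: "additive s"
    and d_closed: "c \<in> C n \<Longrightarrow> d c \<in> C (n - 1)"
    and s_closed: "c \<in> C n \<Longrightarrow> s c \<in> C (n + 1)"
    and d_s: "c \<in> C n \<Longrightarrow> d (s c) = c"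
    and D_s: "c \<in> C n \<Longrightarrow> D (n + 1) (s c) = frag_cmul N (s (d c)) - s (D n c)"
    and d_D: "c \<in> C n \<Longrightarrow> d (D n c) = frag_cmul N (d (d c)) - D (n - 1) (d c)"
begin

lemmas d_simps = additive.zero[OF d_additive] additive.minus[OF d_additive]
  additive.diff[OF d_additive] additive.add[OF d_additive] additive_cmul[OF d_additive]
lemmas s_simps = additive.zero[OF s_additive] additive.minus[OF s_additive]
  additive.diff[OF s_additive] additive.add[OF s_additive] additive_cmul[OF s_additive]
lemmas cmul_closed = frag_subgroup_cmul[OF C_subgroup]

text \<open>
  The chain map \<open>s d\<close> is the projection onto \<open>F\<close> along \<open>K\<close>.
\<close>

definition F :: "int \<Rightarrow> ('b \<Rightarrow>\<^sub>0 int) set" where "F n = s ` C (n - 1)"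
definition K :: "int \<Rightarrow> ('b \<Rightarrow>\<^sub>0 int) set" where "K n = {c \<in> C n. d c = 0}"

lemma s_closed': "c \<in> C (n - 1) \<Longrightarrow> s c \<in> C n"
  using s_closed[of c "n - 1"] by simp

lemma D_s': "c \<in> C (n - 1) \<Longrightarrow> D n (s c) = frag_cmul N (s (d c)) - s (D (n - 1) c)"
  using D_s[of c "n - 1"] by simp

lemma F_C: "c \<in> F n \<Longrightarrow> c \<in> C n"
  using s_closed' by (auto simp: F_def)

lemma K_C: "c \<in> K n \<Longrightarrow> c \<in> C n"
  by (simp add: K_def)

lemma F_iff: "c \<in> F n \<longleftrightarrow> c \<in> C n \<and> s (d c) = c"
proof
  assume "c \<in> C n \<and> s (d c) = c"
  then show "c \<in> F n" unfolding F_def using d_closed[of c n] by (metis imageI)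
qed (auto simp: F_def d_s intro: s_closed')

lemma proj_F: "c \<in> C n \<Longrightarrow> s (d c) \<in> F n"
  using d_closed by (auto simp: F_def)

lemma proj_K: "c \<in> C n \<Longrightarrow> c - s (d c) \<in> K n"
  using C_closed(2)[OF _ F_C[OF proj_F]] d_s[OF d_closed] by (simp add: K_def d_simps)

text \<open>
  Moving \<open>D\<close> past \<open>s\<close> and past \<open>d\<close> produces the same term \<open>N s d d\<close>.
\<close>

lemma D_proj: "c \<in> C n \<Longrightarrow> D n (s (d c)) = s (d (D n c))"
  using D_s'[OF d_closed] by (simp add: d_D s_simps)

lemma F_complex: "frag_complex F D"
proof
  fix n
  show "frag_subgroup (F n)"
    using C_closed by (auto simp: frag_subgroup_def F_iff d_simps s_simps)
  show "D n c \<in> F (n - 1)" if "c \<in> F n" for c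
    using that D_closed D_proj[of c] by (simp add: F_iff)
  show "D n (D (n + 1) c) = 0" if "c \<in> F (n + 1)" for c using D_D F_C[OF that] by blast
qed (simp add: D_simps)

lemma K_complex: "frag_complex K D"
proof
  fix n
  show "frag_subgroup (K n)"
    using C_closed by (auto simp: frag_subgroup_def K_def d_simps)
  show "D n c \<in> K (n - 1)" if "c \<in> K n" for c
    using that D_closed d_D by (simp add: K_def d_simps D_simps)
  show "D n (D (n + 1) c) = 0" if "c \<in> K (n + 1)" for c using D_D K_C[OF that] by blast
qed (simp add: D_simps)

sublocale F: frag_complex F D by (rule F_complex)
sublocale K: frag_complex K D by (rule K_complex)

abbreviation "HC \<equiv> frag_homology C D"
abbreviation "HF \<equiv> frag_homology F D"
abbreviation "HK \<equiv> frag_homology K D"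

lemma grp_HC: "group (HC n)" and grp_HF: "group (HF n)" and grp_HK: "group (HK n)"
  using comm_group_homology F.comm_group_homology K.comm_group_homology comm_group_def by blast+

text \<open>
  For \<open>N = 0\<close> the bijection \<open>s\<close> from \<open>C\<^sub>n\<close> to \<open>F\<^sub>n\<^sub>+\<^sub>1\<close> anticommutes with the differentials.
\<close>

lemma HF_shift_iso:
  assumes "N = 0"
  shows "HF (n + 1) \<cong> HC n"
proof (rule F.homology_iso_of_surjective_hom[OF grp_HC])
  have Ds: "D (m + 1) (s c) = - s (D m c)" if "c \<in> C m" for m c
    using D_s[OF that] assms by simp
  have Z: "s c \<in> F.Z (n + 1) \<longleftrightarrow> c \<in> Z n" if "c \<in> C n" for c
  proof -
    have "s (D n c) = 0 \<longleftrightarrow> D n c = 0"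
      using d_s[OF D_closed[OF that]] by (metis d_simps(1) s_simps(1))
    then show ?thesis using that by (auto simp: F_def Ds)
  qed
  have FZ: "F.Z (n + 1) = s ` Z n" using Z by (auto simp: F_def)
  have "d \<in> hom (frag_group (F.Z (n + 1))) (frag_group (Z n))"
    by (rule hom_frag_group[OF d_additive]) (auto simp: FZ d_s)
  from hom_compose[OF this cls_hom]
  show "(\<lambda>c. cls n (d c)) \<in> hom (frag_group (F.Z (n + 1))) (HC n)" by (simp add: o_def)
  show "(\<lambda>c. cls n (d c)) ` F.Z (n + 1) = carrier (HC n)"
    unfolding FZ carrier_homology image_image by (rule image_cong) (auto simp: d_s)
  fix e assume "e \<in> F.Z (n + 1)"
  then obtain c where c: "c \<in> Z n" "e = s c" by (auto simp: FZ)
  have de: "d e = c" using c d_s by auto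
  have "cls n (d e) = \<one>\<^bsub>HC n\<^esub> \<longleftrightarrow> c \<in> B n" unfolding de by (rule cls_eq_one[OF c(1)])
  also have "\<dots> \<longleftrightarrow> e \<in> F.B (n + 1)"
  proof
    assume "c \<in> B n"
    then obtain w where w: "w \<in> C (n + 1)" "c = D (n + 1) w" by auto
    then have "e = D (n + 1 + 1) (s (- w))"
      using Ds[of "- w" "n + 1"] c C_closed(3) by (simp add: D_simps s_simps)
    moreover have "s (- w) \<in> F (n + 1 + 1)"
      unfolding F_def add_diff_cancel_right' using w C_closed(3) by blast
    ultimately show "e \<in> F.B (n + 1)" by blast
  next
    assume "e \<in> F.B (n + 1)"
    then obtain f where "f \<in> F (n + 1 + 1)" "e = D (n + 1 + 1) f" by (rule imageE)
    then obtain w where w: "w \<in> C (n + 1)" "e = D (n + 1 + 1) (s w)"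
      unfolding F_def add_diff_cancel_right' by blast
    then have "c = d (- s (D (n + 1) w))" using Ds[of w "n + 1"] de by simp
    also have "\<dots> = D (n + 1) (- w)" using d_s[OF D_closed[OF w(1)]] by (simp add: d_simps D_simps)
    finally show "c \<in> B n" using w C_closed(3) by blast
  qed
  finally show "cls n (d e) = \<one>\<^bsub>HC n\<^esub> \<longleftrightarrow> e \<in> F.B (n + 1)" .
qed

text \<open>
  The projections \<open>s d\<close> and \<open>1 - s d\<close> are chain maps by \<open>D_proj\<close>.
\<close>

lemma HC_split_iso: "HC n \<cong> HF n \<times>\<times> HK n"
proof (rule homology_iso_of_surjective_hom)
  let ?f = "\<lambda>c. (F.cls n (s (d c)), K.cls n (c - s (d c)))"
  show "group (HF n \<times>\<times> HK n)" by (rule DirProd_group[OF grp_HF grp_HK])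
  have p1: "s (d c) \<in> F.Z n" if "c \<in> Z n" for c
    using that proj_F D_proj by (auto simp: d_simps s_simps)
  have p2: "c - s (d c) \<in> K.Z n" if "c \<in> Z n" for c
    using that proj_K D_proj by (auto simp: d_simps s_simps D_simps)
  have "(\<lambda>c. s (d c)) \<in> hom (frag_group (Z n)) (frag_group (F.Z n))"
    by (rule hom_frag_group) (use p1 in \<open>auto simp: additive_def d_simps s_simps\<close>)
  note h1 = hom_compose[OF this F.cls_hom]
  have "(\<lambda>c. c - s (d c)) \<in> hom (frag_group (Z n)) (frag_group (K.Z n))"
    by (rule hom_frag_group) (use p2 in \<open>auto simp: additive_def d_simps s_simps\<close>)
  note h2 = hom_compose[OF this K.cls_hom]
  show "?f \<in> hom (frag_group (Z n)) (HF n \<times>\<times> HK n)"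
    unfolding hom_paired using h1 h2 by (simp add: o_def)
  show "?f ` Z n = carrier (HF n \<times>\<times> HK n)"
  proof
    show "?f ` Z n \<subseteq> carrier (HF n \<times>\<times> HK n)"
      using p1 p2 by (force simp: F.carrier_homology K.carrier_homology)
    show "carrier (HF n \<times>\<times> HK n) \<subseteq> ?f ` Z n"
    proof
      fix z assume "z \<in> carrier (HF n \<times>\<times> HK n)"
      then obtain x y where xy: "x \<in> F.Z n" "y \<in> K.Z n" "z = (F.cls n x, K.cls n y)"
        by (auto simp: F.carrier_homology K.carrier_homology)
      have "s (d (x + y)) = x" using xy by (simp add: F_iff K_def d_simps s_simps)
      moreover have "x + y \<in> Z n" using xy C_closed(4)[of x n y] by (simp add: F_iff K_def D_simps)
      ultimately show "z \<in> ?f ` Z n" using xy by (intro image_eqI[of _ _ "x + y"]) auto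
    qed
  qed
  fix c assume c: "c \<in> Z n"
  have "?f c = \<one>\<^bsub>HF n \<times>\<times> HK n\<^esub> \<longleftrightarrow> s (d c) \<in> F.B n \<and> c - s (d c) \<in> K.B n"
    using F.cls_eq_one[OF p1[OF c]] K.cls_eq_one[OF p2[OF c]] by simp
  also have "\<dots> \<longleftrightarrow> c \<in> B n"
  proof
    assume "s (d c) \<in> F.B n \<and> c - s (d c) \<in> K.B n"
    then obtain u v where uv: "u \<in> F (n + 1)" "v \<in> K (n + 1)" "s (d c) = D (n + 1) u" "c - s (d c) = D (n + 1) v"
      by auto
    then have "c = D (n + 1) (u + v)" by (simp add: D_simps algebra_simps)
    then show "c \<in> B n" using uv C_closed(4)[OF F_C K_C] by blast
  next
    assume "c \<in> B n"
    then obtain w where w: "w \<in> C (n + 1)" "c = D (n + 1) w" by auto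
    then have "s (d c) = D (n + 1) (s (d w))" "c - s (d c) = D (n + 1) (w - s (d w))"
      using D_proj by (simp_all add: D_simps)
    then show "s (d c) \<in> F.B n \<and> c - s (d c) \<in> K.B n" using proj_F proj_K w by blast
  qed
  finally show "?f c = \<one>\<^bsub>HF n \<times>\<times> HK n\<^esub> \<longleftrightarrow> c \<in> B n" .
qed

text \<open>
  An element \<open>e\<close> of \<open>F\<^sub>n\<^sub>+\<^sub>1\<close> has unique coordinates \<open>e = s (s (g + y) + x)\<close> with \<open>g \<in> F\<^sub>n\<^sub>-\<^sub>1\<close>, \<open>y \<in> K\<^sub>n\<^sub>-\<^sub>1\<close> and
  \<open>x \<in> K\<^sub>n\<close>. It is a cycle exactly if \<open>g\<close> and \<open>y\<close> are cycles and \<open>D x = N y\<close>. Its differential has the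
  coordinates \<open>D g\<close>, \<open>D y\<close> and \<open>N y - D x\<close>. So the homology of \<open>F\<close> is that of a shifted copy of \<open>F\<close>
  plus that of the cone of multiplication by \<open>N\<close> on \<open>K\<close>.

  The class of \<open>y\<close> is an \<open>N\<close>-torsion class of \<open>K\<close>. To turn \<open>x\<close> into a cycle one subtracts
  \<open>\<sigma> (N y)\<close>, where \<open>\<sigma>\<close> is a section of \<open>D\<close> over the boundaries of \<open>K\<close>; its class is determined only
  modulo \<open>N\<close>, since changing \<open>e\<close> by a boundary may change \<open>x\<close> by \<open>N\<close> times a cycle.
\<close>

lemma HF_recursion_iso:
  "HF (n + 1) \<cong> HF (n - 1) \<times>\<times> (mult_quotient (HK n) N \<times>\<times> mult_torsion (HK (n - 1)) N)"
proof -
  have Ds: "D (n + 1 + 1) (s c) = frag_cmul N (s (d c)) - s (D (n + 1) c)" if "c \<in> C (n + 1)" for c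
    using D_s[OF that] .
  have in_nn: "c \<in> C (n - 1 + 1) \<longleftrightarrow> c \<in> C n" for c by simp
  have BK: "K.B (n - 1) = D n ` K n" by simp
  obtain S where S: "finite S" "C (n - 1) \<subseteq> {c. Poly_Mapping.keys c \<subseteq> S}" using C_finite by blast
  have "K.B (n - 1) \<subseteq> {c. Poly_Mapping.keys c \<subseteq> S}" using K.boundaries_cycles K_C S(2) by blast
  then obtain \<sigma> where \<sigma>: "\<sigma> \<in> hom (frag_group (K.B (n - 1))) (frag_group (K n))"
    and D\<sigma>: "\<And>x. x \<in> K.B (n - 1) \<Longrightarrow> D n (\<sigma> x) = x"
    using frag_section[OF S(1) K.boundaries[of "n - 1"] _ K.C_subgroup[of n] D_additive[of n]]
    unfolding BK by blast
  have \<sigma>K: "\<sigma> x \<in> K n" if "x \<in> K.B (n - 1)" for x using \<sigma> that by (auto simp: hom_def)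
  have \<sigma>_add: "\<sigma> (x + y) = \<sigma> x + \<sigma> y" if "x \<in> K.B (n - 1)" "y \<in> K.B (n - 1)" for x y
    using hom_mult[OF \<sigma>] that by simp
  have \<sigma>_cmul: "\<sigma> (frag_cmul m x) = frag_cmul m (\<sigma> x)" if "x \<in> K.B (n - 1)" for m x
    by (rule hom_frag_group_cmul[OF K.boundaries K.C_subgroup \<sigma> that])

  (* The coordinates of e; the sum g e + y e is w e. *)
  define w where "w e = d (d e)" for e
  define g where "g e = s (d (w e))" for e
  define y where "y e = w e - s (d (w e))" for e
  define x where "x e = d e - s (w e)" for e
  have add: "additive w" "additive g" "additive y" "additive x"
    by (auto simp: additive_def w_def g_def y_def x_def d_simps s_simps)
  note add_simps = additive.add[OF add(1)] additive.add[OF add(2)] additive.add[OF add(3)] additive.add[OF add(4)]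
  have parts: "d e \<in> C n" "w e \<in> C (n - 1)" "e = s (s (w e) + x e)" "w e = g e + y e"
      "g e \<in> F.Z (n - 1)" "y e \<in> K.Z (n - 1)" "x e \<in> K n" "D n (x e) = frag_cmul N (y e)"
    if e: "e \<in> F.Z (n + 1)" for e
  proof -
    obtain c where c: "c \<in> C n" "e = s c" using e by (auto simp: F_def)
    have de: "d e = c" using c d_s by simp
    show dC: "d e \<in> C n" using c de by simp
    show wC: "w e \<in> C (n - 1)" unfolding w_def using d_closed[OF dC] .
    show "e = s (s (w e) + x e)" using c de by (simp add: x_def)
    show "w e = g e + y e" by (simp add: y_def g_def)
    have "s (frag_cmul N (d c) - D n c) = 0"
      using e D_s[OF c(1)] c(2) by (simp add: s_simps)
    moreover have "frag_cmul N (d c) - D n c \<in> C (n - 1)"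
      using C_closed(2) cmul_closed d_closed D_closed c(1) by blast
    ultimately have "frag_cmul N (d c) - D n c = 0" using d_s by (metis d_simps(1))
    then have Dc: "D n c = frag_cmul N (w e)" by (simp add: w_def de)
    have "frag_cmul N (d (w e)) = frag_cmul N (d (w e)) - D (n - 1) (w e)"
      using d_D[OF c(1)] Dc by (simp add: d_simps w_def de)
    then have Dw: "D (n - 1) (w e) = 0" by (metis add_diff_cancel_left' cancel_comm_monoid_add_class.diff_zero diff_add_cancel diff_diff_eq2 diff_self)
    have Dg: "D (n - 1) (g e) = 0" unfolding g_def using D_proj[OF wC] Dw by (simp add: d_simps s_simps)
    show "g e \<in> F.Z (n - 1)" using Dg proj_F[OF wC] by (simp add: g_def)
    show "y e \<in> K.Z (n - 1)" using proj_K[OF wC] Dw Dg by (simp add: y_def D_simps g_def)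
    show "x e \<in> K n" using proj_K[OF c(1)] by (simp add: x_def w_def de)
    have "D n (s (w e)) = frag_cmul N (s (d (w e)))" using D_s'[OF wC] Dw by (simp add: s_simps)
    then show "D n (x e) = frag_cmul N (y e)" by (simp add: x_def de D_simps Dc y_def frag_cmul_diff)
  qed
  (* Conversely, coordinates that satisfy the three conditions come from a cycle. *)
  have build: "e \<in> F.Z (n + 1) \<and> g e = g' \<and> y e = y' \<and> x e = x'"
    if g': "g' \<in> F.Z (n - 1)" and y': "y' \<in> K.Z (n - 1)" and x': "x' \<in> K n" "D n x' = frag_cmul N y'"
      and e: "e = s (s (g' + y') + x')" for e g' y' x'
  proof -
    have gy: "g' + y' \<in> C (n - 1)" using g' y' C_closed(4) F_C K_C by blast
    have c: "s (g' + y') + x' \<in> C n" using s_closed'[OF gy] x' C_closed(4) K_C by blast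
    have de: "d e = s (g' + y') + x'" using e d_s[OF c] by simp
    have we: "w e = g' + y'" unfolding w_def de using d_s[OF gy] x' by (simp add: d_simps K_def)
    have ge: "g e = g'" unfolding g_def we using g' y' by (simp add: d_simps s_simps F_iff K_def)
    have ye: "y e = y'" using ge unfolding y_def g_def we by simp
    have xe: "x e = x'" unfolding x_def de we by simp
    have "D n (s (g' + y')) = frag_cmul N (s (d (g' + y')))"
      using D_s'[OF gy] g' y' by (simp add: D_simps s_simps)
    then have "D n (s (g' + y') + x') = frag_cmul N (g' + y')"
      using x' ge unfolding g_def we by (simp add: D_simps frag_cmul_distrib2)
    then have "D (n + 1) e = 0"
      unfolding e using D_s[OF c] we de by (simp add: w_def s_simps)
    moreover have "e \<in> F (n + 1)" using c e by (simp add: F_def)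
    ultimately show ?thesis using ge ye xe by simp
  qed
  (* The coordinates of the differential of s c', in terms of those of s c'. *)
  have boundary: "D (n + 1 + 1) (s c') = s (s (D n w') + (frag_cmul N (w' - s (d w')) - D (n + 1) (c' - s w')))"
    if c': "c' \<in> C (n + 1)" and w': "w' = d c'" for c' w'
  proof -
    have "D (n + 1) (s w') = frag_cmul N (s (d w')) - s (D n w')"
      using D_s'[of w' "n + 1"] d_closed[OF c'] w' by simp
    then show ?thesis using Ds[OF c'] w' by (simp add: s_simps D_simps frag_cmul_diff)
  qed

  let ?G = "frag_group (F.Z (n + 1))"
  let ?q = "\<lambda>a. (\<lambda>b. b [^]\<^bsub>HK n\<^esub> N) ` carrier (HK n) #>\<^bsub>HK n\<^esub> a"
  let ?x = "\<lambda>e. x e - \<sigma> (frag_cmul N (y e))"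
  let ?f = "\<lambda>e. (F.cls (n - 1) (g e), ?q (K.cls n (?x e)), K.cls (n - 1) (y e))"
  have NyB: "frag_cmul N (y e) \<in> K.B (n - 1)" if "e \<in> F.Z (n + 1)" for e
    using parts(7,8)[OF that] unfolding BK by (metis imageI)
  have xZ: "?x e \<in> K.Z n" if "e \<in> F.Z (n + 1)" for e
    using parts(7,8)[OF that] \<sigma>K[OF NyB[OF that]] D\<sigma>[OF NyB[OF that]] K.C_closed(2)
    by (simp add: D_simps)
  have h1: "(\<lambda>e. F.cls (n - 1) (g e)) \<in> hom ?G (HF (n - 1))"
    using hom_compose[OF hom_frag_group[OF add(2)] F.cls_hom, of "F.Z (n + 1)" "n - 1"] parts(5)
    by (auto simp: o_def)
  have "?x \<in> hom ?G (frag_group (K.Z n))"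
  proof (rule homI)
    show "?x e \<in> carrier (frag_group (K.Z n))" if "e \<in> carrier ?G" for e using xZ[of e] that by simp
    fix e e' assume "e \<in> carrier ?G" "e' \<in> carrier ?G"
    then show "?x (e \<otimes>\<^bsub>?G\<^esub> e') = ?x e \<otimes>\<^bsub>frag_group (K.Z n)\<^esub> ?x e'"
      using \<sigma>_add[OF NyB NyB, of e e'] by (simp add: add_simps frag_cmul_distrib2)
  qed
  note hx = hom_compose[OF this K.cls_hom]
  have h2: "(\<lambda>e. ?q (K.cls n (?x e))) \<in> hom ?G (mult_quotient (HK n) N)"
    using hom_compose[OF hx coset_hom_Mod[OF K.comm_group_homology comm_group.powers_subgroup[OF K.comm_group_homology, where m = N]]]
    by (simp add: o_def mult_quotient_def)
  have y_tors: "K.cls (n - 1) (y e) [^]\<^bsub>HK (n - 1)\<^esub> N = \<one>\<^bsub>HK (n - 1)\<^esub>" if "e \<in> F.Z (n + 1)" for e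
  proof -
    have "frag_cmul N (y e) \<in> K.Z (n - 1)" using frag_subgroup_cmul[OF K.cycles parts(6)[OF that]] .
    then show ?thesis using K.cls_pow[OF parts(6)[OF that]] K.cls_eq_one NyB[OF that] by simp
  qed
  have "(\<lambda>e. K.cls (n - 1) (y e)) \<in> hom ?G (HK (n - 1))"
    using hom_compose[OF hom_frag_group[OF add(3)] K.cls_hom, of "F.Z (n + 1)" "n - 1"] parts(6)
    by (auto simp: o_def)
  then have h3: "(\<lambda>e. K.cls (n - 1) (y e)) \<in> hom ?G (mult_torsion (HK (n - 1)) N)"
    using y_tors by (auto simp: hom_def mult_torsion_def)
  show ?thesis
  proof (rule F.homology_iso_of_surjective_hom)
    show "group (HF (n - 1) \<times>\<times> (mult_quotient (HK n) N \<times>\<times> mult_torsion (HK (n - 1)) N))"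
      using comm_group_DirProd[OF F.comm_group_homology comm_group_DirProd[OF 
        comm_group_mult_quotient[OF K.comm_group_homology] comm_group_mult_torsion[OF K.comm_group_homology]]]
        comm_group_def by blast
    show hom: "?f \<in> hom ?G (HF (n - 1) \<times>\<times> (mult_quotient (HK n) N \<times>\<times> mult_torsion (HK (n - 1)) N))"
      unfolding hom_paired using h1 h2 h3 by blast
    show "?f ` F.Z (n + 1) = carrier (HF (n - 1) \<times>\<times> (mult_quotient (HK n) N \<times>\<times> mult_torsion (HK (n - 1)) N))"
    proof
      show "?f ` F.Z (n + 1) \<subseteq> carrier (HF (n - 1) \<times>\<times> (mult_quotient (HK n) N \<times>\<times> mult_torsion (HK (n - 1)) N))"
        using hom_carrier[OF hom] by simp
      show "carrier (HF (n - 1) \<times>\<times> (mult_quotient (HK n) N \<times>\<times> mult_torsion (HK (n - 1)) N)) \<subseteq> ?f ` F.Z (n + 1)"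
      proof
        fix z assume z: "z \<in> carrier (HF (n - 1) \<times>\<times> (mult_quotient (HK n) N \<times>\<times> mult_torsion (HK (n - 1)) N))"
        obtain z1 z2 z3 where zz: "z = (z1, z2, z3)" by (metis surj_pair)
        obtain g' where g': "g' \<in> F.Z (n - 1)" "z1 = F.cls (n - 1) g'"
          using z zz by (auto simp: F.carrier_homology)
        obtain x1 where x1: "x1 \<in> K.Z n" "z2 = ?q (K.cls n x1)"
          using z zz by (auto simp: mult_quotient_def carrier_FactGroup K.carrier_homology)
        obtain y' where y': "y' \<in> K.Z (n - 1)" "z3 = K.cls (n - 1) y'"
          "K.cls (n - 1) y' [^]\<^bsub>HK (n - 1)\<^esub> N = \<one>\<^bsub>HK (n - 1)\<^esub>"
          using z zz by (auto simp: mult_torsion_def K.carrier_homology)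
        have "frag_cmul N y' \<in> K.Z (n - 1)" using frag_subgroup_cmul[OF K.cycles y'(1)] .
        then have NyB': "frag_cmul N y' \<in> K.B (n - 1)"
          using y'(3) K.cls_pow[OF y'(1)] K.cls_eq_one by simp
        define x' where "x' = x1 + \<sigma> (frag_cmul N y')"
        have x': "x' \<in> K n" "D n x' = frag_cmul N y'"
          using x1(1) \<sigma>K[OF NyB'] D\<sigma>[OF NyB'] K.C_closed(4) by (auto simp: x'_def D_simps)
        define e where "e = s (s (g' + y') + x')"
        have e: "e \<in> F.Z (n + 1)" "g e = g'" "y e = y'" "x e = x'"
          using build[OF g'(1) y'(1) x' e_def] by auto
        have "?f e = z" unfolding zz e(2,3,4) by (simp add: g' x1 y' x'_def)
        then show "z \<in> ?f ` F.Z (n + 1)" using e(1) by blast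
      qed
    qed
    fix e assume e: "e \<in> F.Z (n + 1)"
    note p = parts[OF e]
    have kerq: "?q (K.cls n (?x e)) = \<one>\<^bsub>mult_quotient (HK n) N\<^esub> \<longleftrightarrow>
        (\<exists>z\<in>K.Z n. ?x e - frag_cmul N z \<in> K.B n)"
    proof -
      have c: "K.cls n (?x e) \<in> carrier (HK n)" using xZ[OF e] K.carrier_homology by blast
      have "?q (K.cls n (?x e)) = \<one>\<^bsub>mult_quotient (HK n) N\<^esub> \<longleftrightarrow>
          K.cls n (?x e) \<in> (\<lambda>b. b [^]\<^bsub>HK n\<^esub> N) ` carrier (HK n)"
        using coset_in_Mod_eq_one[OF grp_HK comm_group.powers_subgroup[OF K.comm_group_homology] c]
        by (simp add: mult_quotient_def)
      also have "\<dots> \<longleftrightarrow> (\<exists>z\<in>K.Z n. K.cls n (?x e) = K.cls n z [^]\<^bsub>HK n\<^esub> N)"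
        unfolding K.carrier_homology by blast
      also have "\<dots> \<longleftrightarrow> (\<exists>z\<in>K.Z n. ?x e - frag_cmul N z \<in> K.B n)"
        using K.cls_pow K.cls_eq[OF xZ[OF e]] frag_subgroup_cmul[OF K.cycles] by (intro bex_cong) auto
      finally show ?thesis .
    qed
    have "?f e = \<one>\<^bsub>HF (n - 1) \<times>\<times> (mult_quotient (HK n) N \<times>\<times> mult_torsion (HK (n - 1)) N)\<^esub> \<longleftrightarrow>
        g e \<in> F.B (n - 1) \<and> (\<exists>z\<in>K.Z n. ?x e - frag_cmul N z \<in> K.B n) \<and> y e \<in> K.B (n - 1)"
      using F.cls_eq_one[OF p(5)] kerq K.cls_eq_one[OF p(6)] by (simp add: mult_torsion_def)
    also have "\<dots> \<longleftrightarrow> e \<in> F.B (n + 1)"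
    proof
      assume "e \<in> F.B (n + 1)"
      then obtain c'' where "c'' \<in> F (n + 1 + 1)" "e = D (n + 1 + 1) c''" by (rule imageE)
      then obtain c' where c': "c' \<in> C (n + 1)" "e = D (n + 1 + 1) (s c')"
        unfolding F_def add_diff_cancel_right' by blast
      define w' where "w' = d c'"
      have w'C: "w' \<in> C n" using d_closed[OF c'(1)] by (simp add: w'_def)
      define y' x' where "y' = w' - s (d w')" and "x' = c' - s w'"
      have y'K: "y' \<in> K n" using proj_K[OF w'C] by (simp add: y'_def)
      have x'K: "x' \<in> K (n + 1)" using proj_K[OF c'(1)] by (simp add: x'_def w'_def)
      have eq: "e = s (s (D n w') + (frag_cmul N y' - D (n + 1) x'))"
        using boundary[OF c'(1) w'_def] c'(2) by (simp add: y'_def x'_def)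
      have Dw'C: "D n w' \<in> C (n - 1)" using D_closed[OF w'C] .
      have Dg: "s (d (D n w')) = D n (s (d w'))" using D_proj[OF w'C] by simp
      have DwZ: "D (n - 1) (D n w') = 0" using D_D[of w' "n - 1"] w'C by simp
      have gy: "D n w' = D n (s (d w')) + D n y'" by (simp add: y'_def D_simps)
      have g'Z: "D n (s (d w')) \<in> F.Z (n - 1)"
        using F.boundaries_cycles[of "n - 1"] proj_F[OF w'C] by auto
      have y'Z: "D n y' \<in> K.Z (n - 1)" using K.boundaries_cycles[of "n - 1"] y'K by auto
      have x''K: "frag_cmul N y' - D (n + 1) x' \<in> K n"
        using K.C_closed(2)[OF frag_subgroup_cmul[OF K.C_subgroup y'K]] K.D_closed[OF x'K] by simp
      have Dx'': "D n (frag_cmul N y' - D (n + 1) x') = frag_cmul N (D n y')"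
        using K.D_D[OF x'K] by (simp add: D_simps)
      note b = build[OF g'Z y'Z x''K Dx'' eq[unfolded gy]]
      have yB: "D n y' \<in> K.B (n - 1)" using y'K by simp
      (* Since N y = D (N y'), the correction term changes N y' into N times the cycle z. *)
      define z where "z = y' - \<sigma> (D n y')"
      have zZ: "z \<in> K.Z n" using y'K \<sigma>K[OF yB] D\<sigma>[OF yB] K.C_closed(2) by (simp add: z_def D_simps)
      have "?x e - frag_cmul N z = D (n + 1) (- x')"
        using b by (simp add: \<sigma>_cmul[OF yB] z_def frag_cmul_diff D_simps)
      then have "?x e - frag_cmul N z \<in> K.B n" using K.C_closed(3)[OF x'K] by simp
      moreover have "g e \<in> F.B (n - 1)" using b proj_F[OF w'C] by simp
      moreover have "y e \<in> K.B (n - 1)" using b yB by simp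
      ultimately show "g e \<in> F.B (n - 1) \<and> (\<exists>z\<in>K.Z n. ?x e - frag_cmul N z \<in> K.B n) \<and> y e \<in> K.B (n - 1)"
        using zZ by blast
    next
      assume *: "g e \<in> F.B (n - 1) \<and> (\<exists>z\<in>K.Z n. ?x e - frag_cmul N z \<in> K.B n) \<and> y e \<in> K.B (n - 1)"
      then obtain g' where g': "g' \<in> F n" "g e = D n g'" by auto
      from * have yB: "y e \<in> K.B (n - 1)" by blast
      from * obtain z x' where z: "z \<in> K.Z n" and x': "x' \<in> K (n + 1)"
        and xz: "?x e - frag_cmul N z = D (n + 1) x'" by auto
      (* This y' has the boundary y e, and N y' absorbs both the correction term and N z. *)
      define y' where "y' = z + \<sigma> (y e)"
      have y'K: "y' \<in> K n" using z \<sigma>K[OF yB] K.C_closed(4) by (simp add: y'_def)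
      have Dy': "D n y' = y e" using z D\<sigma>[OF yB] by (simp add: y'_def D_simps)
      have xe: "x e = frag_cmul N y' + D (n + 1) x'"
        using xz by (simp add: y'_def frag_cmul_distrib2 \<sigma>_cmul[OF yB] algebra_simps)
      define w' where "w' = g' + y'"
      have w'C: "w' \<in> C n" using C_closed(4) F_C[OF g'(1)] K_C[OF y'K] by (simp add: w'_def)
      define c' where "c' = s w' - x'"
      have c'C: "c' \<in> C (n + 1)" using C_closed(2) s_closed[OF w'C] K_C[OF x'] by (simp add: c'_def)
      have dc': "w' = d c'" using d_s[OF w'C] x' by (simp add: c'_def d_simps K_def)
      have "w' - s (d w') = y'" using g'(1) y'K by (simp add: w'_def F_iff K_def d_simps s_simps)
      moreover have "c' - s w' = - x'" by (simp add: c'_def)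
      moreover have "D n w' = w e" using g' Dy' p(4) by (simp add: w'_def D_simps)
      ultimately have "D (n + 1 + 1) (s c') = s (s (w e) + x e)"
        using boundary[OF c'C dc'] xe by (simp add: D_simps)
      then have "e = D (n + 1 + 1) (s c')" using p(3) by simp
      moreover have "s c' \<in> F (n + 1 + 1)" unfolding F_def add_diff_cancel_right' using c'C by blast
      ultimately show "e \<in> F.B (n + 1)" by blast
    qed
    finally show "?f e = \<one>\<^bsub>HF (n - 1) \<times>\<times> (mult_quotient (HK n) N \<times>\<times> mult_torsion (HK (n - 1)) N)\<^esub> \<longleftrightarrow> e \<in> F.B (n + 1)" .
  qed
qed

end

section \<open>Homology of the degenerate part\<close>

context degenerate_complex
begin

lemma HC_neg: "n < 0 \<Longrightarrow> carrier (HC n) = {\<one>\<^bsub>HC n\<^esub>}"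
  by (rule homology_of_zero) (rule C_neg)

lemma HK_neg: "n < 0 \<Longrightarrow> carrier (HK n) = {\<one>\<^bsub>HK n\<^esub>}"
  by (rule K.homology_of_zero) (auto simp: K_def C_neg d_simps(1))

lemma HF_nonpos: "n \<le> 0 \<Longrightarrow> carrier (HF n) = {\<one>\<^bsub>HF n\<^esub>}"
  by (rule F.homology_of_zero) (auto simp: F_def C_neg s_simps(1))

lemmas cg_HC = comm_group_homology
lemmas cg_HF = F.comm_group_homology
lemmas cg_HK = K.comm_group_homology
lemmas cg_mqHC = comm_group_mult_quotient[OF cg_HC]
lemmas cg_mqHF = comm_group_mult_quotient[OF cg_HF]

lemma finite_HK:
  assumes "finite (carrier (HC n))"
  shows "finite (carrier (HK n))"
proof -
  have "finite (carrier (HF n \<times>\<times> HK n))" using HC_split_iso[of n] assms iso_finite by blast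
  moreover have "carrier (HF n) \<noteq> {}" using grp_HF[of n] group.is_monoid monoid.one_closed by blast
  ultimately show ?thesis by (auto dest: finite_cartesian_productD2)
qed

text \<open>
  All homology groups are finite here, so torsion may be replaced by quotients in the recursion.
  The induction also carries that \<open>N\<close> kills the homology of \<open>F\<close>. Then \<open>H\<^sub>n F \<cong> H\<^sub>n F / N\<close>, so that the
  induction hypothesis reads \<open>H\<^sub>n\<^sub>+\<^sub>1 F \<cong> H\<^sub>n F \<oplus> H\<^sub>n K / N\<close>, and two of the three summands of \<open>H\<^sub>n\<^sub>+\<^sub>2 F\<close>
  combine to \<open>H\<^sub>n\<^sub>+\<^sub>1 F\<close>.
\<close>

theorem HF_iso_of_torsion:
  assumes tors: "\<And>n. n \<ge> 0 \<Longrightarrow> carrier (HC n) \<subseteq> torsion_elements (HC n)" and n: "n \<ge> 0"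
  shows "HF (n + 1) \<cong> mult_quotient (HC n) N"
proof -
  have fin: "finite (carrier (HC n))" for n
  proof (cases "n \<ge> 0")
    case True
    obtain S where "finite S" "C n \<subseteq> {c. Poly_Mapping.keys c \<subseteq> S}" using C_finite by blast
    then show ?thesis using finite_torsion_homology tors[OF True] by blast
  qed (simp add: HC_neg)
  have tq: "mult_torsion (HK n) N \<cong> mult_quotient (HK n) N" for n
    by (rule finite_mult_torsion_iso_mult_quotient[OF cg_HK finite_HK[OF fin]])
  have split: "mult_quotient (HC n) N \<cong> mult_quotient (HF n) N \<times>\<times> mult_quotient (HK n) N" for n
    by (rule iso_trans[OF mult_quotient_iso[OF cg_HC comm_group_DirProd[OF cg_HF cg_HK] HC_split_iso]
          mult_quotient_DirProd[OF cg_HF cg_HK]])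
  let ?killed = "\<lambda>n. \<forall>x\<in>carrier (HF n). x [^]\<^bsub>HF n\<^esub> N = \<one>\<^bsub>HF n\<^esub>"
  have killed_iso: "mult_quotient (HF n) N \<cong> HF n" if "?killed n" for n
    by (rule mult_quotient_of_exponent_dividing[OF cg_HF]) (use that in blast)
  have killed_next: "?killed (n + 1)" if "HF (n + 1) \<cong> mult_quotient (HC n) N" for n
  proof
    fix x assume "x \<in> carrier (HF (n + 1))"
    then show "x [^]\<^bsub>HF (n + 1)\<^esub> N = \<one>\<^bsub>HF (n + 1)\<^esub>"
      by (intro exponent_iso[OF cg_mqHC cg_HF comm_group_iso_sym[OF cg_HF that]]
          mult_quotient_exponent[OF cg_HC])
  qed
  (* The induction starts in degree -1, where both groups are trivial. *)
  have "HF (n + 1) \<cong> mult_quotient (HC n) N \<and> ?killed n" if "n \<ge> -1" for n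
    using that
  proof (induction n rule: int_ge_induct)
    case base
    have "carrier (mult_quotient (HC (-1)) N) = {\<one>\<^bsub>mult_quotient (HC (-1)) N\<^esub>}"
    proof -
      have one: "\<one>\<^bsub>HC (-1)\<^esub> [^]\<^bsub>HC (-1)\<^esub> N = \<one>\<^bsub>HC (-1)\<^esub>"
        by (rule group.int_pow_one[OF grp_HC])
      have neg: "carrier (HC (-1)) = {\<one>\<^bsub>HC (-1)\<^esub>}" by (rule HC_neg) simp
      have "mult_quotient (HC (-1)) N \<cong> HC (-1)"
        by (rule mult_quotient_of_exponent_dividing[OF cg_HC]) (unfold neg, use one in blast)
      from iso_same_card[OF this] have "card (carrier (mult_quotient (HC (-1)) N)) = 1"
        unfolding neg by simp
      then show ?thesis
        using cg_mqHC[of "-1" N] comm_group.axioms(2) group.is_monoid monoid.one_closed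
        by (metis card_1_singletonE singletonD)
    qed
    then have "HF (-1 + 1) \<cong> mult_quotient (HC (-1)) N"
      by (intro trivial_groups_iso grp_HF comm_group.axioms(2)[OF cg_mqHC] HF_nonpos) simp_all
    moreover have "?killed (-1)"
      using HF_nonpos[of "-1"] group.int_pow_one[OF grp_HF[of "-1"]] by simp
    ultimately show ?case by blast
  next
    case (step n)
    have k1: "?killed (n + 1)" using step.IH killed_next by blast
    have kf: "mult_quotient (HF n) N \<times>\<times> mult_quotient (HK n) N \<cong> HF n \<times>\<times> mult_quotient (HK n) N"
      by (rule DirProd_iso_cong[OF killed_iso]) (use step.IH in auto)
    have "HF (n + 1) \<cong> HF n \<times>\<times> mult_quotient (HK n) N"
      by (rule iso_trans[OF conjunct1[OF step.IH] iso_trans[OF split kf]])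
    then have prev: "HF n \<times>\<times> mult_quotient (HK n) N \<cong> HF (n + 1)"
      by (rule comm_group_iso_sym[OF cg_HF])
    have "HF (n + 1 + 1) \<cong> HF n \<times>\<times> (mult_quotient (HK (n + 1)) N \<times>\<times> mult_torsion (HK n) N)"
      using HF_recursion_iso[of "n + 1"] by simp
    also have "\<dots> \<cong> HF n \<times>\<times> (mult_quotient (HK (n + 1)) N \<times>\<times> mult_quotient (HK n) N)"
      by (intro DirProd_iso_cong iso_refl tq)
    also have "\<dots> \<cong> (HF n \<times>\<times> mult_quotient (HK n) N) \<times>\<times> mult_quotient (HK (n + 1)) N"
      by (rule DirProd_swap_iso)
    also have "\<dots> \<cong> HF (n + 1) \<times>\<times> mult_quotient (HK (n + 1)) N"
      by (intro DirProd_iso_cong iso_refl prev)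
    also have "\<dots> \<cong> mult_quotient (HF (n + 1)) N \<times>\<times> mult_quotient (HK (n + 1)) N"
      by (intro DirProd_iso_cong iso_refl comm_group_iso_sym[OF cg_mqHF killed_iso[OF k1]])
    also have "\<dots> \<cong> mult_quotient (HC (n + 1)) N"
      by (rule comm_group_iso_sym[OF cg_mqHC split])
    finally show ?case using k1 by blast
  qed
  then show ?thesis using n by simp
qed

theorem HF_iso_of_torsion_free:
  assumes "\<And>n x. n \<ge> 0 \<Longrightarrow> x \<in> carrier (HK n) \<Longrightarrow> x [^]\<^bsub>HK n\<^esub> N = \<one>\<^bsub>HK n\<^esub> \<Longrightarrow> x = \<one>\<^bsub>HK n\<^esub>"
  shows "HF (n + 1) \<cong> HF (n - 1) \<times>\<times> mult_quotient (HK n) N"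
proof -
  let ?H = "HK (n - 1)"
  have "x = \<one>\<^bsub>?H\<^esub>" if "x \<in> carrier ?H" "x [^]\<^bsub>?H\<^esub> N = \<one>\<^bsub>?H\<^esub>" for x
  proof (cases "n - 1 \<ge> 0")
    case True
    then show ?thesis using assms that by blast
  next
    case False
    then show ?thesis using that(1) HK_neg[of "n - 1"] by simp
  qed
  moreover have "\<one>\<^bsub>?H\<^esub> \<in> carrier ?H" "\<one>\<^bsub>?H\<^esub> [^]\<^bsub>?H\<^esub> N = \<one>\<^bsub>?H\<^esub>"
    by (rule monoid.one_closed[OF group.is_monoid[OF grp_HK]], rule group.int_pow_one[OF grp_HK])
  ultimately have "carrier (mult_torsion ?H N) = {\<one>\<^bsub>mult_torsion ?H N\<^esub>}"
    unfolding mult_torsion_def by auto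
  then have "mult_quotient (HK n) N \<times>\<times> mult_torsion (HK (n - 1)) N \<cong> mult_quotient (HK n) N"
    by (rule DirProd_trivial_iso)
  then show ?thesis
    by (rule iso_trans[OF HF_recursion_iso DirProd_iso_cong[OF iso_refl]])
qed

theorem HF_iso_of_zero:
  assumes "N = 0"
  shows "HF (n + 1) \<cong> mult_quotient (HC n) N"
proof -
  have "mult_quotient (HC n) N \<cong> HC n"
    by (rule mult_quotient_of_exponent_dividing[OF cg_HC]) (simp add: assms)
  then show ?thesis
    by (rule iso_trans[OF HF_shift_iso[OF assms] comm_group_iso_sym[OF cg_mqHC]])
qed

end

section \<open>Models of complexes of quotient groups\<close>

lemma iso_restrict_vimage:
  assumes G: "comm_group G" and p: "p \<in> iso G (frag_group E)" and E: "frag_subgroup E"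
    and F: "frag_subgroup F" "F \<subseteq> E"
  shows "comm_group (G\<lparr>carrier := {x \<in> carrier G. p x \<in> F}\<rparr>)"
    "p \<in> iso (G\<lparr>carrier := {x \<in> carrier G. p x \<in> F}\<rparr>) (frag_group F)"
proof -
  interpret G: comm_group G by fact
  interpret E: comm_group "frag_group E" by (rule comm_group_frag_group[OF E])
  have ph: "p \<in> hom G (frag_group E)" and im: "p ` carrier G = E" and inj: "inj_on p (carrier G)"
    using p by (auto simp: iso_iff)
  interpret p: group_hom G "frag_group E" p using ph by (simp add: group_hom_def group_hom_axioms_def)
  have "subgroup {x \<in> carrier G. p x \<in> F} G"
  proof (rule G.subgroupI)
    show "{x \<in> carrier G. p x \<in> F} \<noteq> {}"
      using p.hom_one frag_subgroupD(1)[OF F(1)] by (metis (mono_tags, lifting) G.one_closed empty_iff frag_group_simps(2) mem_Collect_eq)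
    fix x assume x: "x \<in> {x \<in> carrier G. p x \<in> F}"
    have px: "p x \<in> E" using x F(2) by auto
    have "p (inv\<^bsub>G\<^esub> x) + p x = 0"
      using p.hom_mult[of "inv\<^bsub>G\<^esub> x" x] x p.hom_one by simp
    then have "p (inv\<^bsub>G\<^esub> x) = - p x" by (simp add: eq_neg_iff_add_eq_0)
    then show "inv\<^bsub>G\<^esub> x \<in> {x \<in> carrier G. p x \<in> F}"
      using x frag_subgroupD(3)[OF F(1)] by simp
    fix y assume "y \<in> {x \<in> carrier G. p x \<in> F}"
    then show "x \<otimes>\<^bsub>G\<^esub> y \<in> {x \<in> carrier G. p x \<in> F}"
      using x p.hom_mult[of x y] frag_subgroupD(4)[OF F(1)] by simp
  qed auto
  then show "comm_group (G\<lparr>carrier := {x \<in> carrier G. p x \<in> F}\<rparr>)" by (rule comm_group_subgroup[OF G])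
  show "p \<in> iso (G\<lparr>carrier := {x \<in> carrier G. p x \<in> F}\<rparr>) (frag_group F)"
    unfolding iso_iff
  proof (intro conjI)
    show "p \<in> hom (G\<lparr>carrier := {x \<in> carrier G. p x \<in> F}\<rparr>) (frag_group F)"
      using ph by (auto simp: hom_def)
    show "p ` carrier (G\<lparr>carrier := {x \<in> carrier G. p x \<in> F}\<rparr>) = carrier (frag_group F)"
      using im F(2) by auto
    show "inj_on p (carrier (G\<lparr>carrier := {x \<in> carrier G. p x \<in> F}\<rparr>))"
      using inj by (auto simp: inj_on_def)
  qed
qed

text \<open>
  An isomorphism of complexes from \<open>Q\<close>, whose chain groups may consist of cosets, to a complex of
  subgroups of a free abelian group.
\<close>

locale frag_model = frag_complex E D
  for E :: "int \<Rightarrow> ('b \<Rightarrow>\<^sub>0 int) set" and D :: "int \<Rightarrow> ('b \<Rightarrow>\<^sub>0 int) \<Rightarrow> ('b \<Rightarrow>\<^sub>0 int)" +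
  fixes Q :: "'q chain_cpx" and p :: "int \<Rightarrow> 'q \<Rightarrow> ('b \<Rightarrow>\<^sub>0 int)"
  assumes Q_group: "comm_group (grp Q n)"
    and p_iso: "p n \<in> iso (grp Q n) (frag_group (E n))"
    and Q_bd_closed: "x \<in> carrier (grp Q n) \<Longrightarrow> bd Q n x \<in> carrier (grp Q (n - 1))"
    and p_bd: "x \<in> carrier (grp Q n) \<Longrightarrow> p (n - 1) (bd Q n x) = D n (p n x)"
begin

lemma p_hom: "p n \<in> hom (grp Q n) (frag_group (E n))"
  and p_image: "p n ` carrier (grp Q n) = E n"
  and p_inj: "inj_on (p n) (carrier (grp Q n))"
  using p_iso[of n] by (auto simp: iso_iff)

lemma p_one: "p n \<one>\<^bsub>grp Q n\<^esub> = 0"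
  using hom_one[OF p_hom[of n]] Q_group[of n] comm_group_frag_group[OF C_subgroup]
  by (simp add: comm_group_def)

lemma p_closed: "x \<in> carrier (grp Q n) \<Longrightarrow> p n x \<in> E n"
  using p_image by blast

text \<open>
  The isomorphism restricts to one of the cycles, and \<open>bd Q\<close> is determined by \<open>D\<close> because \<open>p\<close> is
  injective; so the boundaries of \<open>Q\<close> are the kernel of the map to the homology of the model.
\<close>

lemma homology_iso: "homology Q n \<cong> frag_homology E D n"
  and homology_comm_group: "comm_group (homology Q n)"
proof -
  let ?G = "grp Q n"
  let ?K = "kernel ?G (grp Q (n - 1)) (bd Q n)"
  have "bd Q n x = \<one>\<^bsub>grp Q (n - 1)\<^esub> \<longleftrightarrow> D n (p n x) = 0" if x: "x \<in> carrier ?G" for x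
  proof -
    have "\<one>\<^bsub>grp Q (n - 1)\<^esub> \<in> carrier (grp Q (n - 1))"
      using Q_group[of "n - 1"] comm_group.axioms(2) group.is_monoid monoid.one_closed by blast
    then have "bd Q n x = \<one>\<^bsub>grp Q (n - 1)\<^esub> \<longleftrightarrow> p (n - 1) (bd Q n x) = p (n - 1) \<one>\<^bsub>grp Q (n - 1)\<^esub>"
      using inj_on_eq_iff[OF p_inj Q_bd_closed[OF x]] by simp
    then show ?thesis by (simp add: p_bd[OF x] p_one)
  qed
  then have K: "?K = {x \<in> carrier ?G. p n x \<in> Z n}"
    using p_closed by (auto simp: kernel_def)
  have KG: "comm_group (?G\<lparr>carrier := ?K\<rparr>)" and pK: "p n \<in> iso (?G\<lparr>carrier := ?K\<rparr>) (frag_group (Z n))"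
    unfolding K using iso_restrict_vimage[OF Q_group p_iso C_subgroup cycles] by auto
  then have hK: "p n \<in> hom (?G\<lparr>carrier := ?K\<rparr>) (frag_group (Z n))" and iK: "p n ` ?K = Z n"
    by (auto simp: iso_iff)
  let ?B = "bd Q (n + 1) ` carrier (grp Q (n + 1))"
  have bdn: "bd Q (n + 1) y \<in> carrier ?G" "p n (bd Q (n + 1) y) = D (n + 1) (p (n + 1) y)"
    if "y \<in> carrier (grp Q (n + 1))" for y
    using Q_bd_closed[OF that] p_bd[OF that] by simp_all
  have BK: "?B \<subseteq> ?K"
  proof
    fix x assume "x \<in> ?B"
    then obtain y where y: "y \<in> carrier (grp Q (n + 1))" "x = bd Q (n + 1) y" by auto
    then have "p n x \<in> B n" using bdn(2) p_closed by simp
    then show "x \<in> ?K" unfolding K using boundaries_cycles[of n] bdn(1) y by blast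
  qed
  have mem: "p n x \<in> B n \<longleftrightarrow> x \<in> ?B" if "x \<in> ?K" for x
  proof
    assume "p n x \<in> B n"
    then obtain y where y: "y \<in> carrier (grp Q (n + 1))" "p n x = D (n + 1) (p (n + 1) y)"
      unfolding p_image[symmetric] by auto
    then have "p n x = p n (bd Q (n + 1) y)" using bdn by simp
    then have "x = bd Q (n + 1) y" using p_inj that bdn(1)[OF y(1)] unfolding K by (auto dest: inj_onD)
    then show "x \<in> ?B" using y by blast
  next
    assume "x \<in> ?B"
    then show "p n x \<in> B n" using bdn p_closed by auto
  qed
  have grp: "group (?G\<lparr>carrier := ?K\<rparr>)" "group (frag_homology E D n)"
    using KG comm_group_homology comm_group_def by blast+
  have h: "cls n \<circ> p n \<in> hom (?G\<lparr>carrier := ?K\<rparr>) (frag_homology E D n)"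
    by (rule hom_compose[OF hK cls_hom])
  have im: "(cls n \<circ> p n) ` carrier (?G\<lparr>carrier := ?K\<rparr>) = carrier (frag_homology E D n)"
    unfolding carrier_homology iK[symmetric] by (simp add: image_comp)
  have ker: "(cls n \<circ> p n) x = \<one>\<^bsub>frag_homology E D n\<^esub> \<longleftrightarrow> x \<in> ?B"
    if "x \<in> carrier (?G\<lparr>carrier := ?K\<rparr>)" for x
    using that cls_eq_one[of "p n x" n] mem[of x] iK by auto
  note iso = Mod_iso_of_surjective_hom[OF grp h im ker]
  have sub: "?B \<subseteq> carrier (?G\<lparr>carrier := ?K\<rparr>)" using BK by simp
  show "homology Q n \<cong> frag_homology E D n"
    unfolding homology_def using iso(2)[OF _ sub] by blast
  show "comm_group (homology Q n)"
    unfolding homology_def using comm_group.abelian_FactGroup[OF KG iso(3)[OF _ sub]] by blast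
qed

end

text \<open>
  If \<open>g\<close> maps the coset of \<open>x\<close> into the coset of \<open>g x\<close>, then the map induced on cosets has the expected
  value, although it is defined as a product of sets.
\<close>

lemma coset_map_coset:
  assumes "comm_group H" "subgroup N H" "group G" "subgroup M G" "x \<in> carrier G" "g x \<in> carrier H"
    and "\<And>y. y \<in> M #>\<^bsub>G\<^esub> x \<Longrightarrow> g y \<in> N #>\<^bsub>H\<^esub> g x"
  shows "coset_map H N g (M #>\<^bsub>G\<^esub> x) = N #>\<^bsub>H\<^esub> g x"
proof -
  interpret H: comm_group H by fact
  have x: "x \<in> M #>\<^bsub>G\<^esub> x" using group.rcos_self[OF assms(3,5,4)] .
  have Nc: "h \<in> N \<Longrightarrow> h \<in> carrier H" for h using subgroup.mem_carrier[OF assms(2)] .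
  show ?thesis
  proof
    show "coset_map H N g (M #>\<^bsub>G\<^esub> x) \<subseteq> N #>\<^bsub>H\<^esub> g x"
    proof
      fix z assume "z \<in> coset_map H N g (M #>\<^bsub>G\<^esub> x)"
      then obtain h y where z: "h \<in> N" "y \<in> M #>\<^bsub>G\<^esub> x" "z = h \<otimes>\<^bsub>H\<^esub> g y"
        by (auto simp: coset_map_def set_mult_def)
      then obtain h' where h': "h' \<in> N" "g y = h' \<otimes>\<^bsub>H\<^esub> g x" using assms(7) by (auto simp: r_coset_def)
      have "z = (h \<otimes>\<^bsub>H\<^esub> h') \<otimes>\<^bsub>H\<^esub> g x" using z h' Nc assms(6) by (simp add: H.m_assoc)
      then show "z \<in> N #>\<^bsub>H\<^esub> g x" using subgroup.m_closed[OF assms(2) z(1) h'(1)] by (auto simp: r_coset_def)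
    qed
    show "N #>\<^bsub>H\<^esub> g x \<subseteq> coset_map H N g (M #>\<^bsub>G\<^esub> x)"
    proof
      fix z assume "z \<in> N #>\<^bsub>H\<^esub> g x"
      then obtain h where "h \<in> N" "z = h \<otimes>\<^bsub>H\<^esub> g x" by (auto simp: r_coset_def)
      then show "z \<in> coset_map H N g (M #>\<^bsub>G\<^esub> x)"
        using x unfolding coset_map_def set_mult_def by blast
    qed
  qed
qed

text \<open>
  A surjective chain map \<open>f\<close> with kernel \<open>S\<close> turns its target into a model of the quotient by \<open>S\<close>.
\<close>

lemma quot_cpx_model:
  assumes ED: "frag_complex E D"
    and A: "\<And>n. comm_group (grp A n)"
    and f: "\<And>n. f n \<in> hom (grp A n) (frag_group (E n))"
    and im: "\<And>n. f n ` carrier (grp A n) = E n"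
    and S: "\<And>n. S n = {x \<in> carrier (grp A n). f n x = 0}"
    and closed: "\<And>n x. x \<in> carrier (grp A n) \<Longrightarrow> bd A n x \<in> carrier (grp A (n - 1))"
    and comm: "\<And>n x. x \<in> carrier (grp A n) \<Longrightarrow> f (n - 1) (bd A n x) = D n (f n x)"
  shows "frag_model E D (quot_cpx A S) (\<lambda>n X. the_elem (f n ` X))"
    and "\<And>n. subgroup (S n) (grp A n)"
    and "\<And>n x. x \<in> carrier (grp A n) \<Longrightarrow> the_elem (f n ` (S n #>\<^bsub>grp A n\<^esub> x)) = f n x"
    and "\<And>n x. x \<in> carrier (grp A n) \<Longrightarrow>
      bd (quot_cpx A S) n (S n #>\<^bsub>grp A n\<^esub> x) = S (n - 1) #>\<^bsub>grp A (n - 1)\<^esub> bd A n x"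
proof -
  interpret frag_complex E D by fact
  have gA: "group (grp A n)" for n using A comm_group_def by blast
  have gE: "group (frag_group (E n))" for n
    using comm_group_frag_group[OF C_subgroup] comm_group_def by blast
  have ker: "f n x = \<one>\<^bsub>frag_group (E n)\<^esub> \<longleftrightarrow> x \<in> S n" if "x \<in> carrier (grp A n)" for n x
    using that S by simp
  have SA: "S n \<subseteq> carrier (grp A n)" for n using S by auto
  have im': "f n ` carrier (grp A n) = carrier (frag_group (E n))" for n using im by simp
  have iso: "(\<lambda>X. the_elem (f n ` X)) \<in> iso (grp A n Mod S n) (frag_group (E n))" "subgroup (S n) (grp A n)"
    "\<And>x. x \<in> carrier (grp A n) \<Longrightarrow> the_elem (f n ` (S n #>\<^bsub>grp A n\<^esub> x)) = f n x"
    "\<And>x y. x \<in> carrier (grp A n) \<Longrightarrow> y \<in> S n #>\<^bsub>grp A n\<^esub> x \<Longrightarrow> f n y = f n x" for n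
    using Mod_iso_of_surjective_hom[OF gA[of n] gE[of n] f[of n] im'[of n] ker[of _ n] SA[of n]]
    by blast+
  show sub: "subgroup (S n) (grp A n)" for n using iso(2) .
  show el: "the_elem (f n ` (S n #>\<^bsub>grp A n\<^esub> x)) = f n x" if "x \<in> carrier (grp A n)" for n x
    using iso(3) that by blast
  have grpQ: "grp (quot_cpx A S) n = grp A n Mod S n" for n by (simp add: quot_cpx_def)
  show bdQ: "bd (quot_cpx A S) n (S n #>\<^bsub>grp A n\<^esub> x) = S (n - 1) #>\<^bsub>grp A (n - 1)\<^esub> bd A n x"
    if x: "x \<in> carrier (grp A n)" for n x
  proof -
    have "bd (quot_cpx A S) n = coset_map (grp A (n - 1)) (S (n - 1)) (bd A n)" by (simp add: quot_cpx_def)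
    moreover have "coset_map (grp A (n - 1)) (S (n - 1)) (bd A n) (S n #>\<^bsub>grp A n\<^esub> x) =
      S (n - 1) #>\<^bsub>grp A (n - 1)\<^esub> bd A n x"
    proof (rule coset_map_coset[where g = "bd A n" and x = x, OF A sub gA sub x closed[OF x]])
      fix y assume y: "y \<in> S n #>\<^bsub>grp A n\<^esub> x"
      interpret An: comm_group "grp A (n - 1)" by (rule A)
      have yc: "y \<in> carrier (grp A n)"
        using y monoid.r_coset_subset_G[OF group.is_monoid[OF gA] SA x] by blast
      let ?b = "bd A n y \<otimes>\<^bsub>grp A (n - 1)\<^esub> inv\<^bsub>grp A (n - 1)\<^esub> bd A n x"
      have b: "?b \<in> carrier (grp A (n - 1))" using closed[OF yc] closed[OF x] by simp
      have eq: "bd A n y = ?b \<otimes>\<^bsub>grp A (n - 1)\<^esub> bd A n x"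
        using closed[OF yc] closed[OF x] by (simp add: An.m_assoc)
      have "f n y = f n x" using iso(4)[OF x y] .
      then have "f (n - 1) (bd A n y) = f (n - 1) (bd A n x)" using comm[OF x] comm[OF yc] by simp
      moreover have "f (n - 1) (bd A n y) = f (n - 1) ?b + f (n - 1) (bd A n x)"
        using hom_mult[OF f b closed[OF x]] eq by simp
      ultimately have "f (n - 1) ?b = 0" by simp
      then have "?b \<in> S (n - 1)" using b S by blast
      then show "bd A n y \<in> S (n - 1) #>\<^bsub>grp A (n - 1)\<^esub> bd A n x"
        unfolding r_coset_def using eq by blast
    qed
    ultimately show ?thesis by simp
  qed
  show "frag_model E D (quot_cpx A S) (\<lambda>n X. the_elem (f n ` X))"
  proof (intro frag_model.intro frag_model_axioms.intro ED)
    fix n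
    show "comm_group (grp (quot_cpx A S) n)" unfolding grpQ by (rule comm_group.abelian_FactGroup[OF A sub])
    show "(\<lambda>X. the_elem (f n ` X)) \<in> iso (grp (quot_cpx A S) n) (frag_group (E n))"
      unfolding grpQ by (rule iso(1))
    fix X assume "X \<in> carrier (grp (quot_cpx A S) n)"
    then obtain x where x: "x \<in> carrier (grp A n)" "X = S n #>\<^bsub>grp A n\<^esub> x"
      by (auto simp: grpQ carrier_FactGroup)
    show "bd (quot_cpx A S) n X \<in> carrier (grp (quot_cpx A S) (n - 1))"
      using closed[OF x(1)] by (auto simp: x(2) bdQ[OF x(1)] grpQ carrier_FactGroup)
    show "the_elem (f (n - 1) ` bd (quot_cpx A S) n X) = D n (the_elem (f n ` X))"
      by (simp add: x(2) bdQ[OF x(1)] el[OF x(1)] el[OF closed[OF x(1)]] comm[OF x(1)])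
  qed
qed

section \<open>Faces of tuples\<close>

text \<open>
  Positive degrees are written as \<open>int (Suc m)\<close>, and sums over faces are split at their first term
  when needed; automatic unfolding would destroy this form.
\<close>

declare of_nat_Suc [simp del] sum.atLeast0_atMost_Suc [simp del] sum.cl_ivl_Suc [simp del]

lemma additive_eq_on_frags:
  assumes "additive f" "additive g" "Poly_Mapping.keys c \<subseteq> T" "\<And>x. x \<in> T \<Longrightarrow> f (frag_of x) = g (frag_of x)"
  shows "f c = g c"
  using assms(3)
  by (induction c rule: frag_induction)
    (use assms(4) in \<open>auto simp: additive.zero[OF assms(1)] additive.zero[OF assms(2)]
      additive.diff[OF assms(1)] additive.diff[OF assms(2)]\<close>)

lemma additive_closed_on_frags:
  assumes "additive f" "frag_subgroup Y" "Poly_Mapping.keys c \<subseteq> T" "\<And>x. x \<in> T \<Longrightarrow> f (frag_of x) \<in> Y"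
  shows "f c \<in> Y"
  using assms(3)
  by (induction c rule: frag_induction)
    (use assms(4) frag_subgroupD[OF assms(2)] in \<open>auto simp: additive.zero[OF assms(1)] additive.diff[OF assms(1)]\<close>)

lemma frag_cmul_sum_left: "(\<Sum>i\<in>I. frag_cmul (h i) c) = frag_cmul (\<Sum>i\<in>I. h i) c"
  by (induction I rule: infinite_finite_induct) (simp_all add: frag_cmul_distrib)

lemma additive_frag_extend: "additive (frag_extend f)"
  by (simp add: additive_def frag_extend_add)

lemma additive_compose: "additive f \<Longrightarrow> additive g \<Longrightarrow> additive (\<lambda>x. f (g x))"
  by (simp add: additive_def)

lemma additive_one_term_bd: "additive (one_term_bd op n)"
  by (simp add: additive_def one_term_bd_def frag_extend_add)

lemma additive_multi_bd: "additive (bd (multi_cpx X k star a) n)"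
  by (simp add: additive_def multi_cpx_def additive.add[OF additive_one_term_bd]
      frag_cmul_distrib2 sum.distrib)

lemma frag_subgroup_keys: "frag_subgroup {c. Poly_Mapping.keys c \<subseteq> T}"
  unfolding frag_subgroup_def using keys_diff by fastforce

lemma length_face: "i < length xs \<Longrightarrow> length (face op i xs) = length xs - 1"
  by (simp add: face_def)

lemma face_0: "face op 0 xs = tl xs"
  by (simp add: face_def drop_Suc)

lemma face_Suc_Cons: "face op (Suc i) (x # xs) = op x (xs ! i) # face op i xs"
  by (simp add: face_def)

lemma nth_face_less: "l < i \<Longrightarrow> i < length xs \<Longrightarrow> face op i xs ! l = op (xs ! l) (xs ! i)"
  by (simp add: face_def nth_append)

lemma nth_face_ge: "i \<le> l \<Longrightarrow> Suc l < length xs \<Longrightarrow> face op i xs ! l = xs ! Suc l"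
  by (simp add: face_def nth_append)

lemma set_face:
  assumes "\<And>x y. x \<in> X \<Longrightarrow> y \<in> X \<Longrightarrow> op x y \<in> X" "set xs \<subseteq> X" "i < length xs"
  shows "set (face op i xs) \<subseteq> X"
  using assms set_take_subset[of i xs] set_drop_subset[of "Suc i" xs]
  by (auto simp: face_def subset_iff)

text \<open>
  The presimplicial identity for two operations. The entries before position \<open>i\<close> are acted on by both
  operations, and for them the identity is distributivity; all other entries agree literally.
\<close>

lemma face_face:
  assumes dist: "\<And>x y z. x \<in> X \<Longrightarrow> y \<in> X \<Longrightarrow> z \<in> X \<Longrightarrow> op2 (op1 x y) z = op1 (op2 x z) (op2 y z)"
    and xs: "set xs \<subseteq> X" "i < j" "j < length xs"
  shows "face op1 i (face op2 j xs) = face op2 (j - 1) (face op1 i xs)"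
proof (rule nth_equalityI)
  show "length (face op1 i (face op2 j xs)) = length (face op2 (j - 1) (face op1 i xs))"
    using xs by (simp add: length_face)
  fix l assume "l < length (face op1 i (face op2 j xs))"
  then have l: "Suc (Suc l) < length xs" using xs by (simp add: length_face)
  have X: "xs ! m \<in> X" if "m < length xs" for m using xs(1) that nth_mem by blast
  have lf: "length (face op2 j xs) = length xs - 1" "length (face op1 i xs) = length xs - 1"
    using xs by (simp_all add: length_face)
  consider "l < i" | "i \<le> l" "l < j - 1" | "j - 1 \<le> l" by linarith
  then show "face op1 i (face op2 j xs) ! l = face op2 (j - 1) (face op1 i xs) ! l"
  proof cases
    case 1
    then have "face op1 i (face op2 j xs) ! l = op1 (op2 (xs ! l) (xs ! j)) (op2 (xs ! i) (xs ! j))"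
      using xs lf by (simp add: nth_face_less)
    moreover have "face op2 (j - 1) (face op1 i xs) ! l = op2 (op1 (xs ! l) (xs ! i)) (xs ! j)"
      using 1 xs lf by (simp add: nth_face_less nth_face_ge)
    ultimately show ?thesis using dist X 1 xs by simp
  next
    case 2
    then show ?thesis using xs lf l by (simp add: nth_face_less nth_face_ge)
  next
    case 3
    then show ?thesis using xs lf l by (simp add: nth_face_ge)
  qed
qed

lemma one_term_bd_of:
  "one_term_bd op (int (Suc m)) (frag_of xs) = (\<Sum>i=0..Suc m. frag_cmul ((-1) ^ i) (frag_of (face op i xs)))"
  by (simp add: one_term_bd_def)

lemma multi_bd_nonpos: "n \<le> 0 \<Longrightarrow> bd (multi_cpx X k star a) n c = 0"
  by (simp add: multi_cpx_def one_term_bd_def)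

lemma multi_bd_of:
  "bd (multi_cpx X k star a) (int (Suc m)) (frag_of xs) =
    (\<Sum>r=1..k. \<Sum>i=0..Suc m. frag_cmul (a r * (-1) ^ i) (frag_of (face (star r) i xs)))"
  unfolding multi_cpx_def chain_cpx.simps one_term_bd_of by (simp add: frag_cmul_sum)

lemma tuples_int_iff: "xs \<in> tuples X (int m) \<longleftrightarrow> length xs = Suc m \<and> set xs \<subseteq> X"
  by (auto simp: tuples_def)

lemma tuples_neg: "n < 0 \<Longrightarrow> tuples X n = {}"
  by (auto simp: tuples_def)

lemma finite_tuples: "finite X \<Longrightarrow> finite (tuples X n)"
  by (rule finite_subset[OF _ finite_lists_length_eq[of X "nat (n + 1)"]]) (auto simp: tuples_def)

section \<open>The reduced multi-term complex\<close>

locale pointed_multispindle =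
  fixes X :: "'a set" and k :: nat and star :: "nat \<Rightarrow> 'a \<Rightarrow> 'a \<Rightarrow> 'a" and a :: "nat \<Rightarrow> int" and t :: 'a
  assumes spindle: "multispindle X k star" and X_finite: "finite X" and t: "t \<in> X"
begin

lemma star_closed: "r \<in> {1..k} \<Longrightarrow> x \<in> X \<Longrightarrow> y \<in> X \<Longrightarrow> star r x y \<in> X"
  and star_dist: "r \<in> {1..k} \<Longrightarrow> q \<in> {1..k} \<Longrightarrow> x \<in> X \<Longrightarrow> y \<in> X \<Longrightarrow> z \<in> X \<Longrightarrow>
    star q (star r x y) z = star r (star q x z) (star q y z)"
  and star_idem: "r \<in> {1..k} \<Longrightarrow> x \<in> X \<Longrightarrow> star r x x = x"
  using spindle unfolding multispindle_def by blast+

abbreviation "scalar_sum \<equiv> \<Sum>i=1..k. a i"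
abbreviation "M \<equiv> multi_cpx X k star a"
abbreviation "tuple_chains n \<equiv> {c. Poly_Mapping.keys c \<subseteq> tuples X n}"

text \<open>
  Chains without tuples \<open>(t, \<dots>, t)\<close> represent the classes of the reduced complex. As \<open>set [] \<subseteq> {t}\<close>,
  the map \<open>reduce\<close> also deletes the empty list, which is the tail of a tuple in degree \<open>0\<close>. Hence
  \<open>reduced_tail\<close> vanishes in degree \<open>0\<close>, as required of a map into a trivial group.
\<close>

definition reduce :: "('a list \<Rightarrow>\<^sub>0 int) \<Rightarrow> ('a list \<Rightarrow>\<^sub>0 int)" where
  "reduce = frag_extend (\<lambda>xs. if set xs \<subseteq> {t} then 0 else frag_of xs)"

definition tail :: "('a list \<Rightarrow>\<^sub>0 int) \<Rightarrow> ('a list \<Rightarrow>\<^sub>0 int)" where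
  "tail = frag_extend (\<lambda>xs. frag_of (tl xs))"

definition reduced_chains :: "int \<Rightarrow> ('a list \<Rightarrow>\<^sub>0 int) set" where
  "reduced_chains n = {c. Poly_Mapping.keys c \<subseteq> {xs \<in> tuples X n. \<not> set xs \<subseteq> {t}}}"

definition reduced_bd :: "int \<Rightarrow> ('a list \<Rightarrow>\<^sub>0 int) \<Rightarrow> ('a list \<Rightarrow>\<^sub>0 int)" where
  "reduced_bd n c = reduce (bd M n c)"

definition reduced_tail :: "('a list \<Rightarrow>\<^sub>0 int) \<Rightarrow> ('a list \<Rightarrow>\<^sub>0 int)" where
  "reduced_tail c = reduce (tail c)"

lemma reduce_additive: "additive reduce" and tail_additive: "additive tail" and s0_additive: "additive s0"
  by (simp_all add: reduce_def tail_def s0_def additive_frag_extend)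

lemma reduce_of: "reduce (frag_of xs) = (if set xs \<subseteq> {t} then 0 else frag_of xs)"
  and tail_of: "tail (frag_of xs) = frag_of (tl xs)"
  and s0_of: "s0 (frag_of xs) = frag_of (hd xs # xs)"
  by (simp_all add: reduce_def tail_def s0_def)

lemmas bd_additive = additive_multi_bd[of X k star a]
lemmas lin_simps = additive.zero[OF reduce_additive] additive.zero[OF tail_additive] additive.zero[OF s0_additive]
  additive.add[OF reduce_additive] additive.add[OF tail_additive] additive.add[OF s0_additive]
  additive.diff[OF reduce_additive] additive.diff[OF tail_additive] additive.diff[OF s0_additive]
  additive_cmul[OF reduce_additive] additive_cmul[OF tail_additive] additive_cmul[OF s0_additive]
  additive.sum[OF reduce_additive] additive.sum[OF tail_additive] additive.sum[OF s0_additive]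
lemmas bd_simps = additive.zero[OF bd_additive] additive.add[OF bd_additive] additive.diff[OF bd_additive]
  additive_cmul[OF bd_additive] additive.sum[OF bd_additive]

lemma lookup_reduce: "Poly_Mapping.lookup (reduce c) xs = (if set xs \<subseteq> {t} then 0 else Poly_Mapping.lookup c xs)"
proof -
  have "Poly_Mapping.keys c \<subseteq> UNIV" by simp
  then show ?thesis
    by (induction c rule: frag_induction) (auto simp: lin_simps reduce_of lookup_minus)
qed

lemma reduce_chains: "c \<in> tuple_chains n \<Longrightarrow> reduce c \<in> reduced_chains n"
  by (auto simp: reduced_chains_def in_keys_iff lookup_reduce split: if_splits)

lemma reduced_chains_sub: "c \<in> reduced_chains n \<Longrightarrow> c \<in> tuple_chains n"
  by (auto simp: reduced_chains_def)

lemma reduce_id: "c \<in> reduced_chains n \<Longrightarrow> reduce c = c"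
  by (rule poly_mapping_eqI) (auto simp: lookup_reduce reduced_chains_def in_keys_iff)

lemma tuples_point: "tuples {t} n = {xs \<in> tuples X n. set xs \<subseteq> {t}}"
  using t by (auto simp: tuples_def)

lemma reduce_eq_0_iff: "c \<in> tuple_chains n \<Longrightarrow> reduce c = 0 \<longleftrightarrow> c \<in> point_chains t n"
  by (auto simp: point_chains_def tuples_point poly_mapping_eq_iff fun_eq_iff lookup_reduce in_keys_iff subset_iff)

lemma face_tuple:
  assumes "xs \<in> tuples X (int (Suc m))" "r \<in> {1..k}" "i \<le> Suc m"
  shows "face (star r) i xs \<in> tuples X (int m)"
  using assms set_face[of X "star r" xs i] star_closed[OF assms(2)]
  by (auto simp: tuples_int_iff length_face)

lemma tail_tuple: "xs \<in> tuples X (int (Suc m)) \<Longrightarrow> tl xs \<in> tuples X (int m)"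
  by (cases xs) (auto simp: tuples_int_iff)

lemma bd_chains:
  assumes "c \<in> tuple_chains n"
  shows "bd M n c \<in> tuple_chains (n - 1)"
proof (cases "n \<le> 0")
  case True
  then show ?thesis by (simp add: multi_bd_nonpos)
next
  case False
  then obtain m where n: "n = int (Suc m)" by (metis not_le_imp_less not_gr_zero of_nat_0_less_iff pos_int_cases gr0_implies_Suc)
  note ch = frag_subgroup_keys[of "tuples X (int m)"]
  have "bd M n c \<in> tuple_chains (int m)"
  proof (rule additive_closed_on_frags[OF bd_additive ch, of _ "tuples X n"])
    show "Poly_Mapping.keys c \<subseteq> tuples X n" using assms by simp
    fix xs assume xs: "xs \<in> tuples X n"
    have "Poly_Mapping.keys (frag_cmul (a r * (-1) ^ i) (frag_of (face (star r) i xs))) \<subseteq> tuples X (int m)"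
      if "r \<in> {1..k}" "i \<in> {0..Suc m}" for r i
      using face_tuple[of xs m r i] xs that n by auto
    then show "bd M n (frag_of xs) \<in> tuple_chains (int m)"
      unfolding n multi_bd_of mem_Collect_eq
      by (intro order.trans[OF keys_sum] UN_least order.trans[OF keys_sum]) blast
  qed
  then show ?thesis by (simp add: n of_nat_Suc)
qed

text \<open>
  By the presimplicial identity the composite of the faces \<open>j\<close> and then \<open>i < j\<close>, for the operations \<open>r\<close>
  and then \<open>q\<close>, is that of the faces \<open>i\<close> and then \<open>j - 1\<close>, for \<open>q\<close> and then \<open>r\<close>. These terms have the same
  coefficient up to sign, and exchanging them matches the terms with \<open>i < j\<close> with the others.
\<close>

lemma bd_bd:
  assumes "c \<in> tuple_chains (n + 1)"
  shows "bd M n (bd M (n + 1) c) = 0"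
proof (cases "n \<le> 0")
  case True
  then show ?thesis by (simp add: multi_bd_nonpos)
next
  case False
  then obtain l where n: "n = int (Suc l)" by (metis not_le_imp_less pos_int_cases gr0_implies_Suc)
  have n1: "n + 1 = int (Suc (Suc l))" by (simp add: n)
  have "bd M n (bd M (n + 1) (frag_of xs)) = 0" if xs: "xs \<in> tuples X (n + 1)" for xs
  proof -
    have len: "length xs = Suc (Suc (Suc l))" and sX: "set xs \<subseteq> X"
      using xs unfolding n1 tuples_int_iff by auto
    define T where "T = (\<lambda>(r, j, q, i). frag_cmul (a r * (-1) ^ j * (a q * (-1) ^ i))
      (frag_of (face (star q) i (face (star r) j xs))))"
    define I where "I = {1..k} \<times> {0..Suc (Suc l)} \<times> {1..k} \<times> {0..Suc l}"
    define I1 where "I1 = {(r, j, q, i) \<in> I. i < j}"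
    define I2 where "I2 = {(r, j, q, i) \<in> I. j \<le> i}"
    have fin: "finite I" by (simp add: I_def)
    have "bd M n (bd M (n + 1) (frag_of xs)) = sum T I"
      unfolding n1 multi_bd_of unfolding n
      by (simp only: bd_simps multi_bd_of)
        (simp add: I_def T_def sum.cartesian_product[symmetric] frag_cmul_sum)
    also have "I = I1 \<union> I2" by (auto simp: I1_def I2_def)
    also have "sum T (I1 \<union> I2) = sum T I1 + sum T I2"
      by (rule sum.union_disjoint) (auto simp: I1_def I2_def intro: finite_subset[OF _ fin])
    also have "sum T I1 = (\<Sum>z\<in>I2. - T z)"
    proof (rule sum.reindex_bij_witness[where i = "\<lambda>(q, i, r, j). (r, Suc j, q, i)"
          and j = "\<lambda>(r, j, q, i). (q, i, r, j - 1)"])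
      fix z assume z: "z \<in> I1"
      obtain r j q i where zz: "z = (r, j, q, i)" by (cases z) auto
      have I: "r \<in> {1..k}" "j \<le> Suc (Suc l)" "q \<in> {1..k}" "i < j"
        using z by (auto simp: zz I1_def I_def)
      show "(case case z of (r, j, q, i) \<Rightarrow> (q, i, r, j - 1) of (q, i, r, j) \<Rightarrow> (r, Suc j, q, i)) = z"
        using I by (simp add: zz)
      show "(case z of (r, j, q, i) \<Rightarrow> (q, i, r, j - 1)) \<in> I2"
        using z by (auto simp: zz I1_def I2_def I_def)
      have "face (star q) i (face (star r) j xs) = face (star r) (j - 1) (face (star q) i xs)"
        by (rule face_face[of X]) (use star_dist I sX len in auto)
      moreover have "(-1 :: int) ^ j = - ((-1) ^ (j - 1))" using I by (cases j) auto
      ultimately show "- T (case z of (r, j, q, i) \<Rightarrow> (q, i, r, j - 1)) = T z"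
        by (simp add: zz T_def mult_ac)
    next
      fix z assume "z \<in> I2"
      then show "(case case z of (q, i, r, j) \<Rightarrow> (r, Suc j, q, i) of (r, j, q, i) \<Rightarrow> (q, i, r, j - 1)) = z"
        "(case z of (q, i, r, j) \<Rightarrow> (r, Suc j, q, i)) \<in> I1"
        by (auto simp: I1_def I2_def I_def)
    qed
    finally show ?thesis by (simp add: sum_negf)
  qed
  then show ?thesis
    using additive_eq_on_frags[OF additive_compose[OF bd_additive bd_additive], of "\<lambda>_. 0" c "tuples X (n + 1)" n "n + 1"]
      assms by (auto simp: additive_def)
qed

text \<open>
  The faces of \<open>(t, \<dots>, t)\<close> are again of this form, because the operations are idempotent.
\<close>

lemma reduce_bd_reduce:
  assumes "c \<in> tuple_chains n"
  shows "reduce (bd M n (reduce c)) = reduce (bd M n c)"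
proof (rule additive_eq_on_frags[where c = c and T = "tuples X n"])
  show "Poly_Mapping.keys c \<subseteq> tuples X n" using assms by simp
  fix xs assume xs: "xs \<in> tuples X n"
  show "reduce (bd M n (reduce (frag_of xs))) = reduce (bd M n (frag_of xs))"
  proof (cases "set xs \<subseteq> {t} \<and> n > 0")
    case True
    then obtain m where n: "n = int (Suc m)" by (metis pos_int_cases gr0_implies_Suc)
    have "set (face (star r) i xs) \<subseteq> {t}" if "r \<in> {1..k}" "i \<in> {0..Suc m}" for r i
      by (rule set_face) (use True star_idem[OF that(1) t] xs n that in \<open>auto simp: tuples_int_iff\<close>)
    then have "reduce (bd M n (frag_of xs)) = 0"
      unfolding n multi_bd_of by (simp add: lin_simps reduce_of)
    then show ?thesis using True by (simp add: reduce_of bd_simps lin_simps)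
  next
    case False
    then show ?thesis by (auto simp: reduce_of bd_simps lin_simps multi_bd_nonpos)
  qed
qed (simp_all add: additive_def lin_simps bd_simps)

lemma reduce_tail_reduce: "reduce (tail (reduce c)) = reduce (tail c)"
proof (rule additive_eq_on_frags[where c = c and T = UNIV])
  fix xs :: "'a list"
  show "reduce (tail (reduce (frag_of xs))) = reduce (tail (frag_of xs))"
    by (cases xs) (auto simp: reduce_of tail_of lin_simps)
qed (simp_all add: additive_def lin_simps)

lemma reduce_s0: "c \<in> tuple_chains n \<Longrightarrow> reduce (s0 c) = s0 (reduce c)"
proof (rule additive_eq_on_frags[where c = c and T = "tuples X n"])
  fix xs assume "xs \<in> tuples X n"
  then have "xs \<noteq> []" by (auto simp: tuples_def)
  then show "reduce (s0 (frag_of xs)) = s0 (reduce (frag_of xs))"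
    by (cases xs) (auto simp: reduce_of s0_of lin_simps)
qed (simp_all add: additive_def lin_simps)

lemma s0_chains: "c \<in> tuple_chains n \<Longrightarrow> s0 c \<in> tuple_chains (n + 1)"
proof (rule additive_closed_on_frags[OF s0_additive frag_subgroup_keys, of _ "tuples X n"])
  fix xs assume "xs \<in> tuples X n"
  then show "s0 (frag_of xs) \<in> tuple_chains (n + 1)"
    by (cases xs) (auto simp: s0_of tuples_def)
qed auto

lemma tail_s0: "tail (s0 c) = c"
proof (rule additive_eq_on_frags[where c = c and T = UNIV])
  show "additive (\<lambda>c :: 'a list \<Rightarrow>\<^sub>0 int. c)" by (simp add: additive_def)
qed (simp_all add: additive_def lin_simps tail_of s0_of)

lemma tail_chains: "c \<in> tuple_chains (int (Suc m)) \<Longrightarrow> tail c \<in> tuple_chains (int m)"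
  by (rule additive_closed_on_frags[OF tail_additive frag_subgroup_keys, of _ "tuples X (int (Suc m))"])
    (auto simp: tail_of dest: tail_tuple)

lemma reduced_tail_0:
  assumes "c \<in> tuple_chains 0"
  shows "reduce (tail c) = 0"
proof (rule additive_eq_on_frags[where c = c and T = "tuples X 0" and g = "\<lambda>_. 0"])
  fix xs assume "xs \<in> tuples X 0"
  then obtain y where "xs = [y]" by (auto simp: tuples_def length_Suc_conv)
  then show "reduce (tail (frag_of xs)) = 0" by (simp add: tail_of reduce_of)
qed (use assms in \<open>simp_all add: additive_def lin_simps\<close>)

text \<open>
  In \<open>s0 xs\<close> the faces \<open>0\<close> and \<open>1\<close> both equal \<open>xs\<close>, by idempotency, and cancel. The face \<open>i + 1\<close> for
  \<open>i > 0\<close> is \<open>s0\<close> of the face \<open>i\<close> of \<open>xs\<close>, with the opposite sign. The face \<open>0\<close> of \<open>xs\<close> has no counterpart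
  and is responsible for the first term on the right.
\<close>

lemma bd_s0:
  assumes "c \<in> tuple_chains (int (Suc m))"
  shows "bd M (int (Suc (Suc m))) (s0 c) = frag_cmul scalar_sum (s0 (tail c)) - s0 (bd M (int (Suc m)) c)"
proof (rule additive_eq_on_frags[where c = c and T = "tuples X (int (Suc m))"])
  show "additive (\<lambda>c. frag_cmul scalar_sum (s0 (tail c)) - s0 (bd M (int (Suc m)) c))"
    by (simp add: additive_def lin_simps bd_simps frag_cmul_distrib2)
  fix xs assume xs: "xs \<in> tuples X (int (Suc m))"
  obtain x y ys where xs_eq: "xs = x # y # ys" 
    using xs by (auto simp: tuples_int_iff length_Suc_conv)
  have xX: "x \<in> X" using xs xs_eq by (auto simp: tuples_int_iff)
  let ?g = "\<lambda>r i. frag_cmul (a r * (-1) ^ i) (frag_of (star r x ((y # ys) ! i) # star r x ((y # ys) ! i) # face (star r) i (y # ys)))"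
  have "bd M (int (Suc (Suc m))) (s0 (frag_of xs)) = (\<Sum>r=1..k. \<Sum>i=0..m. ?g r i)"
    unfolding s0_of multi_bd_of
  proof (rule sum.cong[OF refl])
    fix r assume r: "r \<in> {1..k}"
    show "(\<Sum>i=0..Suc (Suc m). frag_cmul (a r * (-1) ^ i) (frag_of (face (star r) i (hd xs # xs)))) = (\<Sum>i=0..m. ?g r i)"
      by (simp add: sum.atLeast0_atMost_Suc_shift xs_eq face_0 face_Suc_Cons star_idem[OF r xX] o_def
          frag_cmul_distrib[symmetric] add.assoc[symmetric])
  qed
  moreover have "s0 (bd M (int (Suc m)) (frag_of xs)) = frag_cmul scalar_sum (frag_of (y # y # ys)) - (\<Sum>r=1..k. \<Sum>i=0..m. ?g r i)"
  proof -
    have "s0 (bd M (int (Suc m)) (frag_of xs)) =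
        (\<Sum>r=1..k. frag_cmul (a r) (frag_of (y # y # ys)) - (\<Sum>i=0..m. ?g r i))"
      unfolding multi_bd_of lin_simps s0_of
      by (rule sum.cong[OF refl])
        (simp add: sum.atLeast0_atMost_Suc_shift xs_eq face_0 face_Suc_Cons o_def sum_negf[symmetric]
          diff_conv_add_uminus del: add_uminus_conv_diff)
    then show ?thesis by (simp add: sum_subtractf frag_cmul_sum_left)
  qed
  moreover have "frag_cmul scalar_sum (s0 (tail (frag_of xs))) = frag_cmul scalar_sum (frag_of (y # y # ys))"
    by (simp add: tail_of s0_of xs_eq)
  ultimately show "bd M (int (Suc (Suc m))) (s0 (frag_of xs)) =
      frag_cmul scalar_sum (s0 (tail (frag_of xs))) - s0 (bd M (int (Suc m)) (frag_of xs))"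
    by simp
qed (use assms in \<open>simp_all add: additive_def lin_simps bd_simps\<close>)

text \<open>
  For \<open>i > 0\<close> the tail of the face \<open>i\<close> is the face \<open>i - 1\<close> of the tail; for \<open>i = 0\<close> it is the tail of the
  tail, which occurs once for each operation.
\<close>

lemma tail_bd:
  assumes "c \<in> tuple_chains (int (Suc (Suc m)))"
  shows "tail (bd M (int (Suc (Suc m))) c) = frag_cmul scalar_sum (tail (tail c)) - bd M (int (Suc m)) (tail c)"
proof (rule additive_eq_on_frags[where c = c and T = "tuples X (int (Suc (Suc m)))"])
  show "additive (\<lambda>c. frag_cmul scalar_sum (tail (tail c)) - bd M (int (Suc m)) (tail c))"
    by (simp add: additive_def lin_simps bd_simps frag_cmul_distrib2)
  fix xs assume xs: "xs \<in> tuples X (int (Suc (Suc m)))"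
  obtain x ys where xs_eq: "xs = x # ys" 
    using xs by (auto simp: tuples_int_iff length_Suc_conv)
  have "tail (bd M (int (Suc (Suc m))) (frag_of xs)) =
      (\<Sum>r=1..k. frag_cmul (a r) (frag_of (tl ys)) - (\<Sum>i=0..Suc m. frag_cmul (a r * (-1) ^ i) (frag_of (face (star r) i ys))))"
    unfolding multi_bd_of lin_simps tail_of
    by (rule sum.cong[OF refl], subst sum.atLeast0_atMost_Suc_shift)
      (simp add: xs_eq face_0 face_Suc_Cons o_def sum_negf[symmetric]
        diff_conv_add_uminus del: add_uminus_conv_diff)
  then show "tail (bd M (int (Suc (Suc m))) (frag_of xs)) =
      frag_cmul scalar_sum (tail (tail (frag_of xs))) - bd M (int (Suc m)) (tail (frag_of xs))"
    unfolding tail_of multi_bd_of by (simp add: sum_subtractf frag_cmul_sum_left xs_eq)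
qed (use assms in \<open>simp_all add: additive_def lin_simps bd_simps\<close>)

end

context pointed_multispindle
begin

lemma reduced_tail_chains:
  assumes "c \<in> reduced_chains n"
  shows "reduced_tail c \<in> reduced_chains (n - 1)"
proof -
  consider "n < 0" | "n = 0" | m where "n = int (Suc m)"
    by (metis gr0_implies_Suc linorder_neqE_linordered_idom pos_int_cases)
  then show ?thesis
  proof cases
    case 1
    then have "c = 0" using assms by (simp add: reduced_chains_def tuples_neg)
    then show ?thesis by (simp add: reduced_tail_def lin_simps reduced_chains_def)
  next
    case 2
    then show ?thesis using reduced_tail_0 reduced_chains_sub assms by (simp add: reduced_tail_def reduced_chains_def)
  next
    case 3
    then have "tail c \<in> tuple_chains (int m)" using tail_chains reduced_chains_sub assms by blast
    from reduce_chains[OF this] show ?thesis using 3 by (simp add: reduced_tail_def of_nat_Suc)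
  qed
qed

lemma reduced_bd_s0:
  assumes "c \<in> reduced_chains n"
  shows "reduced_bd (n + 1) (s0 c) = frag_cmul scalar_sum (s0 (reduced_tail c)) - s0 (reduced_bd n c)"
proof -
  have cc: "c \<in> tuple_chains n" by (rule reduced_chains_sub) fact
  consider "n < 0" | "n = 0" | m where "n = int (Suc m)"
    by (metis gr0_implies_Suc linorder_neqE_linordered_idom pos_int_cases)
  then show ?thesis
  proof cases
    case 1
    then have "c = 0" using assms by (simp add: reduced_chains_def tuples_neg)
    then show ?thesis by (simp add: reduced_tail_def reduced_bd_def lin_simps bd_simps)
  next
    case 2
    have "bd M 1 (s0 c) = 0"
    proof (rule additive_eq_on_frags[where c = c and T = "tuples X 0" and g = "\<lambda>_. 0"])
      fix xs assume "xs \<in> tuples X 0"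
      then obtain y where y: "xs = [y]" "y \<in> X" by (auto simp: tuples_def length_Suc_conv)
      show "bd M 1 (s0 (frag_of xs)) = 0"
        using multi_bd_of[of X k star a 0 "[y, y]"] y star_idem[of _ y]
        by (simp add: s0_of of_nat_Suc sum.atLeast0_atMost_Suc face_0 face_def frag_cmul_distrib[symmetric])
    qed (use cc 2 in \<open>simp_all add: additive_def lin_simps bd_simps\<close>)
    then show ?thesis using 2 reduced_tail_0 cc by (simp add: reduced_tail_def reduced_bd_def lin_simps multi_bd_nonpos)
  next
    case 3
    have t: "tail c \<in> tuple_chains (int m)" using tail_chains cc 3 by blast
    have b: "bd M n c \<in> tuple_chains (n - 1)" by (rule bd_chains[OF cc])
    have n1: "n + 1 = int (Suc (Suc m))" by (simp add: 3 of_nat_Suc)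
    have "reduced_bd (n + 1) (s0 c) = reduce (frag_cmul scalar_sum (s0 (tail c)) - s0 (bd M n c))"
      unfolding reduced_bd_def n1 using bd_s0[of c m] cc by (simp add: 3)
    also have "\<dots> = frag_cmul scalar_sum (s0 (reduced_tail c)) - s0 (reduced_bd n c)"
      using reduce_s0[OF t] reduce_s0[OF b] by (simp add: lin_simps reduced_tail_def reduced_bd_def)
    finally show ?thesis .
  qed
qed

lemma reduced_tail_reduced_bd:
  assumes "c \<in> reduced_chains n"
  shows "reduced_tail (reduced_bd n c) = frag_cmul scalar_sum (reduced_tail (reduced_tail c)) - reduced_bd (n - 1) (reduced_tail c)"
proof -
  have cc: "c \<in> tuple_chains n" by (rule reduced_chains_sub) fact
  consider "n \<le> 0" | "n = 1" | m where "n = int (Suc (Suc m))"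
    by (metis gr0_implies_Suc linorder_not_le not0_implies_Suc of_nat_1 One_nat_def pos_int_cases)
  then show ?thesis
  proof cases
    case 1
    then have "reduced_tail c \<in> {0}" using reduced_tail_chains[OF assms] by (simp add: reduced_chains_def tuples_neg)
    then show ?thesis using 1 by (simp add: reduced_tail_def reduced_bd_def lin_simps multi_bd_nonpos)
  next
    case 2
    have "reduced_bd n c \<in> tuple_chains 0" 
      using reduce_chains[OF bd_chains[OF cc]] reduced_chains_sub 2 by (simp add: reduced_bd_def)
    moreover have "reduced_tail c \<in> tuple_chains 0" using reduced_chains_sub[OF reduced_tail_chains[OF assms]] 2 by simp
    ultimately have "reduced_tail (reduced_bd n c) = 0" "reduced_tail (reduced_tail c) = 0"
      using reduced_tail_0 unfolding reduced_tail_def by blast+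
    moreover have "reduced_bd (n - 1) (reduced_tail c) = 0" using 2 by (simp add: reduced_bd_def multi_bd_nonpos lin_simps)
    ultimately show ?thesis by simp
  next
    case 3
    have n: "n = int (Suc (Suc m))" "n - 1 = int (Suc m)" using 3 by (simp_all add: of_nat_Suc)
    have t: "tail c \<in> tuple_chains (n - 1)" unfolding n(2) using tail_chains cc n(1) by blast
    have "reduced_tail (reduced_bd n c) = reduce (tail (bd M n c))"
      by (simp add: reduced_tail_def reduced_bd_def reduce_tail_reduce)
    also have "\<dots> = frag_cmul scalar_sum (reduce (tail (tail c))) - reduce (bd M (n - 1) (tail c))"
      unfolding n(2) using tail_bd[of c m] cc n(1) by (simp add: lin_simps)
    also have "\<dots> = frag_cmul scalar_sum (reduced_tail (reduced_tail c)) - reduced_bd (n - 1) (reduced_tail c)"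
      using reduce_bd_reduce[OF t] by (simp add: reduced_tail_def reduced_bd_def reduce_tail_reduce)
    finally show ?thesis .
  qed
qed

lemma reduced_bd_additive: "additive (reduced_bd n)"
  by (simp add: additive_def reduced_bd_def bd_simps lin_simps)

lemma reduced_bd_chains:
  assumes "c \<in> reduced_chains n"
  shows "reduced_bd n c \<in> reduced_chains (n - 1)"
  unfolding reduced_bd_def by (intro reduce_chains bd_chains reduced_chains_sub) fact

section \<open>Homology of multispindles\<close>

sublocale degenerate_complex reduced_chains reduced_bd reduced_tail s0 scalar_sum
proof
  fix n
  show "frag_subgroup (reduced_chains n)" unfolding reduced_chains_def by (rule frag_subgroup_keys)
  show "reduced_bd n (x + y) = reduced_bd n x + reduced_bd n y" for x y by (rule additive.add[OF reduced_bd_additive])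
  show "reduced_bd n c \<in> reduced_chains (n - 1)" if "c \<in> reduced_chains n" for c by (rule reduced_bd_chains[OF that])
  show "reduced_bd n (reduced_bd (n + 1) c) = 0" if "c \<in> reduced_chains (n + 1)" for c
    using reduce_bd_reduce[of "bd M (n + 1) c" n] bd_bd[OF reduced_chains_sub[OF that]] bd_chains[OF reduced_chains_sub[OF that]]
    by (simp add: reduced_bd_def lin_simps)
  show "reduced_chains n = {0}" if "n < 0" using that by (simp add: reduced_chains_def tuples_neg)
  show "\<exists>S. finite S \<and> reduced_chains n \<subseteq> {c. Poly_Mapping.keys c \<subseteq> S}"
    using finite_tuples[OF X_finite] reduced_chains_sub by blast
  show "reduced_tail (x + y) = reduced_tail x + reduced_tail y" for x y by (simp add: reduced_tail_def lin_simps)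
  show "s0 (x + y) = s0 x + s0 y" for x y by (simp add: lin_simps)
  show "reduced_tail c \<in> reduced_chains (n - 1)" if "c \<in> reduced_chains n" for c by (rule reduced_tail_chains[OF that])
  show "s0 c \<in> reduced_chains (n + 1)" if "c \<in> reduced_chains n" for c
    using reduce_chains[OF s0_chains[OF reduced_chains_sub[OF that]]] reduce_s0[OF reduced_chains_sub[OF that]] reduce_id[OF that]
    by simp
  show "reduced_tail (s0 c) = c" if "c \<in> reduced_chains n" for c by (simp add: reduced_tail_def tail_s0 reduce_id[OF that])
  show "reduced_bd (n + 1) (s0 c) = frag_cmul scalar_sum (s0 (reduced_tail c)) - s0 (reduced_bd n c)" if "c \<in> reduced_chains n" for c
    by (rule reduced_bd_s0[OF that])
  show "reduced_tail (reduced_bd n c) = frag_cmul scalar_sum (reduced_tail (reduced_tail c)) - reduced_bd (n - 1) (reduced_tail c)"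
    if "c \<in> reduced_chains n" for c
    by (rule reduced_tail_reduced_bd[OF that])
qed

abbreviation "R \<equiv> reduced_cpx X k star a t"
abbreviation "FX n \<equiv> F0_chains X k star a t n"

definition reduce_coset :: "int \<Rightarrow> ('a list \<Rightarrow>\<^sub>0 int) set \<Rightarrow> ('a list \<Rightarrow>\<^sub>0 int)" where
  "reduce_coset n A = the_elem (reduce ` A)"

lemma grp_M: "grp M n = frag_group (tuple_chains n)"
  by (simp add: multi_cpx_def free_Abelian_group_eq_frag_group)

lemma R_eq: "R = quot_cpx M (point_chains t)"
  by (simp add: reduced_cpx_def)

lemma point_chains_eq: "point_chains t n = {c \<in> tuple_chains n. reduce c = 0}"
proof -
  have "c \<in> tuple_chains n" if "c \<in> point_chains t n" for c
    using that by (auto simp: point_chains_def tuples_point)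
  then show ?thesis using reduce_eq_0_iff by blast
qed

text \<open>
  The map \<open>reduce\<close> is a chain map onto the reduced chains whose kernel is spanned by the tuples
  \<open>(t, \<dots>, t)\<close>.
\<close>

lemma reduced_model: "frag_model reduced_chains reduced_bd R reduce_coset"
  and point_subgroup: "subgroup (point_chains t n) (frag_group (tuple_chains n))"
  and reduce_coset_coset: "c \<in> tuple_chains n \<Longrightarrow>
    reduce_coset n (point_chains t n #>\<^bsub>frag_group (tuple_chains n)\<^esub> c) = reduce c"
proof -
  have A: "comm_group (grp M n)" for n
    unfolding grp_M by (rule comm_group_frag_group[OF frag_subgroup_keys])
  have f: "reduce \<in> hom (grp M n) (frag_group (reduced_chains n))" for n
    unfolding grp_M by (rule hom_frag_group[OF reduce_additive]) (use reduce_chains in blast)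
  have im: "reduce ` carrier (grp M n) = reduced_chains n" for n
    unfolding grp_M frag_group_simps
  proof
    show "reduce ` tuple_chains n \<subseteq> reduced_chains n" using reduce_chains by blast
    show "reduced_chains n \<subseteq> reduce ` tuple_chains n"
    proof
      fix c assume c: "c \<in> reduced_chains n"
      show "c \<in> reduce ` tuple_chains n"
        using imageI[OF reduced_chains_sub[OF c], of reduce] reduce_id[OF c] by simp
    qed
  qed
  have S: "point_chains t n = {x \<in> carrier (grp M n). reduce x = 0}" for n
    unfolding grp_M frag_group_simps by (rule point_chains_eq)
  have closed: "bd M n x \<in> carrier (grp M (n - 1))" if "x \<in> carrier (grp M n)" for n x
    using bd_chains[of x n] that unfolding grp_M by simp
  have comm: "reduce (bd M n x) = reduced_bd n (reduce x)" if "x \<in> carrier (grp M n)" for n x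
    using reduce_bd_reduce[of x n] that unfolding grp_M by (simp add: reduced_bd_def)
  note q = quot_cpx_model[where f = "\<lambda>n. reduce" and A = M and S = "point_chains t", OF frag_complex_axioms A f im S closed comm]
  show "frag_model reduced_chains reduced_bd R reduce_coset"
    unfolding R_eq reduce_coset_def[abs_def] by (rule q(1))
  show "subgroup (point_chains t n) (frag_group (tuple_chains n))" using q(2)[of n] unfolding grp_M .
  show "reduce_coset n (point_chains t n #>\<^bsub>frag_group (tuple_chains n)\<^esub> c) = reduce c" if "c \<in> tuple_chains n"
    using q(3)[of c n] that unfolding grp_M reduce_coset_def by simp
qed

sublocale R: frag_model reduced_chains reduced_bd R reduce_coset by (rule reduced_model)

lemma carrier_R: "carrier (grp R n) = (\<lambda>c. point_chains t n #>\<^bsub>frag_group (tuple_chains n)\<^esub> c) ` tuple_chains n"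
  by (simp add: R_eq quot_cpx_def carrier_FactGroup grp_M)

text \<open>
  As \<open>reduce\<close> commutes with \<open>s0\<close>, the degenerate classes correspond to the image of \<open>s0\<close> on reduced
  chains.
\<close>

lemma FX_eq: "FX n = {A \<in> carrier (grp R n). reduce_coset n A \<in> F n}"
proof -
  let ?co = "\<lambda>n c. point_chains t n #>\<^bsub>frag_group (tuple_chains n)\<^esub> c"
  have s0_c: "s0 c \<in> tuple_chains n" if "c \<in> tuple_chains (n - 1)" for c
    using s0_chains[OF that] by simp
  have "coset_map (grp M n) (point_chains t n) s0 (?co (n - 1) c) = ?co n (s0 c)"
    if c: "c \<in> tuple_chains (n - 1)" for c
    unfolding grp_M
  proof (rule coset_map_coset)
    show "comm_group (frag_group (tuple_chains n))" by (rule comm_group_frag_group[OF frag_subgroup_keys])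
    show "group (frag_group (tuple_chains (n - 1)))"
      using comm_group_frag_group[OF frag_subgroup_keys] comm_group_def by blast
    fix y assume "y \<in> ?co (n - 1) c"
    then obtain h where h: "h \<in> point_chains t (n - 1)" "y = h + c" by (auto simp: r_coset_def)
    have "s0 h \<in> point_chains t n"
      using h(1) s0_c[of h] reduce_s0[of h "n - 1"] by (simp add: point_chains_eq lin_simps)
    then show "s0 y \<in> ?co n (s0 c)" by (auto simp: r_coset_def h(2) lin_simps)
  qed (use c s0_c point_subgroup in auto)
  then have FX: "FX n = (\<lambda>c. ?co n (s0 c)) ` tuple_chains (n - 1)"
    unfolding F0_chains_def carrier_R image_image by (rule image_cong[OF refl])
  show ?thesis
  proof
    show "FX n \<subseteq> {A \<in> carrier (grp R n). reduce_coset n A \<in> F n}"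
    proof
      fix A assume "A \<in> FX n"
      then obtain c where c: "c \<in> tuple_chains (n - 1)" "A = ?co n (s0 c)" by (auto simp: FX)
      have "reduce_coset n A = s0 (reduce c)"
        using reduce_coset_coset[OF s0_c[OF c(1)]] reduce_s0[OF c(1)] c(2) by simp
      then have "reduce_coset n A \<in> F n" using reduce_chains[OF c(1)] by (simp add: F_def)
      moreover have "A \<in> carrier (grp R n)" using c s0_c unfolding carrier_R by blast
      ultimately show "A \<in> {A \<in> carrier (grp R n). reduce_coset n A \<in> F n}" by blast
    qed
    show "{A \<in> carrier (grp R n). reduce_coset n A \<in> F n} \<subseteq> FX n"
    proof
      fix A assume "A \<in> {A \<in> carrier (grp R n). reduce_coset n A \<in> F n}"
      then obtain c where A: "A \<in> carrier (grp R n)" and c: "c \<in> reduced_chains (n - 1)" "reduce_coset n A = s0 c"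
        by (auto simp: F_def)
      have cc: "c \<in> tuple_chains (n - 1)" using reduced_chains_sub[OF c(1)] .
      have "reduce_coset n (?co n (s0 c)) = reduce_coset n A"
        using reduce_coset_coset[OF s0_c[OF cc]] reduce_s0[OF cc] reduce_id[OF c(1)] c(2) by simp
      moreover have "?co n (s0 c) \<in> carrier (grp R n)" using s0_c[OF cc] unfolding carrier_R by blast
      ultimately have "A = ?co n (s0 c)" using R.p_inj[of n] A by (auto dest: inj_onD)
      then show "A \<in> FX n" using cc unfolding FX by blast
    qed
  qed
qed

lemma F0_model: "frag_model F reduced_bd (F0_cpx X k star a t) reduce_coset"
proof (intro frag_model.intro frag_model_axioms.intro F_complex)
  fix n
  have g: "grp (F0_cpx X k star a t) n = (grp R n)\<lparr>carrier := {A \<in> carrier (grp R n). reduce_coset n A \<in> F n}\<rparr>" for n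
    by (simp add: F0_cpx_def sub_cpx_def FX_eq)
  have b: "bd (F0_cpx X k star a t) = bd R" by (simp add: F0_cpx_def sub_cpx_def)
  note v = iso_restrict_vimage[OF R.Q_group R.p_iso C_subgroup F.C_subgroup]
  show "comm_group (grp (F0_cpx X k star a t) n)" "reduce_coset n \<in> iso (grp (F0_cpx X k star a t) n) (frag_group (F n))"
    unfolding g using v F_C by blast+
  fix A assume "A \<in> carrier (grp (F0_cpx X k star a t) n)"
  then have A: "A \<in> carrier (grp R n)" "reduce_coset n A \<in> F n" by (auto simp: g)
  show "bd (F0_cpx X k star a t) n A \<in> carrier (grp (F0_cpx X k star a t) (n - 1))"
    using R.Q_bd_closed[OF A(1)] R.p_bd[OF A(1)] F.D_closed[OF A(2)] by (simp add: g b)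
  show "reduce_coset (n - 1) (bd (F0_cpx X k star a t) n A) = reduced_bd n (reduce_coset n A)"
    unfolding b by (rule R.p_bd[OF A(1)])
qed

text \<open>
  The chain map \<open>1 - s d\<close> is onto \<open>K\<close> and has the kernel \<open>F\<close>.
\<close>

lemma mod_F0_model: "\<exists>p. frag_model K reduced_bd (mod_F0_cpx X k star a t) p"
proof -
  let ?f = "\<lambda>n A. reduce_coset n A - s0 (reduced_tail (reduce_coset n A))"
  have pK: "?f n A \<in> K n" if "A \<in> carrier (grp R n)" for n A
    using proj_K[OF R.p_closed[OF that]] .
  have f: "?f n \<in> hom (grp R n) (frag_group (K n))" for n
  proof (rule homI)
    fix A B assume "A \<in> carrier (grp R n)" "B \<in> carrier (grp R n)"
    then show "?f n (A \<otimes>\<^bsub>grp R n\<^esub> B) = ?f n A \<otimes>\<^bsub>frag_group (K n)\<^esub> ?f n B"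
      using hom_mult[OF R.p_hom, of A n B] by (simp add: d_simps s_simps)
  qed (use pK in simp)
  have im: "?f n ` carrier (grp R n) = K n" for n
  proof
    show "?f n ` carrier (grp R n) \<subseteq> K n" using pK by blast
    show "K n \<subseteq> ?f n ` carrier (grp R n)"
    proof
      fix c assume c: "c \<in> K n"
      then obtain A where A: "A \<in> carrier (grp R n)" "c = reduce_coset n A" 
        using R.p_image[of n] K_C by blast
      have "?f n A = c" using c by (simp add: A(2)[symmetric] K_def s_simps)
      then show "c \<in> ?f n ` carrier (grp R n)" using A(1) by blast
    qed
  qed
  have S: "FX n = {A \<in> carrier (grp R n). ?f n A = 0}" for n
    unfolding FX_eq using R.p_closed by (auto simp: F_iff)
  have comm: "?f (n - 1) (bd R n A) = reduced_bd n (?f n A)" if A: "A \<in> carrier (grp R n)" for n A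
    using D_proj[OF R.p_closed[OF A]] by (simp add: R.p_bd[OF A] D_simps)
  show ?thesis
    unfolding mod_F0_cpx_def
    using quot_cpx_model(1)[where f = ?f and A = R and S = "F0_chains X k star a t",
        OF K_complex R.Q_group f im S R.Q_bd_closed comm] by blast
qed

end

lemma torsion_group_iso:
  assumes "comm_group G" "comm_group H" "G \<cong> H" "carrier G \<subseteq> torsion_elements G"
  shows "carrier H \<subseteq> torsion_elements H"
proof
  obtain f where f: "f \<in> iso G H" using assms(3) by (auto simp: is_iso_def)
  then have fh: "f \<in> hom G H" and im: "f ` carrier G = carrier H" by (auto simp: iso_iff)
  have g: "group G" "group H" using assms(1,2) comm_group_def by blast+
  fix y assume "y \<in> carrier H"
  then obtain x where x: "x \<in> carrier G" "y = f x" using im by auto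
  then obtain m :: nat where m: "m > 0" "x [^]\<^bsub>G\<^esub> m = \<one>\<^bsub>G\<^esub>"
    using assms(4) by (auto simp: torsion_elements_def)
  have "y [^]\<^bsub>H\<^esub> m = \<one>\<^bsub>H\<^esub>"
    using hom_nat_pow[OF fh x(1) g, of m] hom_one[OF fh g] m(2) x(2) by simp
  then show "y \<in> torsion_elements H" using m(1) \<open>y \<in> carrier H\<close> by (auto simp: torsion_elements_def)
qed

lemma trivial_free_part_imp_torsion:
  assumes "group G" "trivial_group (free_part G)"
  shows "carrier G \<subseteq> torsion_elements G"
proof
  let ?T = "torsion_elements G"
  interpret group G by fact
  fix x assume x: "x \<in> carrier G"
  have "?T #>\<^bsub>G\<^esub> x \<in> carrier (free_part G)" using x by (simp add: free_part_def carrier_FactGroup)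
  then have "?T #>\<^bsub>G\<^esub> x = ?T"
    using assms(2) by (simp add: trivial_group_def free_part_def)
  moreover have "\<one>\<^bsub>G\<^esub> \<in> ?T" by (auto simp: torsion_elements_def intro: exI[of _ 1])
  then have "x \<in> ?T #>\<^bsub>G\<^esub> x" using x by (force simp: r_coset_def)
  ultimately show "x \<in> ?T" by simp
qed

lemma free_abelian_torsion_free:
  fixes H :: "'h monoid"
  assumes "comm_group G" "is_free_abelian H" "G \<cong> H" "m \<noteq> 0" "x \<in> carrier G" "x [^]\<^bsub>G\<^esub> (m::int) = \<one>\<^bsub>G\<^esub>"
  shows "x = \<one>\<^bsub>G\<^esub>"
proof -
  obtain B :: "'h set" where "H \<cong> free_Abelian_group B" using assms(2) by (auto simp: is_free_abelian_def)
  then have "G \<cong> free_Abelian_group B" using assms(3) iso_trans by blast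
  then obtain f where f: "f \<in> iso G (free_Abelian_group B)" by (auto simp: is_iso_def)
  then have fh: "f \<in> hom G (free_Abelian_group B)" and inj: "inj_on f (carrier G)" by (auto simp: iso_iff)
  interpret comm_group G by fact
  have keys: "Poly_Mapping.keys (f x) \<subseteq> B" using hom_in_carrier[OF fh assms(5)] by simp
  have f1: "f \<one>\<^bsub>G\<^esub> = 0" using hom_one[OF fh is_group] by simp
  have "frag_cmul m (f x) = f (x [^]\<^bsub>G\<^esub> m)"
    using comm_group_hom_int_pow[OF assms(1) abelian_free_Abelian_group fh assms(5), of m] keys by simp
  then have "frag_cmul m (f x) = 0" using assms(6) f1 by simp
  then have "f x = f \<one>\<^bsub>G\<^esub>" using assms(4) f1 by simp
  then show ?thesis using inj assms(5) by (auto dest: inj_onD)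
qed

theorem proposition5p2:
  fixes X :: "'a set" and k :: nat and star :: "nat \<Rightarrow> 'a \<Rightarrow> 'a \<Rightarrow> 'a"
    and a :: "nat \<Rightarrow> int" and t :: 'a
  assumes "multispindle X k star" and "finite X" and "t \<in> X"
  shows
    "((\<Sum>i=1..k. a i) = 0 \<or>
      (\<forall>n\<ge>0. trivial_group (free_part (homology (reduced_cpx X k star a t) n))) \<longrightarrow>
        (\<forall>n\<ge>0. homology (F0_cpx X k star a t) (n + 1)
           \<cong> tensor (homology (reduced_cpx X k star a t) n) (Z_mod (\<Sum>i=1..k. a i)))) \<and>
     ((\<Sum>i=1..k. a i) \<noteq> 0 \<and>
      (\<forall>n\<ge>0. is_free_abelian (homology (mod_F0_cpx X k star a t) n)) \<longrightarrow>
        (\<forall>n\<ge>0. homology (F0_cpx X k star a t) (n + 1)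
           \<cong> homology (F0_cpx X k star a t) (n - 1) \<times>\<times>
              tensor (homology (mod_F0_cpx X k star a t) n) (Z_mod (\<Sum>i=1..k. a i))))"
proof -
  interpret pointed_multispindle X k star a t
    using assms by (simp add: pointed_multispindle_def)
  obtain p where "frag_model K reduced_bd (mod_F0_cpx X k star a t) p" using mod_F0_model by blast
  then interpret MF: frag_model K reduced_bd "mod_F0_cpx X k star a t" p .
  interpret F0: frag_model F reduced_bd "F0_cpx X k star a t" reduce_coset by (rule F0_model)
  let ?R = "reduced_cpx X k star a t" and ?F = "F0_cpx X k star a t" and ?Q = "mod_F0_cpx X k star a t"
  note HR = comm_group_iso_sym[OF R.homology_comm_group R.homology_iso]
  note HF0 = comm_group_iso_sym[OF F0.homology_comm_group F0.homology_iso]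
  note HQ = comm_group_iso_sym[OF MF.homology_comm_group MF.homology_iso]
  have HR_tensor: "mult_quotient (HC n) scalar_sum \<cong> tensor (homology ?R n) (Z_mod scalar_sum)" for n
    by (rule iso_trans[OF mult_quotient_iso[OF cg_HC R.homology_comm_group HR]
          mult_quotient_iso_tensor_Z_mod[OF R.homology_comm_group]])
  have HQ_tensor: "mult_quotient (HK n) scalar_sum \<cong> tensor (homology ?Q n) (Z_mod scalar_sum)" for n
    by (rule iso_trans[OF mult_quotient_iso[OF cg_HK MF.homology_comm_group HQ]
          mult_quotient_iso_tensor_Z_mod[OF MF.homology_comm_group]])
  have 1: "homology ?F (n + 1) \<cong> tensor (homology ?R n) (Z_mod scalar_sum)"
    if hyp: "scalar_sum = 0 \<or> (\<forall>n\<ge>0. trivial_group (free_part (homology ?R n)))" and n: "n \<ge> 0" for n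
  proof -
    have "HF (n + 1) \<cong> mult_quotient (HC n) scalar_sum"
      using hyp
    proof
      assume "scalar_sum = 0"
      then show ?thesis by (rule HF_iso_of_zero)
    next
      assume triv: "\<forall>n\<ge>0. trivial_group (free_part (homology ?R n))"
      show ?thesis
      proof (rule HF_iso_of_torsion[OF _ n])
        fix n :: int assume "n \<ge> 0"
        then have "carrier (homology ?R n) \<subseteq> torsion_elements (homology ?R n)"
          using triv trivial_free_part_imp_torsion R.homology_comm_group comm_group_def by blast
        then show "carrier (HC n) \<subseteq> torsion_elements (HC n)"
          by (rule torsion_group_iso[OF R.homology_comm_group cg_HC R.homology_iso])
      qed
    qed
    then show ?thesis by (rule iso_trans[OF F0.homology_iso iso_trans[OF _ HR_tensor]])
  qed
  have 2: "homology ?F (n + 1) \<cong> homology ?F (n - 1) \<times>\<times> tensor (homology ?Q n) (Z_mod scalar_sum)"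
    if "scalar_sum \<noteq> 0" and free: "\<forall>n\<ge>0. is_free_abelian (homology ?Q n)" for n
  proof -
    have "HF (n + 1) \<cong> HF (n - 1) \<times>\<times> mult_quotient (HK n) scalar_sum"
    proof (rule HF_iso_of_torsion_free)
      fix n x assume "0 \<le> n" "x \<in> carrier (HK n)" "x [^]\<^bsub>HK n\<^esub> scalar_sum = \<one>\<^bsub>HK n\<^esub>"
      with free that(1) show "x = \<one>\<^bsub>HK n\<^esub>"
        by (intro free_abelian_torsion_free[OF cg_HK _ HQ, of n scalar_sum x]) simp_all
    qed
    then show ?thesis
      by (rule iso_trans[OF F0.homology_iso iso_trans[OF _ DirProd_iso_cong[OF HF0 HQ_tensor]]])
  qed
  show ?thesis
    by (intro conjI impI allI) (erule (1) 1, erule conjE, erule (1) 2)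
qed

end
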